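(* Let $\tilde s=(\tilde u,\tilde v,\tilde f)\in\mathcal S_{ad}$ be a local optimal solution of the control problem of minimizing $J$ over $\mathcal S_{ad}$, and let $(\lambda,\eta,\varphi_1,\varphi_2)$ be a Lagrange multiplier at $\tilde s$ (as defined in the context). Then $(\lambda,\eta)\in L^2(Q)\times L^{4/3}(Q)$ satisfies $$\int_0^T\!\!\int_\Omega\big(\partial_tU-\Delta U-\nabla\cdot(U\nabla\tilde{v})\big)\lambda-\int_0^T\!\!\int_\Omega U\eta=\alpha_u\int_0^T\!\!\int_{\Omega}\mathrm{sgn}(\tilde{u}-u_d)|\tilde{u}-u_d|^{13/7}U\qquad\forall\,U\in\mathcal W_{u_0},$$ $$\int_0^T\!\!\int_\Omega\big(\partial_t V-\Delta V+V\big)\eta-\int_0^T\!\!\int_{\Omega_c}\tilde{f}V\eta-\int_0^T\!\!\int_\Omega\nabla\cdot(\tilde{u}\nabla V)\lambda=\alpha_v\int_0^T\!\!\int_{\Omega}(\tilde{v}-v_d)V\qquad\forall\,V\in\mathcal W_{v_0},$$ and the optimality condition $$\int_0^T\!\!\int_{\Omega_c}\big(\alpha_f(\tilde{f})^3+\tilde{v}\eta\big)(f-\tilde{f})\ge 0\qquad\forall f\in\mathcal F.$$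
   Context: $\Omega\subset\mathbb{R}^3$ is a simply connected bounded domain with boundary $\partial\Omega$ of class $C^2$, $\mathbf n$ is its outward unit normal, $0<T<+\infty$, $Q=(0,T)\times\Omega$. $\Omega_c\subset\Omega$ is the control subdomain with characteristic function $\chi_{\Omega_c}$, and $L^4(Q_c):=L^4(0,T;L^4(\Omega_c))$; functions on $\Omega_c$ multiplied by $\chi_{\Omega_c}$ are extended by zero. $L^p(X):=L^p(0,T;X)$; $L^p(Q)=L^p(0,T;L^p(\Omega))$; $X'$ is the topological dual of $X$. $W^{m,p}_{\mathbf n}(\Omega)=\{u\in W^{m,p}(\Omega):\frac{\partial u}{\partial\mathbf n}=0\text{ on }\partial\Omega\}$. $\widehat W^{2-2/p,p}(\Omega)$ is $W^{2-2/p,p}(\Omega)$ if $p<3$ and $W^{2-2/p,p}_{\mathbf n}(\Omega)$ if $p>3$. $X_p:=\{u\in C([0,T];\widehat W^{2-2/p,p}(\Omega))\cap L^p(W^{2,p}(\Omega)):\ \partial_tu\in L^p(Q)\}$. $\mathcal W_u:=\{u\in X_2:\frac{\partial u}{\partial\mathbf n}=0\text{ on }(0,T)\times\partial\Omega\}$, $\mathcal W_v:=\{v\in X_4:\frac{\partial v}{\partial\mathbf n}=0\text{ on }(0,T)\times\partial\Omega\}$, $\mathcal W_{u_0}:=\{u\in\mathcal W_u:u(0)=0\}$, $\mathcal W_{v_0}:=\{v\in\mathcal W_v:v(0)=0\}$. Data: $u_0\in H^1(\Omega)$, $v_0\in W^{3/2,4}_{\mathbf n}(\Omega)$, $u_0,v_0\ge0$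 in $\Omega$; $\mathcal F\subset L^4(Q_c)$ is a nonempty convex set; $u_d\in L^{26/7}(Q)$, $v_d\in L^2(Q)$; $\alpha_u>0$, $\alpha_v\ge0$, $\alpha_f\ge0$. The cost functional is $$J(u,v,f)=\frac{7\alpha_u}{20}\int_0^T\|u-u_d\|^{20/7}_{L^{20/7}(\Omega)}dt+\frac{\alpha_v}{2}\int_0^T\|v-v_d\|^2_{L^2(\Omega)}dt+\frac{\alpha_f}{4}\int_0^T\|f\|^4_{L^4(\Omega_c)}dt.$$ For $f\in L^4(Q_c)$, a strong solution $(u,v)$ of $$\partial_t u-\Delta u=\nabla\cdot(u\nabla v),\quad \partial_t v-\Delta v+v=u+f\,v\,\chi_{\Omega_c}\ \text{ in }Q,$$ $u(0)=u_0$, $v(0)=v_0$ in $\Omega$, $\frac{\partial u}{\partial\mathbf n}=\frac{\partial v}{\partial\mathbf n}=0$ on $(0,T)\times\partial\Omega$, is a pair $(u,v)\in X_2\times X_4$ with $u\ge0$, $v\ge0$ in $Q$, satisfying the equations a.e. in $Q$ and the initial and boundary conditions. The admissible set $\mathcal S_{ad}$ consists of all $(u,v,f)\in X_2\times X_4\times\mathcal F$ such that $(u,v)$ is a strong solution of this problem with control $f$. An element $\tilde s\in\mathcal S_{ad}$ is a local optimal solution if $J(\tilde s)\le J(s)$ for all $s\in\mathcal S_{ad}$ in some neighbourhood of $\tilde s$ in $\mathcal W_u\times\mathcal W_v\times L^4(Q_c)$. $\mathcal C(\tilde f):=\{\theta(f-\tilde f):\theta\ge0,\ f\in\mathcal F\}$.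 A Lagrange multiplier at $\tilde s$ is a quadruple $(\lambda,\eta,\varphi_1,\varphi_2)\in L^2(Q)\times L^{4/3}(Q)\times (H^1(\Omega))'\times (W^{3/2,4}_{\mathbf n}(\Omega))'$ such that for all $(U,V,F)\in\mathcal W_u\times\mathcal W_v\times\mathcal C(\tilde f)$ $$\begin{aligned} &\alpha_u\int_0^T\!\!\int_{\Omega}\mathrm{sgn}(\tilde{u}-u_d)|\tilde{u}-u_d|^{13/7}U+\alpha_v\int_0^T\!\!\int_{\Omega}(\tilde{v}-v_d)V+\alpha_f\int_0^T\!\!\int_{\Omega_c}(\tilde{f})^3F\\ &-\int_0^T\!\!\int_\Omega\big(\partial_tU-\Delta U-\nabla\cdot(U\nabla\tilde{v})-\nabla\cdot(\tilde{u}\nabla V)\big)\lambda -\int_0^T\!\!\int_\Omega\big(\partial_tV-\Delta V+V-U-\tilde{f}V\chi_{\Omega_c}\big)\eta\\ &-\langle\varphi_1,U(0)\rangle-\langle\varphi_2,V(0)\rangle+\int_0^T\!\!\int_{\Omega_c}F\tilde{v}\eta\ \ge\ 0. \end{aligned}$$ *)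

theory Defs
  imports "HOL-Analysis.Analysis"
begin

text \<open>
  Elements of Lebesgue and Sobolev spaces are represented by Borel functions on the ambient
  space; only their values on the set under consideration matter, up to null sets. A function
  on the cylinder \<open>{0<..<T} \<times> \<Omega>\<close> is a curried function \<open>u t x\<close>.
\<close>

section \<open>Classical derivatives and test functions\<close>

text \<open>\<open>pd [b1, \<dots>, bk] f\<close> is the iterated directional derivative along \<open>b1, \<dots>, bk\<close>;
  lists of basis vectors play the role of multi-indices.\<close>

fun pd :: "'a::euclidean_space list \<Rightarrow> ('a \<Rightarrow> real) \<Rightarrow> 'a \<Rightarrow> real" where
  "pd [] f = f"
| "pd (b # bs) f = pd bs (\<lambda>x. frechet_derivative f (at x) b)"

definition multi_indices :: "nat \<Rightarrow> 'a::euclidean_space list set" where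
  "multi_indices m = {bs. set bs \<subseteq> Basis \<and> length bs \<le> m}"

text \<open>Meaningful for open \<open>S\<close> only.\<close>

definition Ck_on :: "nat \<Rightarrow> 'a::euclidean_space set \<Rightarrow> ('a \<Rightarrow> real) \<Rightarrow> bool" where
  "Ck_on k S f \<longleftrightarrow>
     (\<forall>bs\<in>multi_indices k. continuous_on S (pd bs f)) \<and>
     (\<forall>bs\<in>multi_indices k. length bs < k \<longrightarrow> (\<forall>x\<in>S. pd bs f differentiable at x))"

definition smooth :: "('a::euclidean_space \<Rightarrow> real) \<Rightarrow> bool" where
  "smooth f \<longleftrightarrow> (\<forall>k. Ck_on k UNIV f)"

definition test_function :: "'a::euclidean_space set \<Rightarrow> ('a \<Rightarrow> real) \<Rightarrow> bool" where
  "test_function S \<phi> \<longleftrightarrow> smooth \<phi> \<and> (\<exists>K. compact K \<and> K \<subseteq> S \<and> (\<forall>x. x \<notin> K \<longrightarrow> \<phi> x = 0))"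

section \<open>Lebesgue spaces and weak derivatives\<close>

definition locally_integrable :: "'a::euclidean_space set \<Rightarrow> ('a \<Rightarrow> real) \<Rightarrow> bool" where
  "locally_integrable S f \<longleftrightarrow> (\<forall>K. compact K \<and> K \<subseteq> S \<longrightarrow> set_integrable lborel K f)"

definition Lp_space :: "'a::euclidean_space set \<Rightarrow> real \<Rightarrow> ('a \<Rightarrow> real) set" where
  "Lp_space A p =
     {f. set_borel_measurable lborel A f \<and> set_integrable lborel A (\<lambda>x. \<bar>f x\<bar> powr p)}"

definition Lp_norm :: "'a::euclidean_space set \<Rightarrow> real \<Rightarrow> ('a \<Rightarrow> real) \<Rightarrow> real" where
  "Lp_norm A p f = (LBINT x:A. \<bar>f x\<bar> powr p) powr (1 / p)"

definition has_weak_deriv ::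
  "'a::euclidean_space set \<Rightarrow> 'a list \<Rightarrow> ('a \<Rightarrow> real) \<Rightarrow> ('a \<Rightarrow> real) \<Rightarrow> bool" where
  "has_weak_deriv S bs f g \<longleftrightarrow>
     locally_integrable S f \<and> locally_integrable S g \<and>
     (\<forall>\<phi>. test_function S \<phi> \<longrightarrow>
        (LBINT x:S. f x * pd bs \<phi> x) = (-1) ^ length bs * (LBINT x:S. g x * \<phi> x))"

text \<open>A representative of the weak derivative, which is unique up to null sets; zero by
  convention if there is none.\<close>

definition weak_deriv ::
  "'a::euclidean_space set \<Rightarrow> 'a list \<Rightarrow> ('a \<Rightarrow> real) \<Rightarrow> 'a \<Rightarrow> real" where
  "weak_deriv S bs f =
     (if \<exists>g. has_weak_deriv S bs f g then SOME g. has_weak_deriv S bs f g else (\<lambda>_. 0))"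

section \<open>Sobolev spaces of integer and fractional order\<close>

text \<open>For \<open>s = m + \<sigma>\<close> with \<open>m\<close> an integer and \<open>0 \<le> \<sigma> < 1\<close>, \<open>sobolev \<Omega> s p\<close> is
  \<open>W\<^sup>m\<^sup>,\<^sup>p\<close> if \<open>\<sigma> = 0\<close>; otherwise it is the Sobolev-Slobodeckij space, where in addition the
  derivatives of order \<open>m\<close> have finite Gagliardo seminorm of order \<open>\<sigma>\<close>.\<close>

definition gagliardo :: "real \<Rightarrow> real \<Rightarrow> ('a::euclidean_space \<Rightarrow> real) \<Rightarrow> 'a \<times> 'a \<Rightarrow> real" where
  "gagliardo \<sigma> p g =
     (\<lambda>(x, y). \<bar>g x - g y\<bar> powr p / norm (x - y) powr (real DIM('a) + \<sigma> * p))"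

definition sobolev :: "'a::euclidean_space set \<Rightarrow> real \<Rightarrow> real \<Rightarrow> ('a \<Rightarrow> real) set" where
  "sobolev \<Omega> s p =
     {u \<in> Lp_space \<Omega> p.
        \<forall>bs\<in>multi_indices (nat \<lfloor>s\<rfloor>). \<exists>g\<in>Lp_space \<Omega> p. has_weak_deriv \<Omega> bs u g \<and>
          (length bs = nat \<lfloor>s\<rfloor> \<and> frac s > 0 \<longrightarrow>
             set_integrable lborel (\<Omega> \<times> \<Omega>) (gagliardo (frac s) p g))}"

definition sobolev_norm :: "'a::euclidean_space set \<Rightarrow> real \<Rightarrow> real \<Rightarrow> ('a \<Rightarrow> real) \<Rightarrow> real" where
  "sobolev_norm \<Omega> s p u =
     ((\<Sum>bs\<in>multi_indices (nat \<lfloor>s\<rfloor>). LBINT x:\<Omega>. \<bar>weak_deriv \<Omega> bs u x\<bar> powr p) +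
      (if frac s > 0 then
         (\<Sum>bs | bs \<in> multi_indices (nat \<lfloor>s\<rfloor>) \<and> length bs = nat \<lfloor>s\<rfloor>.
            LBINT z:\<Omega> \<times> \<Omega>. gagliardo (frac s) p (weak_deriv \<Omega> bs u) z)
       else 0)) powr (1 / p)"

section \<open>Domains, boundary traces and normal derivatives\<close>

definition domain :: "'a::euclidean_space set \<Rightarrow> bool" where
  "domain \<Omega> \<longleftrightarrow> open \<Omega> \<and> connected \<Omega> \<and> \<Omega> \<noteq> {}"

definition gradient :: "('a::euclidean_space \<Rightarrow> real) \<Rightarrow> 'a \<Rightarrow> 'a" where
  "gradient \<rho> x = (\<Sum>b\<in>Basis. frechet_derivative \<rho> (at x) b *\<^sub>R b)"

definition C2_defining_function ::
  "'a::euclidean_space set \<Rightarrow> 'a set \<Rightarrow> ('a \<Rightarrow> real) \<Rightarrow> bool" where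
  "C2_defining_function \<Omega> N \<rho> \<longleftrightarrow>
     open N \<and> Ck_on 2 N \<rho> \<and> (\<forall>y\<in>N. gradient \<rho> y \<noteq> 0) \<and> \<Omega> \<inter> N = {y \<in> N. \<rho> y < 0}"

definition C2_boundary :: "'a::euclidean_space set \<Rightarrow> bool" where
  "C2_boundary \<Omega> \<longleftrightarrow> (\<forall>x\<in>frontier \<Omega>. \<exists>N \<rho>. x \<in> N \<and> C2_defining_function \<Omega> N \<rho>)"

definition outward_normal :: "'a::euclidean_space set \<Rightarrow> 'a \<Rightarrow> 'a" where
  "outward_normal \<Omega> x =
     (THE \<nu>. \<exists>N \<rho>. x \<in> N \<and> C2_defining_function \<Omega> N \<rho> \<and>
        \<nu> = gradient \<rho> x /\<^sub>R norm (gradient \<rho> x))"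

text \<open>Two-dimensional Hausdorff measure, normalised to agree with surface area; \<open>\<pi> / 4\<close> is
  the area of a disc of unit diameter.\<close>

definition hausdorff2 :: "(real^3) set \<Rightarrow> ennreal" where
  "hausdorff2 A =
     (SUP \<delta>\<in>{0<..}. INF U\<in>{U :: nat \<Rightarrow> (real^3) set.
          A \<subseteq> (\<Union>i. U i) \<and> (\<forall>i. bounded (U i) \<and> diameter (U i) \<le> (\<delta>::real))}.
        \<Sum>i. ennreal (pi / 4 * (diameter (U i))\<^sup>2))"

definition surface_measure :: "(real^3) set \<Rightarrow> (real^3) measure" where
  "surface_measure \<Omega> = measure_of UNIV (sets borel) (\<lambda>A. hausdorff2 (A \<inter> frontier \<Omega>))"

text \<open>The trace operator on \<open>W\<^sup>s\<^sup>,\<^sup>p\<close>, \<open>s > 1 / p\<close>, is the continuous extension of the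
  restriction to the boundary from smooth functions to \<open>L\<^sup>p(\<partial>\<Omega>)\<close>.\<close>

definition has_trace ::
  "(real^3) set \<Rightarrow> real \<Rightarrow> real \<Rightarrow> (real^3 \<Rightarrow> real) \<Rightarrow> (real^3 \<Rightarrow> real) \<Rightarrow> bool" where
  "has_trace \<Omega> s p w g \<longleftrightarrow>
     w \<in> sobolev \<Omega> s p \<and>
     g \<in> borel_measurable (surface_measure \<Omega>) \<and>
     integrable (surface_measure \<Omega>) (\<lambda>x. \<bar>g x\<bar> powr p) \<and>
     (\<exists>\<phi> :: nat \<Rightarrow> real^3 \<Rightarrow> real. (\<forall>k. smooth (\<phi> k)) \<and>
        (\<lambda>k. sobolev_norm \<Omega> s p (\<lambda>x. \<phi> k x - w x)) \<longlonglongrightarrow> 0 \<and>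
        (\<lambda>k. LINT x|surface_measure \<Omega>. \<bar>\<phi> k x - g x\<bar> powr p) \<longlonglongrightarrow> 0)"

text \<open>\<open>\<partial>u/\<partial>n = 0\<close> on the boundary, for \<open>u\<close> in \<open>W\<^sup>s\<^sup>,\<^sup>p\<close> with \<open>s > 1 + 1 / p\<close>; here \<open>h b\<close> is the
  trace of the weak derivative of \<open>u\<close> along \<open>b\<close>.\<close>

definition normal_deriv_zero ::
  "(real^3) set \<Rightarrow> real \<Rightarrow> real \<Rightarrow> (real^3 \<Rightarrow> real) \<Rightarrow> bool" where
  "normal_deriv_zero \<Omega> s p u \<longleftrightarrow>
     (\<exists>G h. (\<forall>b\<in>Basis. has_weak_deriv \<Omega> [b] u (G b) \<and> has_trace \<Omega> (s - 1) p (G b) (h b)) \<and>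
        (AE x in surface_measure \<Omega>. (\<Sum>b\<in>Basis. h b x * (outward_normal \<Omega> x \<bullet> b)) = 0))"

definition sobolev_n :: "(real^3) set \<Rightarrow> real \<Rightarrow> real \<Rightarrow> (real^3 \<Rightarrow> real) set" where
  "sobolev_n \<Omega> s p = {u \<in> sobolev \<Omega> s p. normal_deriv_zero \<Omega> s p u}"

text \<open>Intended for \<open>p \<noteq> 3\<close>.\<close>

definition sobolev_hat :: "(real^3) set \<Rightarrow> real \<Rightarrow> (real^3 \<Rightarrow> real) set" where
  "sobolev_hat \<Omega> p =
     (if p < 3 then sobolev \<Omega> (2 - 2 / p) p else sobolev_n \<Omega> (2 - 2 / p) p)"

text \<open>The dual of the normed space of functions \<open>X\<close> with norm \<open>N\<close>. Boundedness makes the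
  functionals well defined on classes modulo null sets.\<close>

definition dual_space ::
  "('a \<Rightarrow> real) set \<Rightarrow> (('a \<Rightarrow> real) \<Rightarrow> real) \<Rightarrow> (('a \<Rightarrow> real) \<Rightarrow> real) set" where
  "dual_space X N =
     {\<Phi>. (\<forall>u\<in>X. \<forall>w\<in>X. \<Phi> (\<lambda>x. u x + w x) = \<Phi> u + \<Phi> w) \<and>
         (\<forall>c. \<forall>u\<in>X. \<Phi> (\<lambda>x. c * u x) = c * \<Phi> u) \<and>
         (\<exists>C. \<forall>u\<in>X. \<bar>\<Phi> u\<bar> \<le> C * N u)}"

section \<open>Function spaces on the cylinder\<close>

definition cyl :: "real \<Rightarrow> 'a set \<Rightarrow> (real \<times> 'a) set" where
  "cyl T A = {0<..<T} \<times> A"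

definition cyl_Lp :: "real \<Rightarrow> (real^3) set \<Rightarrow> real \<Rightarrow> (real \<Rightarrow> real^3 \<Rightarrow> real) set" where
  "cyl_Lp T A p = {u. case_prod u \<in> Lp_space (cyl T A) p}"

definition cyl_Lp_norm ::
  "real \<Rightarrow> (real^3) set \<Rightarrow> real \<Rightarrow> (real \<Rightarrow> real^3 \<Rightarrow> real) \<Rightarrow> real" where
  "cyl_Lp_norm T A p u = Lp_norm (cyl T A) p (case_prod u)"

definition cyl_int :: "real \<Rightarrow> (real^3) set \<Rightarrow> (real \<Rightarrow> real^3 \<Rightarrow> real) \<Rightarrow> real" where
  "cyl_int T A h = (LBINT z:cyl T A. case_prod h z)"

text \<open>The Bochner space \<open>L\<^sup>p(0,T;X)\<close> and the space \<open>C([0,T];X)\<close>, for a space of functions \<open>X\<close>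
  with norm \<open>N\<close>. The second condition is strong measurability.\<close>

definition bochner_Lp ::
  "real \<Rightarrow> real \<Rightarrow> ('a \<Rightarrow> real) set \<Rightarrow> (('a \<Rightarrow> real) \<Rightarrow> real) \<Rightarrow> (real \<Rightarrow> 'a \<Rightarrow> real) set" where
  "bochner_Lp T p X N =
     {u. (AE t\<in>{0<..<T} in lborel. u t \<in> X) \<and>
         (\<exists>s :: nat \<Rightarrow> real \<Rightarrow> 'a \<Rightarrow> real.
            (\<forall>k. simple_function lborel (s k) \<and> (\<forall>t. s k t \<in> X)) \<and>
            (AE t\<in>{0<..<T} in lborel. (\<lambda>k. N (\<lambda>x. s k t x - u t x)) \<longlonglongrightarrow> 0)) \<and>
         set_integrable lborel {0<..<T} (\<lambda>t. N (u t) powr p)}"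

definition continuous_into ::
  "real \<Rightarrow> ('a \<Rightarrow> real) set \<Rightarrow> (('a \<Rightarrow> real) \<Rightarrow> real) \<Rightarrow> (real \<Rightarrow> 'a \<Rightarrow> real) set" where
  "continuous_into T X N =
     {u. \<forall>t\<in>{0..T}. u t \<in> X \<and>
           ((\<lambda>r. N (\<lambda>x. u r x - u t x)) \<longlongrightarrow> 0) (at t within {0..T})}"

text \<open>Weak derivatives on the cylinder. In the ambient space \<open>(1, 0)\<close> is the time direction
  and the vectors \<open>(0, b)\<close> are the spatial directions.\<close>

definition dt ::
  "real \<Rightarrow> (real^3) set \<Rightarrow> (real \<Rightarrow> real^3 \<Rightarrow> real) \<Rightarrow> real \<Rightarrow> real^3 \<Rightarrow> real" where
  "dt T \<Omega> u t x = weak_deriv (cyl T \<Omega>) [(1, 0)] (case_prod u) (t, x)"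

definition grad ::
  "real \<Rightarrow> (real^3) set \<Rightarrow> (real \<Rightarrow> real^3 \<Rightarrow> real) \<Rightarrow> real \<Rightarrow> real^3 \<Rightarrow> real^3" where
  "grad T \<Omega> u t x = (\<Sum>b\<in>Basis. weak_deriv (cyl T \<Omega>) [(0, b)] (case_prod u) (t, x) *\<^sub>R b)"

definition lap ::
  "real \<Rightarrow> (real^3) set \<Rightarrow> (real \<Rightarrow> real^3 \<Rightarrow> real) \<Rightarrow> real \<Rightarrow> real^3 \<Rightarrow> real" where
  "lap T \<Omega> u t x = (\<Sum>b\<in>Basis. weak_deriv (cyl T \<Omega>) [(0, b), (0, b)] (case_prod u) (t, x))"

definition has_weak_div ::
  "real \<Rightarrow> (real^3) set \<Rightarrow> (real \<Rightarrow> real^3 \<Rightarrow> real^3) \<Rightarrow> (real \<Rightarrow> real^3 \<Rightarrow> real) \<Rightarrow> bool" where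
  "has_weak_div T \<Omega> F g \<longleftrightarrow>
     (\<forall>b\<in>Basis. locally_integrable (cyl T \<Omega>) (\<lambda>(t, x). F t x \<bullet> b)) \<and>
     locally_integrable (cyl T \<Omega>) (case_prod g) \<and>
     (\<forall>\<phi>. test_function (cyl T \<Omega>) \<phi> \<longrightarrow>
        cyl_int T \<Omega> (\<lambda>t x. \<Sum>b\<in>Basis. (F t x \<bullet> b) * pd [(0, b)] \<phi> (t, x)) =
        - cyl_int T \<Omega> (\<lambda>t x. g t x * \<phi> (t, x)))"

definition divg ::
  "real \<Rightarrow> (real^3) set \<Rightarrow> (real \<Rightarrow> real^3 \<Rightarrow> real^3) \<Rightarrow> real \<Rightarrow> real^3 \<Rightarrow> real" where
  "divg T \<Omega> F =
     (if \<exists>g. has_weak_div T \<Omega> F g then SOME g. has_weak_div T \<Omega> F g else (\<lambda>_ _. 0))"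

text \<open>Membership of \<open>u\<close> itself in \<open>L\<^sup>p(Q)\<close> makes the representative jointly measurable.\<close>

definition X_space :: "real \<Rightarrow> (real^3) set \<Rightarrow> real \<Rightarrow> (real \<Rightarrow> real^3 \<Rightarrow> real) set" where
  "X_space T \<Omega> p =
     continuous_into T (sobolev_hat \<Omega> p) (sobolev_norm \<Omega> (2 - 2 / p) p) \<inter>
     bochner_Lp T p (sobolev \<Omega> 2 p) (sobolev_norm \<Omega> 2 p) \<inter>
     {u \<in> cyl_Lp T \<Omega> p.
        \<exists>g\<in>Lp_space (cyl T \<Omega>) p. has_weak_deriv (cyl T \<Omega>) [(1, 0)] (case_prod u) g}"

definition X_norm :: "real \<Rightarrow> (real^3) set \<Rightarrow> real \<Rightarrow> (real \<Rightarrow> real^3 \<Rightarrow> real) \<Rightarrow> real" where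
  "X_norm T \<Omega> p u =
     (SUP t\<in>{0..T}. sobolev_norm \<Omega> (2 - 2 / p) p (u t)) +
     (LBINT t:{0<..<T}. sobolev_norm \<Omega> 2 p (u t) powr p) powr (1 / p) +
     cyl_Lp_norm T \<Omega> p (dt T \<Omega> u)"

text \<open>\<open>W_space T \<Omega> p\<close> is \<open>X\<^sub>p\<close> with homogeneous Neumann condition on the lateral boundary:
  \<open>p = 2\<close> for the first component, \<open>p = 4\<close> for the second one.\<close>

definition neumann :: "real \<Rightarrow> (real^3) set \<Rightarrow> real \<Rightarrow> (real \<Rightarrow> real^3 \<Rightarrow> real) \<Rightarrow> bool" where
  "neumann T \<Omega> p u \<longleftrightarrow> (AE t\<in>{0<..<T} in lborel. normal_deriv_zero \<Omega> 2 p (u t))"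

definition W_space :: "real \<Rightarrow> (real^3) set \<Rightarrow> real \<Rightarrow> (real \<Rightarrow> real^3 \<Rightarrow> real) set" where
  "W_space T \<Omega> p = {u \<in> X_space T \<Omega> p. neumann T \<Omega> p u}"

definition W0_space :: "real \<Rightarrow> (real^3) set \<Rightarrow> real \<Rightarrow> (real \<Rightarrow> real^3 \<Rightarrow> real) set" where
  "W0_space T \<Omega> p = {u \<in> W_space T \<Omega> p. AE x\<in>\<Omega> in lborel. u 0 x = 0}"

section \<open>The control problem\<close>

definition convex_functions :: "(real \<Rightarrow> 'a \<Rightarrow> real) set \<Rightarrow> bool" where
  "convex_functions \<F> \<longleftrightarrow>
     (\<forall>f\<in>\<F>. \<forall>g\<in>\<F>. \<forall>c\<in>{0..1}. (\<lambda>t x. (1 - c) * f t x + c * g t x) \<in> \<F>)"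

definition cost ::
  "real \<Rightarrow> (real^3) set \<Rightarrow> (real^3) set \<Rightarrow> real \<Rightarrow> real \<Rightarrow> real \<Rightarrow>
   (real \<Rightarrow> real^3 \<Rightarrow> real) \<Rightarrow> (real \<Rightarrow> real^3 \<Rightarrow> real) \<Rightarrow>
   (real \<Rightarrow> real^3 \<Rightarrow> real) \<Rightarrow> (real \<Rightarrow> real^3 \<Rightarrow> real) \<Rightarrow> (real \<Rightarrow> real^3 \<Rightarrow> real) \<Rightarrow> real" where
  "cost T \<Omega> \<Omega>c \<alpha>u \<alpha>v \<alpha>f ud vd u v f =
     7 * \<alpha>u / 20 *
       (LBINT t:{0<..<T}. Lp_norm \<Omega> (20/7) (\<lambda>x. u t x - ud t x) powr (20/7)) +
     \<alpha>v / 2 * (LBINT t:{0<..<T}. (Lp_norm \<Omega> 2 (\<lambda>x. v t x - vd t x))\<^sup>2) +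
     \<alpha>f / 4 * (LBINT t:{0<..<T}. Lp_norm \<Omega>c 4 (f t) ^ 4)"

definition strong_solution ::
  "real \<Rightarrow> (real^3) set \<Rightarrow> (real^3) set \<Rightarrow> (real^3 \<Rightarrow> real) \<Rightarrow> (real^3 \<Rightarrow> real) \<Rightarrow>
   (real \<Rightarrow> real^3 \<Rightarrow> real) \<Rightarrow> (real \<Rightarrow> real^3 \<Rightarrow> real) \<Rightarrow> (real \<Rightarrow> real^3 \<Rightarrow> real) \<Rightarrow> bool" where
  "strong_solution T \<Omega> \<Omega>c u0 v0 f u v \<longleftrightarrow>
     u \<in> X_space T \<Omega> 2 \<and> v \<in> X_space T \<Omega> 4 \<and>
     (AE (t, x) in lborel. (t, x) \<in> cyl T \<Omega> \<longrightarrow> 0 \<le> u t x \<and> 0 \<le> v t x) \<and>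
     (AE (t, x) in lborel. (t, x) \<in> cyl T \<Omega> \<longrightarrow>
        dt T \<Omega> u t x - lap T \<Omega> u t x =
          divg T \<Omega> (\<lambda>t x. u t x *\<^sub>R grad T \<Omega> v t x) t x) \<and>
     (AE (t, x) in lborel. (t, x) \<in> cyl T \<Omega> \<longrightarrow>
        dt T \<Omega> v t x - lap T \<Omega> v t x + v t x = u t x + f t x * v t x * indicator \<Omega>c x) \<and>
     (AE x\<in>\<Omega> in lborel. u 0 x = u0 x) \<and>
     (AE x\<in>\<Omega> in lborel. v 0 x = v0 x) \<and>
     neumann T \<Omega> 2 u \<and> neumann T \<Omega> 4 v"

definition admissible ::
  "real \<Rightarrow> (real^3) set \<Rightarrow> (real^3) set \<Rightarrow> (real^3 \<Rightarrow> real) \<Rightarrow> (real^3 \<Rightarrow> real) \<Rightarrow>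
   (real \<Rightarrow> real^3 \<Rightarrow> real) set \<Rightarrow>
   ((real \<Rightarrow> real^3 \<Rightarrow> real) \<times> (real \<Rightarrow> real^3 \<Rightarrow> real) \<times> (real \<Rightarrow> real^3 \<Rightarrow> real)) set" where
  "admissible T \<Omega> \<Omega>c u0 v0 \<F> =
     {(u, v, f). f \<in> \<F> \<and> strong_solution T \<Omega> \<Omega>c u0 v0 f u v}"

definition local_optimal ::
  "real \<Rightarrow> (real^3) set \<Rightarrow> (real^3) set \<Rightarrow> real \<Rightarrow> real \<Rightarrow> real \<Rightarrow>
   (real^3 \<Rightarrow> real) \<Rightarrow> (real^3 \<Rightarrow> real) \<Rightarrow>
   (real \<Rightarrow> real^3 \<Rightarrow> real) \<Rightarrow> (real \<Rightarrow> real^3 \<Rightarrow> real) \<Rightarrow> (real \<Rightarrow> real^3 \<Rightarrow> real) set \<Rightarrow>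
   (real \<Rightarrow> real^3 \<Rightarrow> real) \<Rightarrow> (real \<Rightarrow> real^3 \<Rightarrow> real) \<Rightarrow> (real \<Rightarrow> real^3 \<Rightarrow> real) \<Rightarrow> bool" where
  "local_optimal T \<Omega> \<Omega>c \<alpha>u \<alpha>v \<alpha>f u0 v0 ud vd \<F> u v f \<longleftrightarrow>
     (u, v, f) \<in> admissible T \<Omega> \<Omega>c u0 v0 \<F> \<and>
     (\<exists>\<epsilon>>0. \<forall>(u', v', f') \<in> admissible T \<Omega> \<Omega>c u0 v0 \<F>.
        X_norm T \<Omega> 2 (\<lambda>t x. u' t x - u t x) < \<epsilon> \<and>
        X_norm T \<Omega> 4 (\<lambda>t x. v' t x - v t x) < \<epsilon> \<and>
        cyl_Lp_norm T \<Omega>c 4 (\<lambda>t x. f' t x - f t x) < \<epsilon> \<longrightarrow>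
        cost T \<Omega> \<Omega>c \<alpha>u \<alpha>v \<alpha>f ud vd u v f \<le> cost T \<Omega> \<Omega>c \<alpha>u \<alpha>v \<alpha>f ud vd u' v' f')"

definition cone_at :: "(real \<Rightarrow> 'a \<Rightarrow> real) set \<Rightarrow> (real \<Rightarrow> 'a \<Rightarrow> real) \<Rightarrow> (real \<Rightarrow> 'a \<Rightarrow> real) set"
  where "cone_at \<F> f = {\<lambda>t x. \<theta> * (g t x - f t x) | \<theta> g. 0 \<le> \<theta> \<and> g \<in> \<F>}"

definition lagrange_multiplier ::
  "real \<Rightarrow> (real^3) set \<Rightarrow> (real^3) set \<Rightarrow> real \<Rightarrow> real \<Rightarrow> real \<Rightarrow>
   (real \<Rightarrow> real^3 \<Rightarrow> real) \<Rightarrow> (real \<Rightarrow> real^3 \<Rightarrow> real) \<Rightarrow> (real \<Rightarrow> real^3 \<Rightarrow> real) set \<Rightarrow>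
   (real \<Rightarrow> real^3 \<Rightarrow> real) \<Rightarrow> (real \<Rightarrow> real^3 \<Rightarrow> real) \<Rightarrow> (real \<Rightarrow> real^3 \<Rightarrow> real) \<Rightarrow>
   (real \<Rightarrow> real^3 \<Rightarrow> real) \<Rightarrow> (real \<Rightarrow> real^3 \<Rightarrow> real) \<Rightarrow>
   ((real^3 \<Rightarrow> real) \<Rightarrow> real) \<Rightarrow> ((real^3 \<Rightarrow> real) \<Rightarrow> real) \<Rightarrow> bool" where
  "lagrange_multiplier T \<Omega> \<Omega>c \<alpha>u \<alpha>v \<alpha>f ud vd \<F> u v f lam \<eta> \<phi>1 \<phi>2 \<longleftrightarrow>
     lam \<in> cyl_Lp T \<Omega> 2 \<and>
     \<eta> \<in> cyl_Lp T \<Omega> (4/3) \<and>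
     \<phi>1 \<in> dual_space (sobolev \<Omega> 1 2) (sobolev_norm \<Omega> 1 2) \<and>
     \<phi>2 \<in> dual_space (sobolev_n \<Omega> (3/2) 4) (sobolev_norm \<Omega> (3/2) 4) \<and>
     (\<forall>U\<in>W_space T \<Omega> 2. \<forall>V\<in>W_space T \<Omega> 4. \<forall>F\<in>cone_at \<F> f.
        0 \<le> \<alpha>u * cyl_int T \<Omega>
                (\<lambda>t x. sgn (u t x - ud t x) * \<bar>u t x - ud t x\<bar> powr (13/7) * U t x)
          + \<alpha>v * cyl_int T \<Omega> (\<lambda>t x. (v t x - vd t x) * V t x)
          + \<alpha>f * cyl_int T \<Omega>c (\<lambda>t x. (f t x) ^ 3 * F t x)
          - cyl_int T \<Omega> (\<lambda>t x.
              (dt T \<Omega> U t x - lap T \<Omega> U t x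
                - divg T \<Omega> (\<lambda>t x. U t x *\<^sub>R grad T \<Omega> v t x) t x
                - divg T \<Omega> (\<lambda>t x. u t x *\<^sub>R grad T \<Omega> V t x) t x) * lam t x)
          - cyl_int T \<Omega> (\<lambda>t x.
              (dt T \<Omega> V t x - lap T \<Omega> V t x + V t x - U t x
                - f t x * V t x * indicator \<Omega>c x) * \<eta> t x)
          - \<phi>1 (U 0) - \<phi>2 (V 0)
          + cyl_int T \<Omega>c (\<lambda>t x. F t x * v t x * \<eta> t x))"

end

theory Submission
  imports Defs
begin

text \<open>The three relations come from inserting \<open>(\<plusminus>U, 0, 0)\<close>, \<open>(0, \<plusminus>V, 0)\<close> and \<open>(0, 0, g - f)\<close> into the
  multiplier inequality; the initial values drop out. Since the integral of a non-integrable
  function is \<open>0\<close> and the weak differential operators pick arbitrary representatives, this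
  needs two analytic facts. By density of test functions weak derivatives are unique almost
  everywhere, so the operators are homogeneous up to null sets. The integrals over \<open>\<Omega>\<close> and
  \<open>\<Omega>\<^sub>c\<close> may be separated because \<open>\<partial>\<^sub>t V - \<Delta>V + V\<close> is in \<open>L\<^sup>4\<close>, the dual of the space of \<open>\<eta>\<close>,
  and because \<open>V\<close> and \<open>v\<close> are essentially bounded: \<open>C([0,T]; W\<^sup>1\<^sup>,\<^sup>4)\<close> embeds into
  \<open>L\<^sup>\<infinity>\<close> by Morrey's inequality, which is proved by duality, pairing with test functions that are
  transported along the interior cones of the domain.\<close>

section \<open>Smooth functions\<close>

text \<open>Homogeneity of the weak operators, unlike additivity, can be had without knowing that
  the weak divergences in the multiplier inequality exist: a function and a nonzero multiple of it
  have weak derivatives simultaneously, and the default value 0 scales as well. The proof is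
  arranged so that whole integrands are only multiplied by -1 or 0, and integrals are split only
  where no divergence occurs. The equation for \<open>U\<close> thus needs measurability but no
  integrability. A second obstacle: the Bochner norm in \<open>X_space\<close> measures derivatives
  of time slices, chosen for each time separately and not known to be jointly measurable, whereas
  \<open>lap\<close> uses derivatives on the cylinder. The two are compared only through test
  functions and Fubini, and membership in L^4 is recovered by duality. Hoelder's inequality is
  replaced throughout by the pointwise bounds |a b| <= a^4 + |b|^(4/3) and |x| <= 1 + x^4, so that
  all estimates are affine in integrals of fourth powers.\<close>

lemma smooth_iff:
  "smooth f \<longleftrightarrow> (\<forall>bs. set bs \<subseteq> Basis \<longrightarrow> (\<forall>x. pd bs f differentiable at x))"
proof
  assume f: "smooth f"
  show "\<forall>bs. set bs \<subseteq> Basis \<longrightarrow> (\<forall>x. pd bs f differentiable at x)"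
  proof (intro allI impI)
    fix bs :: "'a list" and x
    assume "set bs \<subseteq> Basis"
    then have "bs \<in> multi_indices (Suc (length bs))" by (auto simp: multi_indices_def)
    then show "pd bs f differentiable at x"
      using f unfolding smooth_def Ck_on_def by blast
  qed
next
  assume f: "\<forall>bs. set bs \<subseteq> Basis \<longrightarrow> (\<forall>x. pd bs f differentiable at x)"
  then show "smooth f"
    unfolding smooth_def Ck_on_def multi_indices_def
    by (auto intro!: continuous_at_imp_continuous_on differentiable_imp_continuous_within)
qed

text \<open>A coinduction principle: it suffices to exhibit a class of differentiable functions
  closed under partial derivatives. Iterated derivatives of multiples, translates or compositions
  never have to be computed.\<close>

lemma smooth_closed_family:
  assumes "f \<in> A"
    and "\<And>f x. f \<in> A \<Longrightarrow> f differentiable at x"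
    and "\<And>f b. f \<in> A \<Longrightarrow> b \<in> Basis \<Longrightarrow> (\<lambda>x. frechet_derivative f (at x) b) \<in> A"
  shows "smooth f"
proof -
  have "pd bs f \<in> A" if "set bs \<subseteq> Basis" for bs
    using that assms(1)
  proof (induction bs arbitrary: f)
    case (Cons b bs)
    then show ?case using assms(3)[of f b] by simp
  qed simp
  then show ?thesis using assms(2) by (simp add: smooth_iff)
qed

lemma smooth_differentiable: "smooth f \<Longrightarrow> f differentiable at x"
  unfolding smooth_iff by (drule spec[of _ "[]"]) simp

lemma smooth_frechet: "smooth f \<Longrightarrow> (b::'a::euclidean_space) \<in> Basis \<Longrightarrow> smooth (\<lambda>x. frechet_derivative f (at x) b)"
  unfolding smooth_iff
proof (intro allI impI)
  fix bs :: "'a list" and x :: 'a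
  assume *: "\<forall>bs. set bs \<subseteq> Basis \<longrightarrow> (\<forall>x. pd bs f differentiable at x)" and "b \<in> Basis" "set bs \<subseteq> Basis"
  then show "pd bs (\<lambda>x. frechet_derivative f (at x) b) differentiable at x"
    using *[rule_format, of "b # bs" x] by simp
qed

lemma smooth_pd: "smooth f \<Longrightarrow> set bs \<subseteq> Basis \<Longrightarrow> smooth (pd bs f)"
proof (induction bs arbitrary: f)
  case (Cons b bs)
  then show ?case using smooth_frechet[of f b] by simp
qed simp

lemma smooth_continuous: "smooth f \<Longrightarrow> continuous_on A f"
  by (simp add: smooth_differentiable continuous_at_imp_continuous_on
      differentiable_imp_continuous_within)

lemma smooth_measurable: "smooth f \<Longrightarrow> f \<in> borel_measurable borel"
  by (simp add: smooth_continuous borel_measurable_continuous_onI)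

section \<open>Calculus rules, supports and a flat function\<close>

lemma frechet_derivative_eqI: "(f has_derivative f') (at x) \<Longrightarrow> frechet_derivative f (at x) = f'"
  by (rule frechet_derivative_at[symmetric])

lemma frechet_derivative_add:
  fixes f :: "'a::euclidean_space \<Rightarrow> real"
  assumes "f differentiable at x" "g differentiable at x"
  shows "frechet_derivative (\<lambda>x. f x + g x) (at x) b
    = frechet_derivative f (at x) b + frechet_derivative g (at x) b"
  using frechet_derivative_eqI[OF has_derivative_add[OF assms[unfolded frechet_derivative_works]]]
  by simp

lemma frechet_derivative_mult:
  fixes f :: "'a::euclidean_space \<Rightarrow> real"
  assumes "f differentiable at x" "g differentiable at x"
  shows "frechet_derivative (\<lambda>x. f x * g x) (at x) b
    = f x * frechet_derivative g (at x) b + frechet_derivative f (at x) b * g x"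
  using frechet_derivative_eqI[OF has_derivative_mult[OF assms[unfolded frechet_derivative_works]]]
  by simp

lemma frechet_derivative_cmult:
  fixes f :: "'a::euclidean_space \<Rightarrow> real"
  assumes "f differentiable at x"
  shows "frechet_derivative (\<lambda>x. c * f x) (at x) b = c * frechet_derivative f (at x) b"
proof -
  have "((\<lambda>x. c * f x) has_derivative (\<lambda>h. c * frechet_derivative f (at x) h)) (at x)"
    using assms by (intro has_derivative_mult_right) (simp add: frechet_derivative_works[symmetric])
  then show ?thesis by (simp add: frechet_derivative_eqI)
qed

lemma smooth_cmult:
  fixes f :: "'a::euclidean_space \<Rightarrow> real"
  assumes "smooth f"
  shows "smooth (\<lambda>x. c * f x)"
proof (rule smooth_closed_family[of _ "{\<lambda>x. c * g x |g. smooth g}"])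
  fix g :: "'a \<Rightarrow> real" and b :: 'a assume "g \<in> {\<lambda>x. c * g x |g. smooth g}" "b \<in> (Basis :: 'a set)"
  then obtain h where h: "smooth h" "g = (\<lambda>x. c * h x)" by auto
  then show "(\<lambda>x. frechet_derivative g (at x) b) \<in> {\<lambda>x. c * g x |g. smooth g}"
    using smooth_frechet[OF h(1) \<open>b \<in> Basis\<close>]
    by (auto simp: frechet_derivative_cmult smooth_differentiable)
qed (use assms in \<open>auto simp: smooth_differentiable\<close>)

lemma pd_eq_0_on_open:
  assumes "open S" "\<And>x. x \<in> S \<Longrightarrow> f x = 0" "x \<in> S"
  shows "pd bs f x = 0"
  using assms(2,3)
proof (induction bs arbitrary: f x)
  case (Cons b bs)
  have "frechet_derivative f (at y) b = 0" if "y \<in> S" for y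
  proof -
    have "(f has_derivative (\<lambda>_. 0)) (at y)"
      by (rule has_derivative_transform_within_open[of "\<lambda>_. 0" _ _ _ S])
        (use assms(1) that Cons.prems(1) in auto)
    then show ?thesis by (simp add: frechet_derivative_eqI)
  qed
  then show ?case using Cons by simp
qed auto

text \<open>\<open>K\<close> is any set outside which the function vanishes, not its exact support;
  it may be enlarged freely, and one \<open>K\<close> can serve a whole sequence.\<close>

definition supported_in :: "('a \<Rightarrow> real) \<Rightarrow> 'a set \<Rightarrow> bool" where
  "supported_in f K \<longleftrightarrow> (\<forall>x. x \<notin> K \<longrightarrow> f x = 0)"

lemma supported_in_pd:
  fixes f :: "'a::euclidean_space \<Rightarrow> real"
  assumes "compact K" "supported_in f K"
  shows "supported_in (pd bs f) K"
  unfolding supported_in_def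
proof (intro allI impI)
  fix x assume "x \<notin> K"
  then show "pd bs f x = 0"
    using assms by (intro pd_eq_0_on_open[of "- K"])
      (auto simp: supported_in_def compact_imp_closed)
qed

lemma smooth_compact_support_bounded:
  assumes "smooth f" "compact K" "supported_in f K"
  obtains B where "B > 0" "\<And>x. \<bar>f x\<bar> \<le> B"
proof -
  have "compact (f ` K)" using assms smooth_continuous compact_continuous_image by blast
  then obtain B where B: "\<And>y. y \<in> f ` K \<Longrightarrow> \<bar>y\<bar> \<le> B"
    using compact_imp_bounded[of "f ` K"] by (auto simp: bounded_iff)
  have "\<bar>f x\<bar> \<le> max B 1" for x
    using B[of "f x"] assms(3) by (cases "x \<in> K") (auto simp: supported_in_def)
  then show ?thesis using that[of "max B 1"] by auto
qed

text \<open>The factor \<open>t\<^sup>-\<^sup>k\<close> makes the span of these functions closed under differentiation.\<close>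

definition flat :: "nat \<Rightarrow> real \<Rightarrow> real" where
  "flat k t = (if t \<le> 0 then 0 else exp (- 1 / t) / t ^ k)"

lemma flat_nonneg: "0 \<le> flat k t"
  by (simp add: flat_def)

lemma flat_pos: "0 < t \<Longrightarrow> 0 < flat k t"
  by (simp add: flat_def)

text \<open>The substitution of 1/t for t turns this into the decay of a power divided by the
  exponential at infinity.\<close>

lemma flat_at_right: "((\<lambda>t. exp (- 1 / t) / t ^ k :: real) \<longlongrightarrow> 0) (at_right 0)"
proof -
  have "((\<lambda>t::real. (inverse t) ^ k / exp (inverse t)) \<longlongrightarrow> 0) (at_right 0)"
    using filterlim_compose[OF tendsto_power_div_exp_0 filterlim_inverse_at_top_right] .
  then show ?thesis
    by (simp add: exp_minus divide_inverse mult.commute power_inverse)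
qed

text \<open>For positive t this is the quotient rule. At 0 the difference quotient
  \<open>flat k h / h\<close> is 0 on the left and \<open>flat (Suc k) h\<close> on the right, which
  tends to 0.\<close>

lemma flat_has_derivative: "(flat k has_real_derivative (- real k * flat (k+1) t + flat (k+2) t)) (at t)"
proof -
  consider "t < 0" | "t = 0" | "t > 0" by linarith
  then show ?thesis
  proof cases
    case 1
    have "((\<lambda>_. 0) has_real_derivative 0) (at t)" by simp
    then have "(flat k has_real_derivative 0) (at t)"
      by (rule has_field_derivative_transform_within_open[of _ _ _ "{..<0}"])
        (use 1 in \<open>auto simp: flat_def\<close>)
    then show ?thesis using 1 by (simp add: flat_def)
  next
    case 2
    have l: "((\<lambda>h. flat k h / h) \<longlongrightarrow> 0) (at_left 0)"
      by (rule tendsto_eventually) (auto simp: flat_def eventually_at_filter)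
    have "((\<lambda>h. flat k h / h) \<longlongrightarrow> 0) (at_right 0)"
      using flat_at_right[of "Suc k"]
      by (rule Lim_transform_eventually) (auto simp: flat_def eventually_at_filter)
    with l have "((\<lambda>h. flat k h / h) \<longlongrightarrow> 0) (at 0)" by (rule filterlim_split_at)
    then have "(flat k has_real_derivative 0) (at 0)"
      by (simp add: DERIV_def flat_def)
    then show ?thesis using 2 by (simp add: flat_def)
  next
    case 3
    have "((\<lambda>t. exp (- 1 / t) / t ^ k) has_real_derivative
        (exp (- 1 / t) * (1 / t\<^sup>2) * t ^ k - exp (- 1 / t) * (real k * t ^ (k - 1))) / (t ^ k * t ^ k)) (at t)"
      using 3 by (auto intro!: derivative_eq_intros simp: power2_eq_square)
    also have "(exp (- 1 / t) * (1 / t\<^sup>2) * t ^ k - exp (- 1 / t) * (real k * t ^ (k - 1))) / (t ^ k * t ^ k)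
        = - real k * flat (k+1) t + flat (k+2) t"
      using 3 by (cases k) (auto simp: flat_def field_simps power2_eq_square)
    finally show ?thesis
      by (rule has_field_derivative_transform_within_open[of _ _ _ "{0<..}"])
        (use 3 in \<open>auto simp: flat_def\<close>)
  qed
qed

section \<open>Smooth functions built from polynomials and the flat function; cutoffs\<close>

lemma real_polynomial_function_derivative:
  fixes p :: "'a::euclidean_space \<Rightarrow> real"
  assumes "real_polynomial_function p"
  shows "real_polynomial_function (\<lambda>x. frechet_derivative p (at x) b)"
  using assms
proof induction
  case (linear f)
  then show ?case
    by (simp add: frechet_derivative_eqI[OF bounded_linear_imp_has_derivative]
        real_polynomial_function.intros(2))
next
  case (const c)
  then show ?case by (simp add: frechet_derivative_const real_polynomial_function.intros(2))
next
  case (add f g)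
  have "frechet_derivative (\<lambda>x. f x + g x) (at x) b
      = frechet_derivative f (at x) b + frechet_derivative g (at x) b" for x
    by (intro frechet_derivative_add differentiable_at_real_polynomial_function add.hyps)
  then show ?case using add by auto
next
  case (mult f g)
  have "frechet_derivative (\<lambda>x. f x * g x) (at x) b
      = f x * frechet_derivative g (at x) b + frechet_derivative f (at x) b * g x" for x
    by (intro frechet_derivative_mult differentiable_at_real_polynomial_function mult.hyps)
  then show ?case using mult by auto
qed

text \<open>A module over the polynomials. It is closed under differentiation, which yields
  smoothness, and under multiplication by polynomials, which lets Stone-Weierstrass produce smooth
  functions of compact support.\<close>

inductive_set flat_algebra :: "('a::euclidean_space \<Rightarrow> real) set" where
  flat: "real_polynomial_function p \<Longrightarrow> real_polynomial_function q \<Longrightarrow>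
    (\<lambda>x. q x * flat k (p x)) \<in> flat_algebra"
| add: "f \<in> flat_algebra \<Longrightarrow> g \<in> flat_algebra \<Longrightarrow> (\<lambda>x. f x + g x) \<in> flat_algebra"

lemma flat_comp_has_derivative:
  fixes p q :: "'a::euclidean_space \<Rightarrow> real"
  assumes "real_polynomial_function p" "real_polynomial_function q"
  shows "((\<lambda>x. q x * flat k (p x)) has_derivative
    (\<lambda>h. q x * (frechet_derivative p (at x) h * (- real k * flat (k+1) (p x) + flat (k+2) (p x)))
       + frechet_derivative q (at x) h * flat k (p x))) (at x)"
proof -
  have p: "(p has_derivative frechet_derivative p (at x)) (at x)"
    and q: "(q has_derivative frechet_derivative q (at x)) (at x)"
    using assms differentiable_at_real_polynomial_function frechet_derivative_works by blast+
  have "((\<lambda>x. flat k (p x)) has_derivative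
      (\<lambda>h. frechet_derivative p (at x) h * (- real k * flat (k+1) (p x) + flat (k+2) (p x)))) (at x)"
    using has_derivative_compose[OF p flat_has_derivative[of k "p x", THEN has_field_derivative_imp_has_derivative]]
    by (simp add: mult.commute)
  from has_derivative_mult[OF q this] show ?thesis .
qed

lemma flat_algebra_derivative:
  fixes f :: "'a::euclidean_space \<Rightarrow> real"
  assumes "f \<in> flat_algebra"
  shows "(\<forall>x. f differentiable at x) \<and> (\<lambda>x. frechet_derivative f (at x) b) \<in> flat_algebra"
  using assms
proof induction
  case (flat p q k)
  let ?p = "\<lambda>x. frechet_derivative p (at x) b" and ?q = "\<lambda>x. frechet_derivative q (at x) b"
  have "(\<lambda>x. frechet_derivative (\<lambda>x. q x * flat k (p x)) (at x) b)
      = (\<lambda>x. ((- real k * q x * ?p x) * flat (k+1) (p x) + (q x * ?p x) * flat (k+2) (p x))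
          + ?q x * flat k (p x))"
    by (rule ext) (simp add: frechet_derivative_eqI[OF flat_comp_has_derivative[OF flat]] algebra_simps)
  also have "\<dots> \<in> flat_algebra"
    by (intro flat_algebra.intros flat real_polynomial_function.intros
        real_polynomial_function_derivative)
  finally show ?case
    using flat_comp_has_derivative[OF flat] unfolding differentiable_def by blast
next
  case (add f g)
  have "frechet_derivative (\<lambda>x. f x + g x) (at x) b
      = frechet_derivative f (at x) b + frechet_derivative g (at x) b" for x
    by (intro frechet_derivative_add) (use add.IH in auto)
  then show ?case using add by (auto intro!: flat_algebra.add)
qed

lemma flat_algebra_smooth: "f \<in> flat_algebra \<Longrightarrow> smooth f"
  by (rule smooth_closed_family[of f flat_algebra]) (use flat_algebra_derivative in auto)

lemma flat_algebra_mult: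
  assumes "f \<in> flat_algebra" "real_polynomial_function r"
  shows "(\<lambda>x. f x * r x) \<in> flat_algebra"
  using assms(1)
proof induction
  case (flat p q k)
  have "(\<lambda>x. (q x * r x) * flat k (p x)) \<in> flat_algebra"
    by (intro flat_algebra.flat flat real_polynomial_function.intros(4) assms(2))
  then show ?case by (simp add: mult.commute mult.left_commute)
next
  case (add f g)
  then show ?case using flat_algebra.add[of "\<lambda>x. f x * r x" "\<lambda>x. g x * r x"]
    by (simp add: algebra_simps)
qed

lemma flat_algebra_zero: "(\<lambda>_. 0) \<in> (flat_algebra :: ('a::euclidean_space \<Rightarrow> real) set)"
  using flat_algebra.flat[of "\<lambda>_. 0" "\<lambda>_. 0" 0] by (simp add: real_polynomial_function.intros(2))

lemma flat_algebra_sum: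
  "finite I \<Longrightarrow> (\<And>i. i \<in> I \<Longrightarrow> f i \<in> flat_algebra) \<Longrightarrow> (\<lambda>x. \<Sum>i\<in>I. f i x) \<in> flat_algebra"
  by (induction I rule: finite_induct) (auto simp: flat_algebra_zero intro: flat_algebra.add)

text \<open>The compact set is covered by finitely many balls. The polynomial \<open>p c\<close> is
  positive exactly on the open ball around \<open>c\<close>, so \<open>flat 0\<close> composed with
  it is a bump, and the bumps are added. The sum is not normalised to 1 on \<open>K\<close>; the
  lower bound \<open>m\<close> is what allows division by it later.\<close>

lemma flat_cutoff:
  fixes S K :: "'a::euclidean_space set"
  assumes "open S" "compact K" "K \<subseteq> S"
  obtains \<kappa> K' m where "\<kappa> \<in> flat_algebra" "compact K'" "K' \<subseteq> S" "supported_in \<kappa> K'"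
    "\<And>x. 0 \<le> \<kappa> x" "m > 0" "\<And>x. x \<in> K \<Longrightarrow> m \<le> \<kappa> x"
proof -
  have "\<exists>r>0. cball x r \<subseteq> S" if "x \<in> K" for x
    using that assms open_contains_cball by blast
  then obtain r where r: "\<And>x. x \<in> K \<Longrightarrow> r x > 0" "\<And>x. x \<in> K \<Longrightarrow> cball x (r x) \<subseteq> S"
    by metis
  have "K \<subseteq> (\<Union>x\<in>K. ball x (r x))" using r(1) by force
  then obtain I where I: "I \<subseteq> K" "finite I" "K \<subseteq> (\<Union>x\<in>I. ball x (r x))"
    using compactE_image[OF assms(2), of K "\<lambda>x. ball x (r x)"] by auto
  define p where "p c x = (r c)\<^sup>2 - (x - c) \<bullet> (x - c)" for c x
  have p_pos: "p c x > 0 \<longleftrightarrow> x \<in> ball c (r c)" if "c \<in> K" for c x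
  proof -
    have "p c x > 0 \<longleftrightarrow> (dist c x)\<^sup>2 < (r c)\<^sup>2"
      by (simp add: p_def dist_commute[of c] dist_norm[of x] power2_norm_eq_inner)
    also have "\<dots> \<longleftrightarrow> dist c x < r c"
      using power_mono_iff[of "r c" "dist c x" 2] r(1)[OF that] by (simp flip: not_le)
    finally show ?thesis by simp
  qed
  have poly: "real_polynomial_function (p c)" for c
  proof -
    have "polynomial_function (\<lambda>x. x - c)"
      using polynomial_function_diff polynomial_function_id polynomial_function_const by blast
    then have "real_polynomial_function (\<lambda>x. (x - c) \<bullet> (x - c))"
      unfolding euclidean_inner[of "_ - c" "_ - c"]
      by (auto intro!: real_polynomial_function_sum real_polynomial_function.intros(4)
          simp: polynomial_function_iff_Basis_inner)
    then show ?thesis unfolding p_def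
      by (intro real_polynomial_function_diff real_polynomial_function.intros(2))
  qed
  define \<kappa> where "\<kappa> x = (\<Sum>c\<in>I. 1 * flat 0 (p c x))" for x
  have \<kappa>: "\<kappa> \<in> flat_algebra"
    unfolding \<kappa>_def by (intro flat_algebra_sum flat_algebra.flat I poly real_polynomial_function.intros(2))
  define K' where "K' = (\<Union>c\<in>I. cball c (r c))"
  have "compact K'" unfolding K'_def using I(2) by (intro compact_UN) auto
  moreover have "K' \<subseteq> S" using I(1) r(2) unfolding K'_def by blast
  moreover have "supported_in \<kappa> K'"
    unfolding supported_in_def
  proof (intro allI impI)
    fix x assume "x \<notin> K'"
    then have "\<not> p c x > 0" if "c \<in> I" for c
    proof -
      have "c \<in> K" "\<not> dist c x \<le> r c" using that I(1) \<open>x \<notin> K'\<close> by (auto simp: K'_def)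
      then show ?thesis using p_pos[of c x] by simp
    qed
    then show "\<kappa> x = 0" unfolding \<kappa>_def by (intro sum.neutral) (simp add: flat_def not_less)
  qed
  moreover have nn: "0 \<le> \<kappa> x" for x
    unfolding \<kappa>_def by (intro sum_nonneg) (auto simp: flat_nonneg)
  moreover have pos: "0 < \<kappa> x" if x: "x \<in> K" for x
  proof -
    obtain c where c: "c \<in> I" "x \<in> ball c (r c)" using x I(3) by blast
    then have "0 < p c x" using p_pos I(1) by blast
    then show ?thesis unfolding \<kappa>_def
      using I(2) c(1) by (intro sum_pos2[of _ c]) (auto simp: flat_nonneg flat_pos)
  qed
  moreover have "\<exists>m>0. \<forall>x\<in>K. m \<le> \<kappa> x"
  proof (cases "K = {}")
    case False
    have "continuous_on K \<kappa>" using \<kappa> flat_algebra_smooth smooth_continuous by blast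
    from continuous_attains_inf[OF assms(2) False this] pos show ?thesis by blast
  qed (auto intro: exI[of _ 1])
  ultimately show ?thesis using that[of \<kappa> K'] \<kappa> by blast
qed


section \<open>Density of test functions\<close>

text \<open>Approximation without convolution: \<open>\<zeta>\<close> is an a.e. limit of continuous
  functions, these are clipped to [-c, c] and divided by the cutoff, the quotients are approximated
  by polynomials on \<open>K'\<close>, and multiplication by the cutoff restores smoothness and
  compact support. The common bound and common compact set prepare dominated convergence.\<close>

lemma test_function_approx:
  fixes S K :: "'a::euclidean_space set"
  assumes "open S" "compact K" "K \<subseteq> S" "\<zeta> \<in> borel_measurable borel"
    "\<And>x. \<bar>\<zeta> x\<bar> \<le> c" "supported_in \<zeta> K"
  obtains \<Phi> K' where "\<And>n::nat. smooth (\<Phi> n)" "compact K'" "K' \<subseteq> S" "K \<subseteq> K'"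
    "\<And>n. supported_in (\<Phi> n) K'" "\<And>n x. \<bar>\<Phi> n x\<bar> \<le> c + 1"
    "AE x in lborel. (\<lambda>n. \<Phi> n x) \<longlonglongrightarrow> \<zeta> x"
proof -
  obtain \<kappa> K' m where \<kappa>: "\<kappa> \<in> flat_algebra" "compact K'" "K' \<subseteq> S" "supported_in \<kappa> K'"
    "\<And>x. 0 \<le> \<kappa> x" "m > 0" "\<And>x. x \<in> K \<Longrightarrow> m \<le> \<kappa> x"
    by (rule flat_cutoff[OF assms(1-3)]) (rule that)
  have \<kappa>_smooth: "smooth \<kappa>" using \<kappa>(1) by (rule flat_algebra_smooth)
  obtain B where B: "B > 0" "\<And>x. \<bar>\<kappa> x\<bar> \<le> B"
    by (rule smooth_compact_support_bounded[OF \<kappa>_smooth \<kappa>(2,4)]) (rule that)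
  have c: "0 \<le> c" using assms(5)[of 0] by linarith
  have "\<zeta> \<in> borel_measurable lebesgue" using assms(4) by (simp add: measurable_completion)
  then have "\<zeta> measurable_on UNIV" by (rule lebesgue_measurable_imp_measurable_on) simp
  then obtain N g where N: "negligible N" and g: "\<And>n. continuous_on UNIV (g n)"
    and lim: "\<And>x. x \<notin> N \<Longrightarrow> (\<lambda>n. g n x) \<longlonglongrightarrow> \<zeta> x"
    unfolding measurable_on_def by auto
  \<comment> \<open>The maximum with \<open>m\<close> keeps the quotient continuous where the cutoff
    vanishes; on \<open>K\<close> it is inactive, so the division is undone exactly by the factor
    \<open>\<kappa>\<close>.\<close>
  define f where "f n x = max (- c) (min c (g n x)) / max (\<kappa> x) m" for n :: nat and x
  have f: "continuous_on UNIV (f n)" for n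
    unfolding f_def using g smooth_continuous[OF \<kappa>_smooth] \<kappa>(6)
    by (intro continuous_intros) (auto simp: max_def)
  have f_bound: "\<bar>\<kappa> x * f n x\<bar> \<le> c" for n x
  proof -
    have "\<bar>\<kappa> x * f n x\<bar> = \<bar>max (- c) (min c (g n x))\<bar> * (\<kappa> x / max (\<kappa> x) m)"
      using \<kappa>(5)[of x] \<kappa>(6) by (simp add: f_def abs_mult)
    also have "\<dots> \<le> c * 1"
      using \<kappa>(5)[of x] \<kappa>(6) c by (intro mult_mono) auto
    finally show ?thesis by simp
  qed
  \<comment> \<open>Multiplication by the cutoff, bounded by \<open>B\<close>, turns this accuracy
    into 1/(n+1); as this is at most 1, it also yields the bound c + 1.\<close>
  have "\<exists>p. real_polynomial_function p \<and> (\<forall>x\<in>K'. \<bar>f n x - p x\<bar> < 1 / (real (Suc n) * B))" for n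
  proof -
    have "0 < 1 / (real (Suc n) * B)" using B(1) by simp
    moreover have "continuous_on K' (f n)" using f continuous_on_subset by blast
    ultimately obtain g where "real_polynomial_function g"
      "\<And>x. x \<in> K' \<Longrightarrow> \<bar>f n x - g x\<bar> < 1 / (real (Suc n) * B)"
      using Stone_Weierstrass_real_polynomial_function[OF \<kappa>(2)] by (metis (no_types, lifting))
    then show ?thesis by (intro exI[of _ g]) simp
  qed
  then obtain p where p: "\<And>n. real_polynomial_function (p n)"
    "\<And>n x. x \<in> K' \<Longrightarrow> \<bar>f n x - p n x\<bar> < 1 / (real (Suc n) * B)" by metis
  define \<Phi> where "\<Phi> n x = \<kappa> x * p n x" for n x
  have diff: "\<bar>\<kappa> x * f n x - \<Phi> n x\<bar> \<le> 1 / real (Suc n)" for n x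
  proof (cases "x \<in> K'")
    case True
    have "\<bar>\<kappa> x * f n x - \<Phi> n x\<bar> = \<bar>\<kappa> x\<bar> * \<bar>f n x - p n x\<bar>"
      by (simp add: \<Phi>_def abs_mult flip: right_diff_distrib)
    also have "\<dots> \<le> B * (1 / (real (Suc n) * B))"
      using B p(2)[OF True, of n] by (intro mult_mono) auto
    also have "\<dots> = 1 / real (Suc n)" using B(1) by simp
    finally show ?thesis .
  next
    case False
    then show ?thesis using \<kappa>(4) by (simp add: \<Phi>_def supported_in_def)
  qed
  have "(\<lambda>n. \<Phi> n x) \<longlonglongrightarrow> \<zeta> x" if "x \<notin> N" for x
  proof -
    have "(\<lambda>n. max (- c) (min c (g n x)) / max (\<kappa> x) m) \<longlonglongrightarrow> max (- c) (min c (\<zeta> x)) / max (\<kappa> x) m"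
      using \<kappa>(6) by (intro tendsto_intros lim that) (auto simp: max_def)
    then have "(\<lambda>n. \<kappa> x * f n x) \<longlonglongrightarrow> \<kappa> x * (max (- c) (min c (\<zeta> x)) / max (\<kappa> x) m)"
      unfolding f_def by (rule tendsto_mult_left)
    \<comment> \<open>On \<open>K\<close> neither the clipping nor the maximum acts, because
      \<open>\<zeta>\<close> is bounded by \<open>c\<close> and the cutoff is at least
      \<open>m\<close>; off \<open>K\<close> the function \<open>\<zeta>\<close> is 0.\<close>
    also have "\<kappa> x * (max (- c) (min c (\<zeta> x)) / max (\<kappa> x) m) = \<zeta> x"
    proof (cases "x \<in> K")
      case True
      then have "max (\<kappa> x) m = \<kappa> x" "max (- c) (min c (\<zeta> x)) = \<zeta> x" "\<kappa> x \<noteq> 0"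
        using \<kappa>(6) \<kappa>(7)[OF True] assms(5)[of x] by linarith+
      then show ?thesis by simp
    next
      case False
      then show ?thesis using assms(6) c by (simp add: supported_in_def)
    qed
    finally have "(\<lambda>n. \<kappa> x * f n x) \<longlonglongrightarrow> \<zeta> x" .
    moreover have "(\<lambda>n. \<kappa> x * f n x - \<Phi> n x) \<longlonglongrightarrow> 0"
      by (rule Lim_null_comparison[OF _ LIMSEQ_inverse_real_of_nat])
        (use diff in \<open>auto simp: divide_inverse\<close>)
    ultimately show ?thesis
      using tendsto_diff[of "\<lambda>n. \<kappa> x * f n x" "\<zeta> x" sequentially "\<lambda>n. \<kappa> x * f n x - \<Phi> n x" 0] by simp
  qed
  moreover have "AE x in lborel. x \<notin> N"
    using N AE_not_in[of N lebesgue] by (simp add: negligible_iff_null_sets AE_completion_iff)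
  ultimately have "AE x in lborel. (\<lambda>n. \<Phi> n x) \<longlonglongrightarrow> \<zeta> x" by auto
  moreover have "K \<subseteq> K'"
  proof
    fix x assume "x \<in> K"
    then have "\<kappa> x \<noteq> 0" using \<kappa>(6) \<kappa>(7)[of x] by simp
    then show "x \<in> K'" using \<kappa>(4) by (auto simp: supported_in_def)
  qed
  moreover have "smooth (\<Phi> n)" for n
    unfolding \<Phi>_def by (intro flat_algebra_smooth flat_algebra_mult \<kappa> p)
  moreover have "supported_in (\<Phi> n) K'" for n
    using \<kappa>(4) by (simp add: \<Phi>_def supported_in_def)
  moreover have "\<bar>\<Phi> n x\<bar> \<le> c + 1" for n x
  proof -
    have "1 / real (Suc n) \<le> 1" by simp
    then show ?thesis using diff[of x n] f_bound[of x n] by linarith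
  qed
  ultimately show ?thesis using \<kappa>(2,3) by (intro that[of \<Phi> K'])
qed

lemma test_functionI: "smooth \<phi> \<Longrightarrow> compact K \<Longrightarrow> K \<subseteq> S \<Longrightarrow> supported_in \<phi> K \<Longrightarrow> test_function S \<phi>"
  unfolding test_function_def supported_in_def by blast

lemma test_functionE:
  assumes "test_function S \<phi>"
  obtains K where "smooth \<phi>" "compact K" "K \<subseteq> S" "supported_in \<phi> K"
  using assms unfolding test_function_def supported_in_def by blast

text \<open>Moves the cut from \<open>S\<close>, where \<open>w\<close> is only locally integrable,
  to the compact \<open>K\<close>, where it is integrable.\<close>

lemma set_integral_supported:
  assumes "supported_in \<phi> K" "K \<subseteq> S"
  shows "(LINT x:S|M. w x * \<phi> x) = (LINT x|M. (indicator K x *\<^sub>R w x) * \<phi> x)"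
  unfolding set_lebesgue_integral_def
  using assms by (intro Bochner_Integration.integral_cong) (auto simp: supported_in_def indicator_def)

text \<open>Both sides pass to the limit by dominated convergence along
  \<open>test_function_approx\<close>. The shape of the bound serves two duality arguments: C = 0, q
  = 1 yields essential boundedness, and D = 1, q = 4/3 yields membership in L^4.\<close>

lemma dual_bound_extend:
  fixes S K :: "'a::euclidean_space set"
  assumes S: "open S" and w: "locally_integrable S w" and q: "q > 0"
    and bound: "\<And>\<phi>. test_function S \<phi> \<Longrightarrow>
      \<bar>LBINT x:S. w x * \<phi> x\<bar> \<le> C + D * (LBINT x:S. \<bar>\<phi> x\<bar> powr q)"
    and K: "compact K" "K \<subseteq> S" and \<zeta>: "\<zeta> \<in> borel_measurable borel"
    "\<And>x. \<bar>\<zeta> x\<bar> \<le> c" "supported_in \<zeta> K"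
  shows "\<bar>LBINT x:S. w x * \<zeta> x\<bar> \<le> C + D * (LBINT x:S. \<bar>\<zeta> x\<bar> powr q)"
proof -
  obtain \<Phi> K' where \<Phi>: "\<And>n::nat. smooth (\<Phi> n)" and K': "compact K'" "K' \<subseteq> S" "K \<subseteq> K'"
    and supp: "\<And>n. supported_in (\<Phi> n) K'" and bnd: "\<And>n x. \<bar>\<Phi> n x\<bar> \<le> c + 1"
    and lim: "AE x in lborel. (\<lambda>n. \<Phi> n x) \<longlonglongrightarrow> \<zeta> x"
    by (rule test_function_approx[OF S K \<zeta>]) (rule that)
  have supp': "supported_in \<zeta> K'" using \<zeta>(3) K'(3) by (auto simp: supported_in_def)
  have w': "integrable lborel (\<lambda>x. indicator K' x *\<^sub>R w x)"
    using w K' by (simp add: locally_integrable_def set_integrable_def)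
  have [measurable]: "\<Phi> n \<in> borel_measurable borel" for n
    using \<Phi> by (rule smooth_measurable)
  note [measurable] = \<zeta>(1)
  have [measurable]: "K' \<in> sets borel" using K' by (simp add: compact_imp_closed)
  have [measurable]: "(\<lambda>x. indicator K' x *\<^sub>R w x) \<in> borel_measurable lborel"
    using w' by (rule borel_measurable_integrable)
  have 1: "(\<lambda>n. LBINT x:S. w x * \<Phi> n x) \<longlonglongrightarrow> (LBINT x:S. w x * \<zeta> x)"
    unfolding set_integral_supported[OF supp K'(2)] set_integral_supported[OF supp' K'(2)]
  proof (rule integral_dominated_convergence[where w="\<lambda>x. (c + 1) * \<bar>indicator K' x *\<^sub>R w x\<bar>"])
    show "AE x in lborel. (\<lambda>n. (indicator K' x *\<^sub>R w x) * \<Phi> n x) \<longlonglongrightarrow> (indicator K' x *\<^sub>R w x) * \<zeta> x"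
      using lim by eventually_elim (rule tendsto_mult_left)
    show "AE x in lborel. norm ((indicator K' x *\<^sub>R w x) * \<Phi> n x) \<le> (c + 1) * \<bar>indicator K' x *\<^sub>R w x\<bar>" for n
    proof (rule AE_I2)
      fix x show "norm ((indicator K' x *\<^sub>R w x) * \<Phi> n x) \<le> (c + 1) * \<bar>indicator K' x *\<^sub>R w x\<bar>"
        using mult_right_mono[OF bnd[of n x], of "\<bar>indicator K' x *\<^sub>R w x\<bar>"]
        by (simp add: abs_mult mult.commute)
    qed
    show "integrable lborel (\<lambda>x. (c + 1) * \<bar>indicator K' x *\<^sub>R w x\<bar>)"
      using w' by (intro integrable_mult_right integrable_abs)
  qed measurable
  have supp_pow: "supported_in (\<lambda>x. \<bar>\<psi> x\<bar> powr q) K'" if "supported_in \<psi> K'" for \<psi> :: "'a \<Rightarrow> real"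
    using that by (simp add: supported_in_def)
  \<comment> \<open>The factor 1 plays the part of \<open>w\<close> in
    \<open>set_integral_supported\<close>.\<close>
  have 2: "(\<lambda>n. LBINT x:S. 1 * \<bar>\<Phi> n x\<bar> powr q) \<longlonglongrightarrow> (LBINT x:S. 1 * \<bar>\<zeta> x\<bar> powr q)"
    unfolding set_integral_supported[OF supp_pow[OF supp] K'(2)] set_integral_supported[OF supp_pow[OF supp'] K'(2)]
  proof (rule integral_dominated_convergence[where w="\<lambda>x. indicator K' x *\<^sub>R (c + 1) powr q"])
    show "AE x in lborel. (\<lambda>n. (indicator K' x *\<^sub>R 1) * \<bar>\<Phi> n x\<bar> powr q) \<longlonglongrightarrow> (indicator K' x *\<^sub>R 1) * \<bar>\<zeta> x\<bar> powr q"
      using lim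
    proof eventually_elim
      case (elim x)
      then show ?case using q by (intro tendsto_mult_left tendsto_powr' tendsto_rabs tendsto_const) auto
    qed
    show "AE x in lborel. norm ((indicator K' x *\<^sub>R 1) * \<bar>\<Phi> n x\<bar> powr q) \<le> indicator K' x *\<^sub>R (c + 1) powr q" for n
      using bnd q by (intro AE_I2) (auto simp: indicator_def intro!: powr_mono2)
    show "integrable lborel (\<lambda>x. indicator K' x *\<^sub>R (c + 1) powr q)"
      using K'(1) by (intro integrable_indicator) (simp_all add: emeasure_compact_finite[simplified])
  qed measurable
  show ?thesis
  proof (rule LIMSEQ_le)
    show "(\<lambda>n. \<bar>LBINT x:S. w x * \<Phi> n x\<bar>) \<longlonglongrightarrow> \<bar>LBINT x:S. w x * \<zeta> x\<bar>"
      using 1 by (rule tendsto_rabs)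
    show "(\<lambda>n. C + D * (LBINT x:S. \<bar>\<Phi> n x\<bar> powr q)) \<longlonglongrightarrow> C + D * (LBINT x:S. \<bar>\<zeta> x\<bar> powr q)"
      using 2 by (intro tendsto_intros) simp
    show "\<exists>N. \<forall>n\<ge>N. \<bar>LBINT x:S. w x * \<Phi> n x\<bar> \<le> C + D * (LBINT x:S. \<bar>\<Phi> n x\<bar> powr q)"
      using bound test_functionI[OF \<Phi> K'(1,2) supp] by blast
  qed
qed

section \<open>Locally integrable functions and weak derivatives\<close>

lemma set_borel_measurable_mult:
  fixes f g :: "'a \<Rightarrow> real"
  assumes "set_borel_measurable M S f" "set_borel_measurable M S g"
  shows "set_borel_measurable M S (\<lambda>x. f x * g x)"
proof -
  have "(\<lambda>x. (indicator S x *\<^sub>R f x) * (indicator S x *\<^sub>R g x)) \<in> borel_measurable M"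
    using assms unfolding set_borel_measurable_def by (rule borel_measurable_times)
  then show ?thesis unfolding set_borel_measurable_def
    by (rule measurable_cong[THEN iffD1, rotated]) (simp add: indicator_def)
qed

lemma set_borel_measurable_add:
  fixes f g :: "'a \<Rightarrow> real"
  assumes "set_borel_measurable M S f" "set_borel_measurable M S g"
  shows "set_borel_measurable M S (\<lambda>x. f x + g x)"
  using borel_measurable_add[OF assms[unfolded set_borel_measurable_def]]
  by (simp add: set_borel_measurable_def distrib_left)

lemma set_borel_measurable_diff:
  fixes f g :: "'a \<Rightarrow> real"
  assumes "set_borel_measurable M S f" "set_borel_measurable M S g"
  shows "set_borel_measurable M S (\<lambda>x. f x - g x)"
  using borel_measurable_diff[OF assms[unfolded set_borel_measurable_def]]
  by (simp add: set_borel_measurable_def right_diff_distrib)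

lemma set_borel_measurable_cmult:
  fixes f :: "'a \<Rightarrow> real"
  assumes "set_borel_measurable M S f"
  shows "set_borel_measurable M S (\<lambda>x. c * f x)"
  using borel_measurable_times[OF borel_measurable_const[of c] assms[unfolded set_borel_measurable_def]]
  by (simp add: set_borel_measurable_def mult.left_commute)

lemma set_borel_measurable_sum:
  fixes f :: "'i \<Rightarrow> 'a \<Rightarrow> real"
  assumes "\<And>i. i \<in> I \<Longrightarrow> set_borel_measurable M S (f i)"
  shows "set_borel_measurable M S (\<lambda>x. \<Sum>i\<in>I. f i x)"
  using borel_measurable_sum[of I "\<lambda>i x. indicator S x *\<^sub>R f i x" M] assms
  by (simp add: set_borel_measurable_def sum_distrib_left)

lemma set_borel_measurable_zero: "set_borel_measurable M S (\<lambda>_. 0 :: real)"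
  by (simp add: set_borel_measurable_def)

lemma set_borel_measurable_comp:
  fixes f :: "'a \<Rightarrow> real" and h :: "real \<Rightarrow> real"
  assumes f: "set_borel_measurable M S f" and h: "h \<in> borel_measurable borel" and S: "S \<in> sets M"
  shows "set_borel_measurable M S (\<lambda>x. h (f x))"
proof -
  note [measurable] = f[unfolded set_borel_measurable_def] h S
  have "(\<lambda>x. indicator S x *\<^sub>R h (indicator S x *\<^sub>R f x)) \<in> borel_measurable M"
    by measurable
  then show ?thesis unfolding set_borel_measurable_def
    by (rule measurable_cong[THEN iffD1, rotated]) (simp add: indicator_def)
qed

lemma set_borel_measurable_mono:
  fixes f :: "'a \<Rightarrow> real"
  assumes "set_borel_measurable M S f" "A \<in> sets M" "A \<subseteq> S"
  shows "set_borel_measurable M A f"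
proof -
  note [measurable] = assms(1)[unfolded set_borel_measurable_def] assms(2)
  have "(\<lambda>x. indicator A x *\<^sub>R (indicator S x *\<^sub>R f x)) \<in> borel_measurable M" by measurable
  then show ?thesis unfolding set_borel_measurable_def
    by (rule measurable_cong[THEN iffD1, rotated]) (use assms(3) in \<open>auto simp: indicator_def\<close>)
qed

lemma borel_set_borel_measurable:
  "f \<in> borel_measurable M \<Longrightarrow> S \<in> sets M \<Longrightarrow> set_borel_measurable M S (f :: 'a \<Rightarrow> real)"
  unfolding set_borel_measurable_def
  by (intro borel_measurable_scaleR borel_measurable_indicator)

lemma set_integral_cong_AE':
  fixes f g :: "'a \<Rightarrow> real"
  assumes "set_borel_measurable M S f" "set_borel_measurable M S g"
    and "AE x in M. x \<in> S \<longrightarrow> f x = g x"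
  shows "(LINT x:S|M. f x) = (LINT x:S|M. g x)"
  unfolding set_lebesgue_integral_def
  using assms(1,2) unfolding set_borel_measurable_def
  by (rule integral_cong_AE) (use assms(3) in \<open>auto simp: indicator_def\<close>)

lemma set_integrable_cong_AE':
  fixes f g :: "'a \<Rightarrow> real"
  assumes "set_borel_measurable M S g" "set_integrable M S f"
    and "AE x in M. x \<in> S \<longrightarrow> f x = g x"
  shows "set_integrable M S g"
  unfolding set_integrable_def
proof (rule integrable_cong_AE_imp)
  show "integrable M (\<lambda>x. indicator S x *\<^sub>R f x)" using assms(2) by (simp add: set_integrable_def)
  show "AE x in M. indicator S x *\<^sub>R f x = indicator S x *\<^sub>R g x"
    using assms(3) by (auto simp: indicator_def)
qed (use assms(1) in \<open>simp add: set_borel_measurable_def\<close>)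

lemma set_integrable_bound':
  fixes f g :: "'a \<Rightarrow> real"
  assumes "set_integrable M S f" "set_borel_measurable M S g"
    and "AE x in M. x \<in> S \<longrightarrow> \<bar>g x\<bar> \<le> f x"
  shows "set_integrable M S g"
  unfolding set_integrable_def
proof (rule Bochner_Integration.integrable_bound)
  show "integrable M (\<lambda>x. indicator S x *\<^sub>R f x)" using assms(1) by (simp add: set_integrable_def)
  show "AE x in M. norm (indicator S x *\<^sub>R g x) \<le> norm (indicator S x *\<^sub>R f x)"
    using assms(3) by eventually_elim (auto simp: indicator_def)
qed (use assms(2) in \<open>simp add: set_borel_measurable_def\<close>)

lemma set_integrable_imp_set_borel_measurable:
  "set_integrable M S f \<Longrightarrow> set_borel_measurable M S (f :: 'a \<Rightarrow> real)"
  unfolding set_integrable_def set_borel_measurable_def by (rule borel_measurable_integrable)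

lemma set_integral_AE_zero:
  fixes f :: "'a \<Rightarrow> real"
  assumes "AE x in M. x \<in> S \<longrightarrow> f x = 0"
  shows "(LINT x:S|M. f x) = 0"
  unfolding set_lebesgue_integral_def
  by (rule integral_eq_zero_AE) (use assms in \<open>auto simp: indicator_def\<close>)

text \<open>Local integrability speaks about compact subsets only; the truncations to a compact
  exhaustion converge pointwise to the truncation to \<open>S\<close>.\<close>

lemma set_borel_measurable_exhaust:
  fixes S :: "'a::euclidean_space set" and f :: "'a \<Rightarrow> real"
  assumes "open S" "\<And>K. compact K \<Longrightarrow> K \<subseteq> S \<Longrightarrow> set_borel_measurable lborel K f"
  shows "set_borel_measurable lborel S f"
proof -
  obtain C where C: "\<And>n. compact (C n)" "\<And>n. C n \<subseteq> S" "\<And>n. C n \<subseteq> interior (C (Suc n))"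
      "\<Union> (range C) = S" "\<And>K. \<lbrakk>compact K; K \<subseteq> S\<rbrakk> \<Longrightarrow> \<exists>N. \<forall>n\<ge>N. K \<subseteq> (C n)"
    by (rule open_Union_compact_subsets[OF assms(1)]) (rule that)
  show ?thesis
    unfolding set_borel_measurable_def
  proof (rule borel_measurable_LIMSEQ_real)
    fix n show "(\<lambda>x. indicator (C n) x *\<^sub>R f x) \<in> borel_measurable lborel"
      using assms(2)[OF C(1,2)] by (simp add: set_borel_measurable_def)
  next
    fix x
    show "(\<lambda>n. indicator (C n) x *\<^sub>R f x) \<longlonglongrightarrow> indicator S x *\<^sub>R f x"
    proof (cases "x \<in> S")
      case True
      then obtain N where "\<forall>n\<ge>N. x \<in> C n" using C(5)[of "{x}"] by auto
      then show ?thesis using True by (intro tendsto_eventually) (auto simp: eventually_at_top_linorder indicator_def)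
    next
      case False
      then have "x \<notin> C n" for n using C(2) by blast
      then show ?thesis using False by simp
    qed
  qed
qed

lemma locally_integrable_measurable:
  "open S \<Longrightarrow> locally_integrable S f \<Longrightarrow> set_borel_measurable lborel S f"
  by (rule set_borel_measurable_exhaust)
    (auto simp: locally_integrable_def intro: set_integrable_imp_set_borel_measurable)

lemma locally_integrable_cmult: "locally_integrable S f \<Longrightarrow> locally_integrable S (\<lambda>x. c * f x)"
  unfolding locally_integrable_def by auto

lemma locally_integrable_diff:
  "locally_integrable S f \<Longrightarrow> locally_integrable S g \<Longrightarrow> locally_integrable S (\<lambda>x. f x - g x)"
  unfolding locally_integrable_def by auto

lemma locally_integrable_zero: "locally_integrable S (\<lambda>_. 0)"
  by (simp add: locally_integrable_def set_integrable_def)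

lemma locally_integrable_cong_AE:
  assumes "locally_integrable S f" "set_borel_measurable lborel S g"
    "AE x in lborel. x \<in> S \<longrightarrow> f x = g x"
  shows "locally_integrable S g"
  unfolding locally_integrable_def
proof (intro allI impI)
  fix K assume K: "compact K \<and> K \<subseteq> S"
  then have "set_borel_measurable lborel K g"
    using set_borel_measurable_mono[OF assms(2), of K] by (simp add: borel_compact)
  then show "set_integrable lborel K g"
  proof (rule set_integrable_cong_AE')
    show "set_integrable lborel K f" using assms(1) K by (simp add: locally_integrable_def)
    show "AE x in lborel. x \<in> K \<longrightarrow> f x = g x" using assms(3) K by auto
  qed
qed

lemma locally_integrable_mult_test:
  fixes S :: "'a::euclidean_space set"
  assumes "open S" "locally_integrable S w" "smooth \<phi>" "compact K" "K \<subseteq> S" "supported_in \<phi> K"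
  shows "set_integrable lborel S (\<lambda>x. w x * \<phi> x)"
proof -
  obtain B where B: "B > 0" "\<And>x. \<bar>\<phi> x\<bar> \<le> B"
    by (rule smooth_compact_support_bounded[OF assms(3,4,6)]) (rule that)
  have [measurable]: "\<phi> \<in> borel_measurable borel" using assms(3) by (rule smooth_measurable)
  have w: "integrable lborel (\<lambda>x. indicator K x *\<^sub>R w x)"
    using assms by (simp add: locally_integrable_def set_integrable_def)
  note [measurable] = borel_measurable_integrable[OF w]
  have "integrable lborel (\<lambda>x. (indicator K x *\<^sub>R w x) * \<phi> x)"
  proof (rule Bochner_Integration.integrable_bound)
    show "integrable lborel (\<lambda>x. B * (indicator K x *\<^sub>R w x))" using w by (rule integrable_mult_right)
    show "AE x in lborel. norm ((indicator K x *\<^sub>R w x) * \<phi> x) \<le> norm (B * (indicator K x *\<^sub>R w x))"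
    proof (rule AE_I2)
      fix x show "norm ((indicator K x *\<^sub>R w x) * \<phi> x) \<le> norm (B * (indicator K x *\<^sub>R w x))"
        using mult_right_mono[OF B(2)[of x], of "\<bar>indicator K x *\<^sub>R w x\<bar>"] B(1)
        by (simp add: abs_mult mult.commute)
    qed
  qed measurable
  then show ?thesis unfolding set_integrable_def
    by (rule Bochner_Integration.integrable_cong[THEN iffD1, rotated 2])
      (use assms(5,6) in \<open>auto simp: indicator_def supported_in_def\<close>)
qed

lemma test_function_pd_integrable:
  assumes "open S" "locally_integrable S w" "test_function S \<phi>" "set bs \<subseteq> Basis"
  shows "set_integrable lborel S (\<lambda>x. w x * pd bs \<phi> x)"
  using assms(3)
proof (rule test_functionE)
  fix K assume "smooth \<phi>" "compact K" "K \<subseteq> S" "supported_in \<phi> K"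
  then show ?thesis
    using assms smooth_pd supported_in_pd by (intro locally_integrable_mult_test) auto
qed

lemma test_function_integrable:
  assumes "open S" "locally_integrable S w" "test_function S \<phi>"
  shows "set_integrable lborel S (\<lambda>x. w x * \<phi> x)"
  using test_function_pd_integrable[OF assms, of "[]"] by simp

text \<open>If |w| exceeded \<open>M\<close> on a set of positive measure, the sign of
  \<open>w\<close> on a compact part of that set would violate the bound. That sign is measurable
  and bounded, hence admissible after \<open>dual_bound_extend\<close>.\<close>

lemma AE_bounded_of_dual_bound:
  fixes S :: "'a::euclidean_space set"
  assumes S: "open S" and w: "locally_integrable S w" and M: "0 \<le> M"
    and bound: "\<And>\<phi>. test_function S \<phi> \<Longrightarrow> \<bar>LBINT x:S. w x * \<phi> x\<bar> \<le> M * (LBINT x:S. \<bar>\<phi> x\<bar>)"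
  shows "AE x in lborel. x \<in> S \<longrightarrow> \<bar>w x\<bar> \<le> M"
proof -
  obtain C where C: "\<And>n. compact (C n)" "\<And>n. C n \<subseteq> S" "\<And>n. C n \<subseteq> interior (C (Suc n))"
      "\<Union> (range C) = S" "\<And>K. \<lbrakk>compact K; K \<subseteq> S\<rbrakk> \<Longrightarrow> \<exists>N. \<forall>n\<ge>N. K \<subseteq> (C n)"
    by (rule open_Union_compact_subsets[OF S]) (rule that)
  define W where "W x = indicator S x *\<^sub>R w x" for x
  have [measurable]: "W \<in> borel_measurable borel"
    using locally_integrable_measurable[OF S w] by (simp add: W_def[abs_def] set_borel_measurable_def)
  have "AE x in lborel. x \<in> C n \<longrightarrow> \<bar>w x\<bar> \<le> M" for n
  proof -
    have [measurable]: "C n \<in> sets borel" using C(1) by (simp add: compact_imp_closed)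
    define \<zeta> where "\<zeta> x = indicator (C n) x * (if \<bar>W x\<bar> > M then sgn (W x) else 0)" for x
    have [measurable]: "\<zeta> \<in> borel_measurable borel" unfolding \<zeta>_def[abs_def]
      by (intro borel_measurable_times borel_measurable_indicator measurable_If) measurable
    have "\<bar>LBINT x:S. w x * \<zeta> x\<bar> \<le> 0 + M * (LBINT x:S. \<bar>\<zeta> x\<bar> powr 1)"
    proof (rule dual_bound_extend[OF S w, where K="C n" and c=1])
      show "\<bar>LBINT x:S. w x * \<phi> x\<bar> \<le> 0 + M * (LBINT x:S. \<bar>\<phi> x\<bar> powr 1)"
        if "test_function S \<phi>" for \<phi> using bound[OF that] by simp
      show "\<bar>\<zeta> x\<bar> \<le> 1" for x by (simp add: \<zeta>_def indicator_def sgn_if)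
      show "supported_in \<zeta> (C n)" by (simp add: \<zeta>_def supported_in_def)
    qed (use C(1,2) in simp_all)
    moreover have "(LBINT x:S. w x * \<zeta> x)
        = (LINT x|lborel. indicator (C n) x * (if \<bar>W x\<bar> > M then \<bar>W x\<bar> else 0))"
      unfolding set_lebesgue_integral_def using C(2)[of n]
      by (intro Bochner_Integration.integral_cong) (use M in \<open>auto simp: \<zeta>_def W_def indicator_def sgn_if\<close>)
    moreover have "(LBINT x:S. \<bar>\<zeta> x\<bar> powr 1)
        = (LINT x|lborel. indicator (C n) x * (if \<bar>W x\<bar> > M then 1 else 0))"
      unfolding set_lebesgue_integral_def using C(2)[of n]
      by (intro Bochner_Integration.integral_cong) (use M in \<open>auto simp: \<zeta>_def W_def indicator_def sgn_if\<close>)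
    ultimately have le: "(LINT x|lborel. indicator (C n) x * (if \<bar>W x\<bar> > M then \<bar>W x\<bar> else 0))
        \<le> M * (LINT x|lborel. indicator (C n) x * (if \<bar>W x\<bar> > M then 1 else 0))"
      by (simp add: abs_le_iff)
    have CW: "integrable lborel (\<lambda>x. indicator (C n) x *\<^sub>R w x)"
      using w C by (simp add: locally_integrable_def set_integrable_def)
    have i1: "integrable lborel (\<lambda>x. indicator (C n) x * (if \<bar>W x\<bar> > M then \<bar>W x\<bar> else 0))"
    proof (rule Bochner_Integration.integrable_bound[OF CW])
      have "W x = w x" if "x \<in> C n" for x using that C(2)[of n] by (auto simp: W_def indicator_def)
      then show "AE x in lborel. norm (indicator (C n) x * (if \<bar>W x\<bar> > M then \<bar>W x\<bar> else 0))
          \<le> norm (indicator (C n) x *\<^sub>R w x)" by (intro AE_I2) (simp add: indicator_def)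
    qed measurable
    have i2: "integrable lborel (\<lambda>x. indicator (C n) x * (if \<bar>W x\<bar> > M then 1 else 0 :: real))"
    proof (rule Bochner_Integration.integrable_bound)
      show "integrable lborel (\<lambda>x. indicator (C n) x *\<^sub>R (1::real))"
        using C(1)[of n] by (intro integrable_indicator) (simp_all add: emeasure_compact_finite[simplified])
      show "AE x in lborel. norm (indicator (C n) x * (if \<bar>W x\<bar> > M then 1 else 0 :: real))
          \<le> norm (indicator (C n) x *\<^sub>R (1::real))" by (intro AE_I2) (simp add: indicator_def)
    qed measurable
    \<comment> \<open>This is the positive part of |w| - M on \<open>C n\<close>. It is nonnegative
      with nonpositive integral, hence zero a.e.\<close>
    let ?h = "\<lambda>x. indicator (C n) x * (if \<bar>W x\<bar> > M then \<bar>W x\<bar> else 0)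
        - M * (indicator (C n) x * (if \<bar>W x\<bar> > M then 1 else 0))"
    have "(LINT x|lborel. ?h x) \<le> 0" using le i1 i2 by simp
    moreover have nn: "AE x in lborel. 0 \<le> ?h x" using M by (intro AE_I2) (simp add: indicator_def)
    ultimately have "(LINT x|lborel. ?h x) = 0"
      using integral_nonneg_AE[OF nn] by linarith
    moreover have "integrable lborel ?h" using i1 i2 by auto
    ultimately have "AE x in lborel. ?h x = 0"
      using integral_nonneg_eq_0_iff_AE[OF _ nn] by blast
    then show ?thesis
    proof eventually_elim
      case (elim x)
      show ?case
      proof
        assume x: "x \<in> C n"
        then have "W x = w x" using C(2)[of n] by (auto simp: W_def indicator_def)
        then show "\<bar>w x\<bar> \<le> M" using elim x
          by (cases "w x = 0") (auto split: if_splits simp: not_le[symmetric])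
      qed
    qed
  qed
  then have "AE x in lborel. \<forall>n. x \<in> C n \<longrightarrow> \<bar>w x\<bar> \<le> M" unfolding AE_all_countable by blast
  then show ?thesis by eventually_elim (use C(4) in auto)
qed

section \<open>Homogeneity and uniqueness of weak derivatives\<close>

lemma has_weak_deriv_scale:
  fixes S :: "'a::euclidean_space set"
  assumes S: "open S" and bs: "set bs \<subseteq> Basis" and f: "has_weak_deriv S bs f g"
    and f': "set_borel_measurable lborel S f'" "AE x in lborel. x \<in> S \<longrightarrow> f' x = c * f x"
  shows "has_weak_deriv S bs f' (\<lambda>x. c * g x)"
  unfolding has_weak_deriv_def
proof (intro conjI allI impI)
  note f = f[unfolded has_weak_deriv_def]
  show l: "locally_integrable S f'"
    by (rule locally_integrable_cong_AE[of _ "\<lambda>x. c * f x"])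
      (use f f' in \<open>auto intro: locally_integrable_cmult\<close>)
  show "locally_integrable S (\<lambda>x. c * g x)" using f by (simp add: locally_integrable_cmult)
  fix \<phi> assume \<phi>: "test_function S \<phi>"
  have i: "set_integrable lborel S (\<lambda>x. f x * pd bs \<phi> x)" "set_integrable lborel S (\<lambda>x. f' x * pd bs \<phi> x)"
    using test_function_pd_integrable[OF S _ \<phi> bs] f l by auto
  have "(LBINT x:S. f' x * pd bs \<phi> x) = (LBINT x:S. c * (f x * pd bs \<phi> x))"
    by (rule set_integral_cong_AE')
      (use i f'(2) in \<open>auto intro!: set_integrable_imp_set_borel_measurable\<close>)
  also have "\<dots> = c * ((-1) ^ length bs * (LBINT x:S. g x * \<phi> x))" using f \<phi> by simp
  also have "\<dots> = (-1) ^ length bs * (LBINT x:S. c * g x * \<phi> x)" by (simp add: mult.assoc)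
  finally show "(LBINT x:S. f' x * pd bs \<phi> x) = (-1) ^ length bs * (LBINT x:S. c * g x * \<phi> x)" .
qed

lemma has_weak_deriv_diff:
  fixes S :: "'a::euclidean_space set"
  assumes S: "open S" and bs: "set bs \<subseteq> Basis"
    and f: "has_weak_deriv S bs f g" and f': "has_weak_deriv S bs f' g'"
  shows "has_weak_deriv S bs (\<lambda>x. f x - f' x) (\<lambda>x. g x - g' x)"
  unfolding has_weak_deriv_def
proof (intro conjI allI impI)
  note f = f[unfolded has_weak_deriv_def] and f' = f'[unfolded has_weak_deriv_def]
  show "locally_integrable S (\<lambda>x. f x - f' x)" "locally_integrable S (\<lambda>x. g x - g' x)"
    using f f' by (auto intro: locally_integrable_diff)
  fix \<phi> assume \<phi>: "test_function S \<phi>"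
  have i: "set_integrable lborel S (\<lambda>x. f x * pd bs \<phi> x)" "set_integrable lborel S (\<lambda>x. f' x * pd bs \<phi> x)"
    "set_integrable lborel S (\<lambda>x. g x * \<phi> x)" "set_integrable lborel S (\<lambda>x. g' x * \<phi> x)"
    using test_function_pd_integrable[OF S _ \<phi> bs] test_function_integrable[OF S _ \<phi>] f f' by auto
  then show "(LBINT x:S. (f x - f' x) * pd bs \<phi> x) = (-1) ^ length bs * (LBINT x:S. (g x - g' x) * \<phi> x)"
    using f f' \<phi> by (simp add: left_diff_distrib right_diff_distrib set_integral_diff)
qed

lemma has_weak_deriv_zero: "has_weak_deriv S bs (\<lambda>_. 0) (\<lambda>_. 0)"
  by (simp add: has_weak_deriv_def locally_integrable_zero)

text \<open>The case M = 0 of \<open>AE_bounded_of_dual_bound\<close>, applied to the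
  difference.\<close>

lemma AE_eq_of_test_functions:
  fixes S :: "'a::euclidean_space set"
  assumes S: "open S" and "locally_integrable S g" "locally_integrable S g'"
    and eq: "\<And>\<phi>. test_function S \<phi> \<Longrightarrow> (LBINT x:S. g x * \<phi> x) = (LBINT x:S. g' x * \<phi> x)"
  shows "AE x in lborel. x \<in> S \<longrightarrow> g x = g' x"
proof -
  have "AE x in lborel. x \<in> S \<longrightarrow> \<bar>g x - g' x\<bar> \<le> 0"
  proof (rule AE_bounded_of_dual_bound[OF S])
    show "locally_integrable S (\<lambda>x. g x - g' x)" using assms by (intro locally_integrable_diff)
    fix \<phi> assume \<phi>: "test_function S \<phi>"
    have "(LBINT x:S. (g x - g' x) * \<phi> x) = 0"
      using test_function_integrable[OF S assms(2) \<phi>] test_function_integrable[OF S assms(3) \<phi>] eq[OF \<phi>]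
      by (simp add: left_diff_distrib set_integral_diff)
    then show "\<bar>LBINT x:S. (g x - g' x) * \<phi> x\<bar> \<le> 0 * (LBINT x:S. \<bar>\<phi> x\<bar>)" by simp
  qed simp
  then show ?thesis by eventually_elim auto
qed

lemma has_weak_deriv_unique:
  fixes S :: "'a::euclidean_space set"
  assumes "open S" "has_weak_deriv S bs f g" "has_weak_deriv S bs f g'"
  shows "AE x in lborel. x \<in> S \<longrightarrow> g x = g' x"
  by (rule AE_eq_of_test_functions) (use assms in \<open>auto simp: has_weak_deriv_def\<close>)

lemma has_weak_deriv_weak_deriv:
  "has_weak_deriv S bs f g \<Longrightarrow> has_weak_deriv S bs f (weak_deriv S bs f)"
  unfolding weak_deriv_def by (auto intro: someI[of "has_weak_deriv S bs f"])

text \<open>Unconditional, since the default value 0 is locally integrable too. Measurability of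
  \<open>dt\<close>, \<open>lap\<close> and \<open>grad\<close> therefore never depends on the
  existence of the derivatives.\<close>

lemma weak_deriv_locally_integrable: "locally_integrable S (weak_deriv S bs f)"
proof (cases "\<exists>g. has_weak_deriv S bs f g")
  case True
  then show ?thesis using has_weak_deriv_weak_deriv by (auto simp: has_weak_deriv_def)
next
  case False
  then show ?thesis by (simp add: weak_deriv_def locally_integrable_zero)
qed

lemma weak_deriv_measurable: "open S \<Longrightarrow> set_borel_measurable lborel S (weak_deriv S bs f)"
  by (rule locally_integrable_measurable[OF _ weak_deriv_locally_integrable])

lemma weak_deriv_AE_eq:
  fixes S :: "'a::euclidean_space set"
  assumes "open S" "has_weak_deriv S bs f g"
  shows "AE x in lborel. x \<in> S \<longrightarrow> weak_deriv S bs f x = g x"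
  by (rule has_weak_deriv_unique[OF assms(1) has_weak_deriv_weak_deriv[OF assms(2)] assms(2)])

text \<open>No weak derivative is assumed to exist. For nonzero c, one of \<open>f\<close> for which
  none exists excludes one of \<open>f'\<close>, by scaling back with 1/c, and both sides are the
  default 0. For c = 0 the function \<open>f'\<close> vanishes a.e. and has weak derivative
  0.\<close>

lemma weak_deriv_scale:
  fixes S :: "'a::euclidean_space set"
  assumes S: "open S" and bs: "set bs \<subseteq> Basis"
    and f: "set_borel_measurable lborel S f" and f': "set_borel_measurable lborel S f'"
    and eq: "AE x in lborel. x \<in> S \<longrightarrow> f' x = c * f x"
  shows "AE x in lborel. x \<in> S \<longrightarrow> weak_deriv S bs f' x = c * weak_deriv S bs f x"
proof (cases "\<exists>g. has_weak_deriv S bs f g")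
  case True
  then have "has_weak_deriv S bs f (weak_deriv S bs f)" using has_weak_deriv_weak_deriv by blast
  from weak_deriv_AE_eq[OF S has_weak_deriv_scale[OF S bs this f' eq]] show ?thesis .
next
  case False
  then have 0: "weak_deriv S bs f = (\<lambda>_. 0)" by (simp add: weak_deriv_def)
  show ?thesis
  proof (cases "c = 0")
    case True
    have "has_weak_deriv S bs f' (\<lambda>x. 0 * 0)"
      using has_weak_deriv_scale[OF S bs has_weak_deriv_zero f', of 0] eq True by simp
    from weak_deriv_AE_eq[OF S this] show ?thesis using 0 by simp
  next
    case c: False
    have "AE x in lborel. x \<in> S \<longrightarrow> f x = (1 / c) * f' x"
      using eq by eventually_elim (use c in simp)
    then have "\<not> has_weak_deriv S bs f' g" for g
      using has_weak_deriv_scale[OF S bs _ f, of f' g "1 / c"] False by blast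
    then show ?thesis using 0 by (simp add: weak_deriv_def)
  qed
qed

lemma weak_deriv_diff:
  fixes S :: "'a::euclidean_space set"
  assumes S: "open S" and bs: "set bs \<subseteq> Basis"
    and f: "has_weak_deriv S bs f g" and f': "has_weak_deriv S bs f' g'"
  shows "AE x in lborel. x \<in> S \<longrightarrow>
    weak_deriv S bs (\<lambda>x. f x - f' x) x = weak_deriv S bs f x - weak_deriv S bs f' x"
  using weak_deriv_AE_eq[OF S has_weak_deriv_diff[OF S bs
      has_weak_deriv_weak_deriv[OF f] has_weak_deriv_weak_deriv[OF f']]] .

section \<open>Invariance of the function spaces under scaling\<close>

lemma Lp_space_cmult:
  assumes "f \<in> Lp_space A p"
  shows "(\<lambda>x. c * f x) \<in> Lp_space A p"
  using assms unfolding Lp_space_def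
  by (simp add: set_borel_measurable_cmult abs_mult powr_mult)

lemma gagliardo_cmult: "gagliardo \<sigma> p (\<lambda>x. c * g x) z = \<bar>c\<bar> powr p * gagliardo \<sigma> p g z"
  by (cases z) (simp add: gagliardo_def abs_mult powr_mult flip: right_diff_distrib)

lemma sobolev_measurable: "u \<in> sobolev \<Omega> s p \<Longrightarrow> set_borel_measurable lborel \<Omega> u"
  by (simp add: sobolev_def Lp_space_def)

lemma sobolev_has_weak_deriv:
  "u \<in> sobolev \<Omega> s p \<Longrightarrow> bs \<in> multi_indices (nat \<lfloor>s\<rfloor>) \<Longrightarrow> \<exists>g\<in>Lp_space \<Omega> p. has_weak_deriv \<Omega> bs u g"
  unfolding sobolev_def by blast

lemma multi_indices_Basis: "bs \<in> multi_indices k \<Longrightarrow> set bs \<subseteq> Basis"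
  by (simp add: multi_indices_def)

lemma finite_multi_indices: "finite (multi_indices k)"
  unfolding multi_indices_def by (rule finite_lists_length_le) simp

lemma sobolev_cmult:
  fixes \<Omega> :: "'a::euclidean_space set"
  assumes "open \<Omega>" "u \<in> sobolev \<Omega> s p"
  shows "(\<lambda>x. c * u x) \<in> sobolev \<Omega> s p"
  unfolding sobolev_def
proof (rule CollectI, intro conjI ballI)
  show "(\<lambda>x. c * u x) \<in> Lp_space \<Omega> p" using assms(2) by (simp add: sobolev_def Lp_space_cmult)
  fix bs :: "'a list" assume bs: "bs \<in> multi_indices (nat \<lfloor>s\<rfloor>)"
  then obtain g where g: "g \<in> Lp_space \<Omega> p" "has_weak_deriv \<Omega> bs u g"
    "length bs = nat \<lfloor>s\<rfloor> \<and> frac s > 0 \<longrightarrow> set_integrable lborel (\<Omega> \<times> \<Omega>) (gagliardo (frac s) p g)"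
    using assms(2) unfolding sobolev_def by blast
  have "has_weak_deriv \<Omega> bs (\<lambda>x. c * u x) (\<lambda>x. c * g x)"
    by (rule has_weak_deriv_scale[OF assms(1) multi_indices_Basis[OF bs] g(2)])
      (auto intro: set_borel_measurable_cmult sobolev_measurable[OF assms(2)])
  moreover have "gagliardo (frac s) p (\<lambda>x. c * g x) = (\<lambda>z. \<bar>c\<bar> powr p * gagliardo (frac s) p g z)"
    by (rule ext) (rule gagliardo_cmult)
  ultimately show "\<exists>g\<in>Lp_space \<Omega> p. has_weak_deriv \<Omega> bs (\<lambda>x. c * u x) g \<and>
      (length bs = nat \<lfloor>s\<rfloor> \<and> frac s > 0 \<longrightarrow>
         set_integrable lborel (\<Omega> \<times> \<Omega>) (gagliardo (frac s) p g))"
    using g Lp_space_cmult by (intro bexI[of _ "\<lambda>x. c * g x"]) auto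
qed

text \<open>Lets an a.e. identity between derivatives be used in the Gagliardo double integral,
  whose integrand evaluates them at two independent points.\<close>

lemma AE_product_of_AE:
  fixes P :: "'a::euclidean_space \<Rightarrow> bool"
  assumes "AE x in lborel. P x"
  shows "AE z in (lborel :: ('a \<times> 'a) measure). P (fst z) \<and> P (snd z)"
proof -
  obtain N where N: "N \<in> null_sets lborel" "{x. \<not> P x} \<subseteq> N"
    using assms unfolding eventually_ae_filter by auto
  then have [measurable]: "N \<in> sets borel" by auto
  have n: "AE x in lborel. x \<notin> N" using N(1) by (rule AE_not_in)
  have "AE z in (lborel \<Otimes>\<^sub>M lborel). fst z \<notin> N \<and> snd z \<notin> N"
  proof (rule lborel_pair.AE_pair_measure)
    show "AE x in lborel. AE y in lborel. fst (x, y) \<notin> N \<and> snd (x, y) \<notin> N"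
      using n by eventually_elim (use n in auto)
  qed measurable
  then have "AE z in lborel. fst z \<notin> N \<and> snd z \<notin> N" unfolding lborel_prod .
  then show ?thesis by eventually_elim (use N(2) in auto)
qed

lemma gagliardo_measurable:
  fixes g :: "'a::euclidean_space \<Rightarrow> real"
  assumes "open \<Omega>" "set_borel_measurable lborel \<Omega> g"
  shows "set_borel_measurable lborel (\<Omega> \<times> \<Omega>) (gagliardo \<sigma> p g)"
proof -
  have [measurable]: "\<Omega> \<in> sets borel" using assms(1) by simp
  define G where "G x = indicator \<Omega> x *\<^sub>R g x" for x
  have [measurable]: "G \<in> borel_measurable borel"
    using assms(2) by (simp add: G_def[abs_def] set_borel_measurable_def)
  have "(\<lambda>z. indicator \<Omega> (fst z) * indicator \<Omega> (snd z) *
      (\<bar>G (fst z) - G (snd z)\<bar> powr p / norm (fst z - snd z) powr (real DIM('a) + \<sigma> * p)))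
      \<in> borel_measurable (borel \<Otimes>\<^sub>M borel)" by measurable
  then have "(\<lambda>z. indicator \<Omega> (fst z) * indicator \<Omega> (snd z) *
      (\<bar>G (fst z) - G (snd z)\<bar> powr p / norm (fst z - snd z) powr (real DIM('a) + \<sigma> * p)))
      \<in> borel_measurable borel" by (simp add: borel_prod)
  also have "(\<lambda>z. indicator \<Omega> (fst z) * indicator \<Omega> (snd z) *
      (\<bar>G (fst z) - G (snd z)\<bar> powr p / norm (fst z - snd z) powr (real DIM('a) + \<sigma> * p)))
      = (\<lambda>z. indicator (\<Omega> \<times> \<Omega>) z *\<^sub>R gagliardo \<sigma> p g z)"
    by (auto simp: fun_eq_iff indicator_def gagliardo_def G_def)
  finally show ?thesis by (simp add: set_borel_measurable_def)
qed

text \<open>Only a.e. proportionality is asked. With c = 0 the lemma says that functions vanishing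
  a.e. have norm 0, which is how bounded functionals are later shown to ignore null sets.\<close>

lemma sobolev_norm_scale:
  fixes \<Omega> :: "'a::euclidean_space set"
  assumes \<Omega>: "open \<Omega>" and p: "p > 0" and u: "set_borel_measurable lborel \<Omega> u"
    and u': "set_borel_measurable lborel \<Omega> u'" "AE x in lborel. x \<in> \<Omega> \<longrightarrow> u' x = c * u x"
  shows "sobolev_norm \<Omega> s p u' = \<bar>c\<bar> * sobolev_norm \<Omega> s p u"
proof -
  let ?k = "nat \<lfloor>s\<rfloor>"
  define A where "A u bs = (LBINT x:\<Omega>. \<bar>weak_deriv \<Omega> bs u x\<bar> powr p)" for u :: "'a \<Rightarrow> real" and bs
  define B where "B u bs = (LBINT z:\<Omega> \<times> \<Omega>. gagliardo (frac s) p (weak_deriv \<Omega> bs u) z)" for u :: "'a \<Rightarrow> real" and bs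
  let ?J = "{bs. bs \<in> multi_indices ?k \<and> length bs = ?k}"
  have wd: "AE x in lborel. x \<in> \<Omega> \<longrightarrow> weak_deriv \<Omega> bs u' x = c * weak_deriv \<Omega> bs u x"
    if "bs \<in> multi_indices ?k" for bs
    using weak_deriv_scale[OF \<Omega> multi_indices_Basis[OF that] u u'] .
  have m: "set_borel_measurable lborel \<Omega> (\<lambda>x. \<bar>weak_deriv \<Omega> bs u x\<bar> powr p)" for bs u
    by (rule set_borel_measurable_comp[OF weak_deriv_measurable[OF \<Omega>], of "\<lambda>x. \<bar>x\<bar> powr p"])
      (use \<Omega> in auto)
  have A: "A u' bs = \<bar>c\<bar> powr p * A u bs" if bs: "bs \<in> multi_indices ?k" for bs
  proof -
    have "A u' bs = (LBINT x:\<Omega>. \<bar>c\<bar> powr p * \<bar>weak_deriv \<Omega> bs u x\<bar> powr p)"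
      unfolding A_def
    proof (rule set_integral_cong_AE'[OF m set_borel_measurable_cmult[OF m]])
      show "AE x in lborel. x \<in> \<Omega> \<longrightarrow> \<bar>weak_deriv \<Omega> bs u' x\<bar> powr p
          = \<bar>c\<bar> powr p * \<bar>weak_deriv \<Omega> bs u x\<bar> powr p"
        using wd[OF bs] by eventually_elim (simp add: abs_mult powr_mult)
    qed
    then show ?thesis by (simp add: A_def)
  qed
  have B: "B u' bs = \<bar>c\<bar> powr p * B u bs" if bs: "bs \<in> multi_indices ?k" for bs
  proof -
    have "B u' bs = (LBINT z:\<Omega> \<times> \<Omega>. \<bar>c\<bar> powr p * gagliardo (frac s) p (weak_deriv \<Omega> bs u) z)"
      unfolding B_def
    proof (rule set_integral_cong_AE')
      show "AE z in lborel. z \<in> \<Omega> \<times> \<Omega> \<longrightarrow> gagliardo (frac s) p (weak_deriv \<Omega> bs u') z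
          = \<bar>c\<bar> powr p * gagliardo (frac s) p (weak_deriv \<Omega> bs u) z"
        using AE_product_of_AE[OF wd[OF bs]]
        by eventually_elim
          (auto simp: gagliardo_def abs_mult powr_mult simp flip: right_diff_distrib split: prod.splits)
    qed (intro set_borel_measurable_cmult gagliardo_measurable weak_deriv_measurable \<Omega>)+
    then show ?thesis by (simp add: B_def)
  qed
  have nn: "0 \<le> (\<Sum>bs\<in>multi_indices ?k. A u bs) + (if frac s > 0 then \<Sum>bs\<in>?J. B u bs else 0)"
    unfolding A_def B_def set_lebesgue_integral_def
    by (intro add_nonneg_nonneg sum_nonneg Bochner_Integration.integral_nonneg)
      (auto intro!: sum_nonneg Bochner_Integration.integral_nonneg simp: gagliardo_def indicator_def split: prod.splits)
  have "sobolev_norm \<Omega> s p u'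
      = ((\<Sum>bs\<in>multi_indices ?k. A u' bs) + (if frac s > 0 then \<Sum>bs\<in>?J. B u' bs else 0)) powr (1 / p)"
    by (simp add: sobolev_norm_def A_def B_def)
  also have "\<dots> = (\<bar>c\<bar> powr p *
      ((\<Sum>bs\<in>multi_indices ?k. A u bs) + (if frac s > 0 then \<Sum>bs\<in>?J. B u bs else 0))) powr (1 / p)"
    by (simp add: A B distrib_left sum_distrib_left)
  also have "\<dots> = \<bar>c\<bar> * ((\<Sum>bs\<in>multi_indices ?k. A u bs) + (if frac s > 0 then \<Sum>bs\<in>?J. B u bs else 0)) powr (1 / p)"
    using nn p by (simp add: powr_mult powr_powr)
  also have "\<dots> = \<bar>c\<bar> * sobolev_norm \<Omega> s p u"
    by (simp add: sobolev_norm_def A_def B_def)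
  finally show ?thesis .
qed

lemma sobolev_norm_cmult:
  fixes \<Omega> :: "'a::euclidean_space set"
  assumes "open \<Omega>" "p > 0" "set_borel_measurable lborel \<Omega> u"
  shows "sobolev_norm \<Omega> s p (\<lambda>x. c * u x) = \<bar>c\<bar> * sobolev_norm \<Omega> s p u"
  by (rule sobolev_norm_scale) (use assms in \<open>auto intro: set_borel_measurable_cmult\<close>)

text \<open>The multiples of an approximating sequence approximate the multiple, in the domain and
  on the boundary.\<close>

lemma has_trace_cmult:
  assumes \<Omega>: "open \<Omega>" and p: "p > 0" and t: "has_trace \<Omega> s p w g"
  shows "has_trace \<Omega> s p (\<lambda>x. c * w x) (\<lambda>x. c * g x)"
proof -
  obtain \<phi> :: "nat \<Rightarrow> real^3 \<Rightarrow> real" where \<phi>: "\<And>k. smooth (\<phi> k)"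
    "(\<lambda>k. sobolev_norm \<Omega> s p (\<lambda>x. \<phi> k x - w x)) \<longlonglongrightarrow> 0"
    "(\<lambda>k. LINT x|surface_measure \<Omega>. \<bar>\<phi> k x - g x\<bar> powr p) \<longlonglongrightarrow> 0"
    using t unfolding has_trace_def by blast
  have w: "set_borel_measurable lborel \<Omega> w" using t sobolev_measurable by (auto simp: has_trace_def)
  have "sobolev_norm \<Omega> s p (\<lambda>x. c * \<phi> k x - c * w x) = \<bar>c\<bar> * sobolev_norm \<Omega> s p (\<lambda>x. \<phi> k x - w x)" for k
  proof -
    have "set_borel_measurable lborel \<Omega> (\<lambda>x. \<phi> k x - w x)"
      using smooth_measurable[OF \<phi>(1)] w \<Omega>
      by (intro set_borel_measurable_diff[OF borel_set_borel_measurable]) auto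
    from sobolev_norm_cmult[OF \<Omega> p this, of s c] show ?thesis by (simp add: right_diff_distrib)
  qed
  then have 1: "(\<lambda>k. sobolev_norm \<Omega> s p (\<lambda>x. c * \<phi> k x - c * w x)) \<longlonglongrightarrow> 0"
    using tendsto_mult_left[OF \<phi>(2), of "\<bar>c\<bar>"] by simp
  have "(LINT x|surface_measure \<Omega>. \<bar>c * \<phi> k x - c * g x\<bar> powr p)
      = \<bar>c\<bar> powr p * (LINT x|surface_measure \<Omega>. \<bar>\<phi> k x - g x\<bar> powr p)" for k
    by (simp add: abs_mult powr_mult flip: right_diff_distrib integral_mult_right_zero)
  then have 2: "(\<lambda>k. LINT x|surface_measure \<Omega>. \<bar>c * \<phi> k x - c * g x\<bar> powr p) \<longlonglongrightarrow> 0"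
    using tendsto_mult_left[OF \<phi>(3), of "\<bar>c\<bar> powr p"] by simp
  show ?thesis unfolding has_trace_def
    using t[unfolded has_trace_def] 1 2 smooth_cmult[OF \<phi>(1)] sobolev_cmult[OF \<Omega>]
    by (auto simp: abs_mult powr_mult intro!: exI[of _ "\<lambda>k x. c * \<phi> k x"])
qed

lemma normal_deriv_zero_cmult:
  assumes \<Omega>: "open \<Omega>" and p: "p > 0" and u: "normal_deriv_zero \<Omega> s p u" "set_borel_measurable lborel \<Omega> u"
  shows "normal_deriv_zero \<Omega> s p (\<lambda>x. c * u x)"
proof -
  obtain G h where G: "\<forall>b\<in>Basis. has_weak_deriv \<Omega> [b] u (G b) \<and> has_trace \<Omega> (s - 1) p (G b) (h b)"
    and h: "AE x in surface_measure \<Omega>. (\<Sum>b\<in>Basis. h b x * (outward_normal \<Omega> x \<bullet> b)) = 0"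
    using u(1) unfolding normal_deriv_zero_def by blast
  have "AE x in surface_measure \<Omega>. (\<Sum>b\<in>Basis. c * h b x * (outward_normal \<Omega> x \<bullet> b)) = 0"
    using h by eventually_elim (simp add: mult.assoc flip: sum_distrib_left)
  moreover have "has_weak_deriv \<Omega> [b] (\<lambda>x. c * u x) (\<lambda>x. c * G b x)" if "b \<in> Basis" for b
    using G that u(2)
    by (intro has_weak_deriv_scale[OF \<Omega>, of "[b]" u]) (auto intro: set_borel_measurable_cmult)
  moreover have "has_trace \<Omega> (s - 1) p (\<lambda>x. c * G b x) (\<lambda>x. c * h b x)" if "b \<in> Basis" for b
    using G that by (intro has_trace_cmult \<Omega> p) auto
  ultimately show ?thesis unfolding normal_deriv_zero_def
    by (intro exI[of _ "\<lambda>b x. c * G b x"] exI[of _ "\<lambda>b x. c * h b x"]) auto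
qed

lemma sobolev_hat_measurable: "u \<in> sobolev_hat \<Omega> p \<Longrightarrow> set_borel_measurable lborel \<Omega> u"
  by (auto simp: sobolev_hat_def sobolev_n_def intro: sobolev_measurable split: if_splits)

lemma sobolev_hat_cmult:
  assumes "open \<Omega>" "p > 0" "u \<in> sobolev_hat \<Omega> p"
  shows "(\<lambda>x. c * u x) \<in> sobolev_hat \<Omega> p"
  using assms sobolev_hat_measurable[OF assms(3)]
  by (auto simp: sobolev_hat_def sobolev_n_def intro: sobolev_cmult normal_deriv_zero_cmult split: if_splits)

lemma X_space_measurable:
  assumes "u \<in> X_space T \<Omega> p" "t \<in> {0..T}"
  shows "set_borel_measurable lborel \<Omega> (u t)"
  using assms by (auto simp: X_space_def continuous_into_def intro: sobolev_hat_measurable)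

lemma X_space_cmult:
  assumes \<Omega>: "open \<Omega>" and p: "p > 0" and u: "u \<in> X_space T \<Omega> p"
  shows "(\<lambda>t x. c * u t x) \<in> X_space T \<Omega> p"
proof -
  have m: "set_borel_measurable lborel \<Omega> (u t)" if "t \<in> {0..T}" for t
    using X_space_measurable[OF u that] .
  have "(\<lambda>t x. c * u t x) \<in> continuous_into T (sobolev_hat \<Omega> p) (sobolev_norm \<Omega> (2 - 2 / p) p)"
    unfolding continuous_into_def
  proof (rule CollectI, intro ballI conjI)
    fix t assume t: "t \<in> {0..T}"
    have ut: "u t \<in> sobolev_hat \<Omega> p"
      and lim: "((\<lambda>r. sobolev_norm \<Omega> (2 - 2 / p) p (\<lambda>x. u r x - u t x)) \<longlongrightarrow> 0) (at t within {0..T})"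
      using u t by (auto simp: X_space_def continuous_into_def)
    show "(\<lambda>x. c * u t x) \<in> sobolev_hat \<Omega> p" using ut by (intro sobolev_hat_cmult \<Omega> p)
    have "((\<lambda>r. \<bar>c\<bar> * sobolev_norm \<Omega> (2 - 2 / p) p (\<lambda>x. u r x - u t x)) \<longlongrightarrow> 0) (at t within {0..T})"
      using tendsto_mult_left[OF lim, of "\<bar>c\<bar>"] by simp
    then show "((\<lambda>r. sobolev_norm \<Omega> (2 - 2 / p) p (\<lambda>x. c * u r x - c * u t x)) \<longlongrightarrow> 0) (at t within {0..T})"
    \<comment> \<open>The scaling of the norm needs measurable slices, and these are available only
      for times in [0, T]; hence the identity is used along the filter within that interval.\<close>
    proof (rule Lim_transform_eventually)
      show "\<forall>\<^sub>F r in at t within {0..T}. \<bar>c\<bar> * sobolev_norm \<Omega> (2 - 2 / p) p (\<lambda>x. u r x - u t x)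
          = sobolev_norm \<Omega> (2 - 2 / p) p (\<lambda>x. c * u r x - c * u t x)"
        unfolding eventually_at_filter
      proof (intro always_eventually allI impI)
        fix r assume "r \<in> {0..T}"
        then have "set_borel_measurable lborel \<Omega> (\<lambda>x. u r x - u t x)"
          using m t by (intro set_borel_measurable_diff)
        from sobolev_norm_cmult[OF \<Omega> p this, of "2 - 2 / p" c]
        show "\<bar>c\<bar> * sobolev_norm \<Omega> (2 - 2 / p) p (\<lambda>x. u r x - u t x)
          = sobolev_norm \<Omega> (2 - 2 / p) p (\<lambda>x. c * u r x - c * u t x)"
          by (simp add: right_diff_distrib)
      qed
    qed
  qed
  moreover have "(\<lambda>t x. c * u t x) \<in> bochner_Lp T p (sobolev \<Omega> 2 p) (sobolev_norm \<Omega> 2 p)"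
  proof -
    have b: "u \<in> bochner_Lp T p (sobolev \<Omega> 2 p) (sobolev_norm \<Omega> 2 p)"
      using u by (simp add: X_space_def)
    then obtain \<sigma> :: "nat \<Rightarrow> real \<Rightarrow> real^3 \<Rightarrow> real"
      where \<sigma>: "\<And>k. simple_function lborel (\<sigma> k)" "\<And>k t. \<sigma> k t \<in> sobolev \<Omega> 2 p"
      and lim: "AE t\<in>{0<..<T} in lborel. (\<lambda>k. sobolev_norm \<Omega> 2 p (\<lambda>x. \<sigma> k t x - u t x)) \<longlonglongrightarrow> 0"
      unfolding bochner_Lp_def by blast
    have "AE t\<in>{0<..<T} in lborel. (\<lambda>k. sobolev_norm \<Omega> 2 p (\<lambda>x. c * \<sigma> k t x - c * u t x)) \<longlonglongrightarrow> 0"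
      using lim
    proof eventually_elim
      case (elim t)
      show ?case
      proof
        assume t: "t \<in> {0<..<T}"
        have "sobolev_norm \<Omega> 2 p (\<lambda>x. c * \<sigma> k t x - c * u t x)
            = \<bar>c\<bar> * sobolev_norm \<Omega> 2 p (\<lambda>x. \<sigma> k t x - u t x)" for k
        proof -
          have "set_borel_measurable lborel \<Omega> (\<lambda>x. \<sigma> k t x - u t x)"
            using sobolev_measurable[OF \<sigma>(2)] m t by (intro set_borel_measurable_diff) auto
          from sobolev_norm_cmult[OF \<Omega> p this, of 2 c] show ?thesis by (simp add: right_diff_distrib)
        qed
        then show "(\<lambda>k. sobolev_norm \<Omega> 2 p (\<lambda>x. c * \<sigma> k t x - c * u t x)) \<longlonglongrightarrow> 0"
          using tendsto_mult_left[of _ 0 sequentially "\<bar>c\<bar>"] elim t by auto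
      qed
    qed
    moreover have "simple_function lborel (\<lambda>t x. c * \<sigma> k t x)" for k
      using simple_function_compose1[OF \<sigma>(1)[of k], of "\<lambda>w x. c * w x"] .
    moreover have "AE t\<in>{0<..<T} in lborel. (\<lambda>x. c * u t x) \<in> sobolev \<Omega> 2 p"
      using b unfolding bochner_Lp_def by (auto intro: sobolev_cmult[OF \<Omega>])
    moreover have "set_integrable lborel {0<..<T} (\<lambda>t. sobolev_norm \<Omega> 2 p (\<lambda>x. c * u t x) powr p)"
    proof -
      have "set_integrable lborel {0<..<T} (\<lambda>t. \<bar>c\<bar> powr p * sobolev_norm \<Omega> 2 p (u t) powr p)"
        using b by (simp add: bochner_Lp_def)
      then show ?thesis
        by (rule set_integrable_cong[THEN iffD1, rotated 3])
          (use sobolev_norm_cmult[OF \<Omega> p m, of _ 2 c] in \<open>auto simp: powr_mult sobolev_norm_def\<close>)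
    qed
    ultimately show ?thesis
      unfolding bochner_Lp_def using \<sigma>(2) sobolev_cmult[OF \<Omega>]
      by (intro CollectI conjI exI[of _ "\<lambda>k t x. c * \<sigma> k t x"]) auto
  qed
  moreover have "(\<lambda>t x. c * u t x) \<in> cyl_Lp T \<Omega> p"
    using u Lp_space_cmult[of "case_prod u" "cyl T \<Omega>" p c]
    by (simp add: X_space_def cyl_Lp_def case_prod_beta')
  moreover have "\<exists>g\<in>Lp_space (cyl T \<Omega>) p. has_weak_deriv (cyl T \<Omega>) [(1, 0)] (\<lambda>(t, x). c * u t x) g"
  proof -
    obtain g where g: "g \<in> Lp_space (cyl T \<Omega>) p" "has_weak_deriv (cyl T \<Omega>) [(1, 0)] (case_prod u) g"
      using u by (auto simp: X_space_def)
    have o: "open (cyl T \<Omega>)" using \<Omega> by (simp add: cyl_def open_Times)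
    have "has_weak_deriv (cyl T \<Omega>) [(1, 0)] (\<lambda>(t, x). c * u t x) (\<lambda>z. c * g z)"
      by (rule has_weak_deriv_scale[OF o _ g(2)])
        (use u set_borel_measurable_cmult[of lborel "cyl T \<Omega>" "case_prod u" c]
          in \<open>auto simp: X_space_def cyl_Lp_def Lp_space_def case_prod_beta' Basis_prod_def\<close>)
    then show ?thesis using Lp_space_cmult[OF g(1)] by blast
  qed
  ultimately show ?thesis by (simp add: X_space_def)
qed

lemma W_space_cmult:
  assumes \<Omega>: "open \<Omega>" and p: "p > 0" and u: "u \<in> W_space T \<Omega> p"
  shows "(\<lambda>t x. c * u t x) \<in> W_space T \<Omega> p"
proof -
  have X: "u \<in> X_space T \<Omega> p" and n: "neumann T \<Omega> p u" using u by (auto simp: W_space_def)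
  have "neumann T \<Omega> p (\<lambda>t x. c * u t x)"
    using n unfolding neumann_def
    by eventually_elim (use X_space_measurable[OF X] in \<open>auto intro!: normal_deriv_zero_cmult[OF \<Omega> p]\<close>)
  then show ?thesis using X_space_cmult[OF \<Omega> p X] by (simp add: W_space_def)
qed

lemma W0_space_cmult:
  assumes "open \<Omega>" "p > 0" "u \<in> W0_space T \<Omega> p"
  shows "(\<lambda>t x. c * u t x) \<in> W0_space T \<Omega> p"
  using assms W_space_cmult by (auto simp: W0_space_def)

section \<open>A Morrey inequality\<close>

lemma frechet_derivative_translate:
  fixes f :: "'a::euclidean_space \<Rightarrow> real"
  assumes "f differentiable at (x - a)"
  shows "((\<lambda>x. f (x - a)) has_derivative frechet_derivative f (at (x - a))) (at x)"
  by (rule has_derivative_compose[of "\<lambda>x. x - a" "\<lambda>h. h" x UNIV f, simplified])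
    (use assms in \<open>auto intro!: derivative_eq_intros simp: frechet_derivative_works[symmetric]\<close>)

lemma frechet_derivative_translate_eq:
  fixes f :: "'a::euclidean_space \<Rightarrow> real"
  assumes "f differentiable at (x - a)"
  shows "frechet_derivative (\<lambda>x. f (x - a)) (at x) = frechet_derivative f (at (x - a))"
  by (rule frechet_derivative_eqI[OF frechet_derivative_translate[OF assms]])

lemma smooth_translate:
  fixes f :: "'a::euclidean_space \<Rightarrow> real"
  assumes "smooth f"
  shows "smooth (\<lambda>x. f (x - a))"
proof (rule smooth_closed_family[of _ "{\<lambda>x. g (x - a) |g. smooth g}"])
  fix g :: "'a \<Rightarrow> real" and x :: 'a
  assume "g \<in> {\<lambda>x. g (x - a) |g. smooth g}"
  then obtain h where h: "smooth h" "g = (\<lambda>x. h (x - a))" by auto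
  show "g differentiable at x"
    using frechet_derivative_translate[OF smooth_differentiable[OF h(1)]] h(2)
    unfolding differentiable_def by blast
  show "(\<lambda>x. frechet_derivative g (at x) b) \<in> {\<lambda>x. g (x - a) |g. smooth g}" if "b \<in> Basis" for b
    using smooth_frechet[OF h(1) that] h
    by (auto simp: frechet_derivative_translate_eq smooth_differentiable
        intro!: exI[of _ "\<lambda>x. frechet_derivative h (at x) b"])
qed (use assms in auto)

lemma frechet_derivative_direction:
  fixes f :: "'a::euclidean_space \<Rightarrow> real"
  assumes "f differentiable at x"
  shows "frechet_derivative f (at x) y = (\<Sum>b\<in>Basis. (y \<bullet> b) * pd [b] f x)"
proof -
  have l: "linear (frechet_derivative f (at x))" using assms by (rule linear_frechet_derivative)
  have "frechet_derivative f (at x) y = frechet_derivative f (at x) (\<Sum>b\<in>Basis. (y \<bullet> b) *\<^sub>R b)"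
    by (simp add: euclidean_representation)
  also have "\<dots> = (\<Sum>b\<in>Basis. (y \<bullet> b) * frechet_derivative f (at x) b)"
    by (simp add: linear_sum[OF l] linear_scale[OF l])
  finally show ?thesis by simp
qed

text \<open>Without integrability the left side is 0 by convention. Estimates can thus be carried
  out in \<open>ennreal\<close>, where Fubini asks for measurability alone.\<close>

lemma abs_integral_le_nn_integral:
  fixes f :: "'a \<Rightarrow> real"
  shows "ennreal \<bar>integral\<^sup>L M f\<bar> \<le> (\<integral>\<^sup>+ x. ennreal \<bar>f x\<bar> \<partial>M)"
proof (cases "integrable M f")
  case True
  then show ?thesis using integral_norm_bound_ennreal[OF True] by simp
next
  case False
  then show ?thesis by (simp add: not_integrable_integral_eq)
qed

lemma nn_integral_lborel_affine:
  fixes f :: "'a::euclidean_space \<Rightarrow> ennreal"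
  assumes [measurable]: "f \<in> borel_measurable borel" and c: "c \<noteq> 0"
  shows "(\<integral>\<^sup>+ x. f x \<partial>lborel) = ennreal (\<bar>c\<bar> ^ DIM('a)) * (\<integral>\<^sup>+ x. f (t + c *\<^sub>R x) \<partial>lborel)"
  by (subst lborel_affine[OF c, of t])
    (simp add: nn_integral_density nn_integral_distr nn_integral_cmult)

text \<open>Stands in for Hoelder's inequality between L^1 and L^4 on sets of finite
  measure.\<close>

lemma abs_le_one_plus_power4: "\<bar>x\<bar> \<le> 1 + x ^ 4" for x :: real
proof (cases "\<bar>x\<bar> \<le> 1")
  case True
  moreover have "0 \<le> x ^ 4" by simp
  ultimately show ?thesis by linarith
next
  case False
  then have "\<bar>x\<bar> ^ 1 \<le> \<bar>x\<bar> ^ 4" by (intro power_increasing) auto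
  then show ?thesis by simp
qed

text \<open>The quartic reparametrisation of the segment from \<open>z\<close> to \<open>z + y\<close> removes the singularity of
  the Jacobian factor \<open>s\<^sup>-\<^sup>3\<close> in the averaging below.\<close>

lemma test_function_segment_formula:
  fixes \<psi> :: "'a::euclidean_space \<Rightarrow> real"
  assumes "smooth \<psi>"
  shows "(LINT \<sigma>|lborel. (4 * \<sigma> ^ 3 * frechet_derivative \<psi> (at (z - \<sigma> ^ 4 *\<^sub>R y)) y) * indicator {0..1} \<sigma>)
    = \<psi> z - \<psi> (z - y)"
proof -
  \<comment> \<open>The minus sign cancels the one produced by differentiating the base point, which
    moves along -y.\<close>
  define F where "F \<sigma> = - \<psi> (z - \<sigma> ^ 4 *\<^sub>R y)" for \<sigma> :: real
  have "(LINT \<sigma>|lborel. (4 * \<sigma> ^ 3 * frechet_derivative \<psi> (at (z - \<sigma> ^ 4 *\<^sub>R y)) y) * indicator {0..1} \<sigma>)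
    = F 1 - F 0"
  proof (rule integral_FTC_Icc_real)
    fix \<sigma> :: real
    have 1: "((\<lambda>\<sigma>. z - \<sigma> ^ 4 *\<^sub>R y) has_derivative (\<lambda>h. - (h * (4 * \<sigma> ^ 3)) *\<^sub>R y)) (at \<sigma>)"
      by (auto intro!: derivative_eq_intros simp: algebra_simps)
    have d: "(\<psi> has_derivative frechet_derivative \<psi> (at (z - \<sigma> ^ 4 *\<^sub>R y))) (at (z - \<sigma> ^ 4 *\<^sub>R y))"
      using smooth_differentiable[OF assms] frechet_derivative_works by blast
    have l: "linear (frechet_derivative \<psi> (at (z - \<sigma> ^ 4 *\<^sub>R y)))"
      using smooth_differentiable[OF assms] by (rule linear_frechet_derivative)
    have "(F has_derivative (\<lambda>h. - frechet_derivative \<psi> (at (z - \<sigma> ^ 4 *\<^sub>R y)) (- (h * (4 * \<sigma> ^ 3)) *\<^sub>R y))) (at \<sigma>)"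
      unfolding F_def by (intro has_derivative_minus has_derivative_compose[OF 1 d])
    then show "(F has_real_derivative 4 * \<sigma> ^ 3 * frechet_derivative \<psi> (at (z - \<sigma> ^ 4 *\<^sub>R y)) y) (at \<sigma>)"
      unfolding has_field_derivative_def
      by (rule has_derivative_eq_rhs) (simp add: fun_eq_iff linear_scale[OF l] linear_neg[OF l])
    have "continuous_on UNIV (\<lambda>\<sigma>. 4 * \<sigma> ^ 3 * frechet_derivative \<psi> (at (z - \<sigma> ^ 4 *\<^sub>R y)) y)"
      unfolding frechet_derivative_direction[OF smooth_differentiable[OF assms]]
      by (intro continuous_intros continuous_on_compose2[OF smooth_continuous[OF smooth_pd[OF assms], of _ UNIV]]) auto
    then show "isCont (\<lambda>\<sigma>. 4 * \<sigma> ^ 3 * frechet_derivative \<psi> (at (z - \<sigma> ^ 4 *\<^sub>R y)) y) \<sigma>"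
      by (simp add: continuous_on_eq_continuous_at)
  qed simp
  then show ?thesis by (simp add: F_def)
qed

text \<open>The fundamental theorem of calculus is applied to the test function instead of
  \<open>u\<close>: \<open>u\<close> is paired with the difference of \<open>\<psi>\<close> and its
  translate by \<open>y\<close>, written as an integral of directional derivatives of translates.
  Each of these is moved onto \<open>u\<close> by the definition of the weak derivative, and undoing
  the translation evaluates \<open>u\<close> and its derivatives along the segment from z to z +
  y.\<close>

lemma weak_deriv_segment_bound:
  fixes \<Omega> :: "'a::euclidean_space set"
  assumes \<Omega>: "open \<Omega>"
    and G: "\<And>b. b \<in> Basis \<Longrightarrow> has_weak_deriv \<Omega> [b] u (G b)" and u: "locally_integrable \<Omega> u"
    and \<psi>: "smooth \<psi>" "compact K" "supported_in \<psi> K"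
    and seg: "\<And>z s. z \<in> K \<Longrightarrow> s \<in> {0..1} \<Longrightarrow> z + s *\<^sub>R y \<in> \<Omega>"
    and R: "norm y \<le> R"
  defines "u' \<equiv> \<lambda>x. indicator \<Omega> x * u x" and "G' \<equiv> \<lambda>b x. indicator \<Omega> x * G b x"
  shows "ennreal \<bar>LBINT z:\<Omega>. u z * \<psi> z\<bar> \<le> (\<integral>\<^sup>+ z. ennreal \<bar>\<psi> z\<bar> * (ennreal \<bar>u' (z + y)\<bar>
    + (\<integral>\<^sup>+ \<sigma>. ennreal (indicator {0..1} \<sigma> * (4 * R * \<sigma> ^ 3 * (\<Sum>b\<in>Basis. \<bar>G' b (z + \<sigma> ^ 4 *\<^sub>R y)\<bar>))) \<partial>lborel)) \<partial>lborel)"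
proof -
  have R0: "0 \<le> R" using R norm_ge_zero order_trans by blast
  have [measurable]: "\<Omega> \<in> sets borel" using \<Omega> by simp
  have [measurable]: "u' \<in> borel_measurable borel"
    using locally_integrable_measurable[OF \<Omega> u] by (simp add: u'_def set_borel_measurable_def)
  have Gm[measurable]: "G' b \<in> borel_measurable borel" if "b \<in> Basis" for b
    using locally_integrable_measurable[OF \<Omega>, of "G b"] G[OF that]
    by (simp add: G'_def set_borel_measurable_def has_weak_deriv_def)
  have [measurable]: "\<psi> \<in> borel_measurable borel" using \<psi>(1) by (rule smooth_measurable)
  \<comment> \<open>The set swept out by \<open>K\<close> along \<open>y\<close>. It is compact and
    lies in \<open>\<Omega>\<close>, so every translate of \<open>\<psi>\<close> by a fraction of
    \<open>y\<close> is a test function on \<open>\<Omega>\<close>.\<close>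
  define P where "P = (\<lambda>(z, s). z + s *\<^sub>R y) ` (K \<times> {0..1::real})"
  have P: "compact P" unfolding P_def
    by (intro compact_continuous_image compact_Times \<psi> compact_Icc)
      (auto intro!: continuous_intros simp: case_prod_beta')
  have P\<Omega>: "P \<subseteq> \<Omega>" using seg by (auto simp: P_def)
  have supp: "supported_in (\<lambda>z. f (z - s *\<^sub>R y)) P" if "s \<in> {0..1}" "supported_in f K" for s and f :: "'a \<Rightarrow> real"
    unfolding supported_in_def
  proof (intro allI impI)
    fix z assume z: "z \<notin> P"
    have "z - s *\<^sub>R y \<notin> K"
    proof
      assume "z - s *\<^sub>R y \<in> K"
      then have "(\<lambda>(z, s). z + s *\<^sub>R y) (z - s *\<^sub>R y, s) \<in> P" unfolding P_def using that(1) by blast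
      with z show False by simp
    qed
    then show "f (z - s *\<^sub>R y) = 0" using that(2) by (simp add: supported_in_def)
  qed
  have test: "test_function \<Omega> (\<lambda>z. \<psi> (z - s *\<^sub>R y))" if "s \<in> {0..1}" for s
    using supp[OF that \<psi>(3)] P P\<Omega> smooth_translate[OF \<psi>(1)] by (intro test_functionI)
  define D where "D x = frechet_derivative \<psi> (at x) y" for x
  have D_eq: "D = (\<lambda>x. \<Sum>b\<in>Basis. (y \<bullet> b) * pd [b] \<psi> x)"
    unfolding D_def using frechet_derivative_direction[OF smooth_differentiable[OF \<psi>(1)]] by blast
  have D_supp: "supported_in D K"
    unfolding D_eq using supported_in_pd[OF \<psi>(2,3)] by (simp add: supported_in_def del: pd.simps)
  have D_cont: "continuous_on UNIV D"
    unfolding D_eq by (intro continuous_intros smooth_continuous smooth_pd \<psi>(1)) auto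
  then have [measurable]: "D \<in> borel_measurable borel" by (rule borel_measurable_continuous_onI)
  obtain B where B: "\<And>x. \<bar>D x\<bar> \<le> B"
  proof -
    have "compact (D ` K)" using \<psi>(2) D_cont continuous_on_subset compact_continuous_image by blast
    then obtain B where "\<And>x. x \<in> D ` K \<Longrightarrow> \<bar>x\<bar> \<le> B"
      using compact_imp_bounded[of "D ` K"] by (auto simp: bounded_iff)
    then have "\<bar>D x\<bar> \<le> max B 0" for x
      using D_supp by (cases "x \<in> K") (auto simp: supported_in_def le_max_iff_disj)
    then show ?thesis by (rule that)
  qed
  \<comment> \<open>Cut to \<open>P\<close>, the locally integrable \<open>u\<close> becomes
    integrable on the whole space, as Fubini requires, and no integral below changes, because the
    translates of \<open>\<psi>\<close> and of \<open>D\<close> vanish off \<open>P\<close>.\<close>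
  define uP where "uP z = indicator P z *\<^sub>R u z" for z
  have uP: "integrable lborel uP"
    using u P P\<Omega> by (simp add: uP_def[abs_def] locally_integrable_def set_integrable_def)
  then have [measurable]: "uP \<in> borel_measurable borel" by (simp add: borel_measurable_integrable)
  have uPD: "uP z * f (z - s *\<^sub>R y) = indicator \<Omega> z *\<^sub>R (u z * f (z - s *\<^sub>R y))"
    if "s \<in> {0..1}" "supported_in f K" for f s z
    using supp[OF that] P\<Omega> by (auto simp: uP_def indicator_def supported_in_def)
  define h where "h \<sigma> z = uP z * (indicator {0..1} \<sigma> * (4 * \<sigma> ^ 3 * D (z - \<sigma> ^ 4 *\<^sub>R y)))" for \<sigma> :: real and z
  have h_int: "integrable (lborel \<Otimes>\<^sub>M lborel) (\<lambda>(z, \<sigma>). h \<sigma> z)"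
  proof (rule Bochner_Integration.integrable_bound)
    have "integrable lborel (\<lambda>\<sigma>::real. indicator {0..1} \<sigma> *\<^sub>R (4 * B))"
      by (intro integrable_indicator) auto
    then have i: "integrable lborel (\<lambda>\<sigma>::real. indicator {0..1} \<sigma> * (4 * B))" by simp
    show "integrable (lborel \<Otimes>\<^sub>M lborel) (\<lambda>(z, \<sigma>::real). uP z * (indicator {0..1} \<sigma> * (4 * B)))"
    proof (rule lborel_pair.Fubini_integrable)
      show "integrable lborel (\<lambda>z. LINT \<sigma>|lborel. norm (case (z, \<sigma>) of (z, \<sigma>::real) \<Rightarrow> uP z * (indicator {0..1} \<sigma> * (4 * B))))"
        using uP by (auto simp: abs_mult)
      show "AE z in lborel. integrable lborel (\<lambda>\<sigma>. case (z, \<sigma>) of (z, \<sigma>::real) \<Rightarrow> uP z * (indicator {0..1} \<sigma> * (4 * B)))"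
        using i by (intro AE_I2) auto
    qed measurable
    show "AE x in lborel \<Otimes>\<^sub>M lborel. norm (case x of (z, \<sigma>) \<Rightarrow> h \<sigma> z)
        \<le> norm (case x of (z, \<sigma>) \<Rightarrow> uP z * (indicator {0..1} \<sigma> * (4 * B)))"
    proof (rule AE_I2, clarify)
      fix z :: 'a and \<sigma> :: real
      show "norm (h \<sigma> z) \<le> norm (uP z * (indicator {0..1} \<sigma> * (4 * B)))"
      proof (cases "\<sigma> \<in> {0..1}")
        case True
        then have "\<bar>\<sigma> ^ 3\<bar> * \<bar>D (z - \<sigma> ^ 4 *\<^sub>R y)\<bar> \<le> 1 * B"
          using B by (intro mult_mono) (auto simp: power_le_one)
        then have "\<bar>4 * \<sigma> ^ 3 * D (z - \<sigma> ^ 4 *\<^sub>R y)\<bar> \<le> \<bar>4 * B\<bar>" by (simp add: abs_mult)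
        then show ?thesis using True by (simp add: h_def abs_mult mult_left_mono)
      qed (simp add: h_def)
    qed
  qed (unfold h_def, measurable)
  have pow: "\<sigma> ^ 4 \<in> {0..1}" if "\<sigma> \<in> {0..1}" for \<sigma> :: real
    using that by (auto simp: power_le_one)
  \<comment> \<open>For fixed \<sigma> this is the definition of the weak derivative, tested with
    the translate by \<open>\<sigma> ^ 4 *\<^sub>R y\<close>; the minus sign is that of a derivative
    of order one.\<close>
  have inner: "(LINT z|lborel. h \<sigma> z)
      = - (indicator {0..1} \<sigma> * (4 * \<sigma> ^ 3 * (\<Sum>b\<in>Basis. (y \<bullet> b) * (LBINT z:\<Omega>. G b z * \<psi> (z - \<sigma> ^ 4 *\<^sub>R y)))))" for \<sigma>
  proof (cases "\<sigma> \<in> {0..1}")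
    case True
    note s = pow[OF True]
    have pdt: "pd [b] (\<lambda>z. \<psi> (z - \<sigma> ^ 4 *\<^sub>R y)) = (\<lambda>z. pd [b] \<psi> (z - \<sigma> ^ 4 *\<^sub>R y))" for b
      by (simp add: fun_eq_iff frechet_derivative_translate_eq smooth_differentiable[OF \<psi>(1)])
    have int: "set_integrable lborel \<Omega> (\<lambda>z. u z * pd [b] \<psi> (z - \<sigma> ^ 4 *\<^sub>R y))" if "b \<in> Basis" for b
      using test_function_pd_integrable[OF \<Omega> u test[OF s], of "[b]"] that unfolding pdt by simp
    have "(LINT z|lborel. h \<sigma> z) = 4 * \<sigma> ^ 3 * (LBINT z:\<Omega>. u z * D (z - \<sigma> ^ 4 *\<^sub>R y))"
    proof -
      have "h \<sigma> z = 4 * \<sigma> ^ 3 * (indicator \<Omega> z *\<^sub>R (u z * D (z - \<sigma> ^ 4 *\<^sub>R y)))" for z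
        unfolding uPD[OF s D_supp, symmetric] using True by (simp add: h_def mult_ac)
      then show ?thesis by (simp add: set_lebesgue_integral_def)
    qed
    also have "(LBINT z:\<Omega>. u z * D (z - \<sigma> ^ 4 *\<^sub>R y))
        = (LBINT z:\<Omega>. \<Sum>b\<in>Basis. (y \<bullet> b) * (u z * pd [b] \<psi> (z - \<sigma> ^ 4 *\<^sub>R y)))"
      by (simp add: D_eq sum_distrib_left mult.left_commute del: pd.simps)
    also have "\<dots> = (\<Sum>b\<in>Basis. (y \<bullet> b) * (LBINT z:\<Omega>. u z * pd [b] \<psi> (z - \<sigma> ^ 4 *\<^sub>R y)))"
      unfolding set_lebesgue_integral_def scaleR_sum_right
      by (subst Bochner_Integration.integral_sum)
        (use int in \<open>auto simp del: pd.simps simp: set_integrable_def mult.left_commute[of "indicator _ _" "_ \<bullet> _"]\<close>)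
    also have "\<dots> = (\<Sum>b\<in>Basis. (y \<bullet> b) * (- (LBINT z:\<Omega>. G b z * \<psi> (z - \<sigma> ^ 4 *\<^sub>R y))))"
    proof (intro sum.cong refl)
      fix b :: 'a assume "b \<in> Basis"
      then have "(LBINT z:\<Omega>. u z * pd [b] (\<lambda>z. \<psi> (z - \<sigma> ^ 4 *\<^sub>R y)) z)
          = (-1) ^ length [b] * (LBINT z:\<Omega>. G b z * \<psi> (z - \<sigma> ^ 4 *\<^sub>R y))"
        using G[of b] test[OF s] unfolding has_weak_deriv_def by blast
      then show "(y \<bullet> b) * (LBINT z:\<Omega>. u z * pd [b] \<psi> (z - \<sigma> ^ 4 *\<^sub>R y))
          = (y \<bullet> b) * (- (LBINT z:\<Omega>. G b z * \<psi> (z - \<sigma> ^ 4 *\<^sub>R y)))"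
        unfolding pdt by simp
    qed
    finally show ?thesis using True by (simp add: sum_negf)
  qed (simp add: h_def)
  have split: "(LBINT z:\<Omega>. u z * \<psi> z) = (LBINT z:\<Omega>. u z * \<psi> (z - y)) + (LINT \<sigma>|lborel. LINT z|lborel. h \<sigma> z)"
  proof -
    have i0: "set_integrable lborel \<Omega> (\<lambda>z. u z * \<psi> z)"
      using test_function_integrable[OF \<Omega> u test[of 0]] by simp
    have i1: "set_integrable lborel \<Omega> (\<lambda>z. u z * \<psi> (z - y))"
      using test_function_integrable[OF \<Omega> u test[of 1]] by simp
    have "(LBINT z:\<Omega>. u z * \<psi> z) - (LBINT z:\<Omega>. u z * \<psi> (z - y))
        = (LBINT z:\<Omega>. u z * \<psi> z - u z * \<psi> (z - y))"
      by (rule set_integral_diff(2)[OF i0 i1, symmetric])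
    also have "\<dots> = (LINT z|lborel. uP z * (\<psi> z - \<psi> (z - y)))"
      unfolding set_lebesgue_integral_def
    proof (intro Bochner_Integration.integral_cong refl)
      fix z show "indicator \<Omega> z *\<^sub>R (u z * \<psi> z - u z * \<psi> (z - y)) = uP z * (\<psi> z - \<psi> (z - y))"
        using uPD[of 0, OF _ \<psi>(3), of z] uPD[of 1, OF _ \<psi>(3), of z]
        by (auto simp: right_diff_distrib)
    qed
    also have "\<dots> = (LINT z|lborel. LINT \<sigma>|lborel. h \<sigma> z)"
      unfolding h_def test_function_segment_formula[OF \<psi>(1), symmetric]
      by (simp add: D_def mult.commute mult.left_commute)
    also have "\<dots> = (LINT \<sigma>|lborel. LINT z|lborel. h \<sigma> z)"
      using lborel_pair.Fubini_integral[OF h_int] by simp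
    finally show ?thesis by simp
  qed
  \<comment> \<open>Translation invariance of Lebesgue measure moves the shift from
    \<open>\<psi>\<close> to the other factor.\<close>
  have shift: "(\<integral>\<^sup>+ z. ennreal \<bar>f z\<bar> * ennreal \<bar>\<psi> (z - a)\<bar> \<partial>lborel) = (\<integral>\<^sup>+ z. ennreal \<bar>\<psi> z\<bar> * ennreal \<bar>f (z + a)\<bar> \<partial>lborel)"
    if [measurable]: "f \<in> borel_measurable borel" for a and f :: "'a \<Rightarrow> real"
    by (subst nn_integral_lborel_affine[where t=a and c=1]) (simp_all add: mult.commute add.commute)
  have T1: "ennreal \<bar>LBINT z:\<Omega>. u z * \<psi> (z - y)\<bar> \<le> (\<integral>\<^sup>+ z. ennreal \<bar>\<psi> z\<bar> * ennreal \<bar>u' (z + y)\<bar> \<partial>lborel)"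
    unfolding shift[OF \<open>u' \<in> _\<close>, symmetric] set_lebesgue_integral_def
    by (rule order_trans[OF abs_integral_le_nn_integral]) (simp add: u'_def abs_mult ennreal_mult' mult.assoc)
  have GT: "ennreal \<bar>LBINT z:\<Omega>. G b z * \<psi> (z - a)\<bar> \<le> (\<integral>\<^sup>+ z. ennreal \<bar>\<psi> z\<bar> * ennreal \<bar>G' b (z + a)\<bar> \<partial>lborel)"
    if "b \<in> Basis" for a b
    unfolding shift[OF Gm[OF that], symmetric] set_lebesgue_integral_def
    by (rule order_trans[OF abs_integral_le_nn_integral]) (simp add: G'_def abs_mult ennreal_mult' mult.assoc)
  have "ennreal \<bar>LINT \<sigma>|lborel. LINT z|lborel. h \<sigma> z\<bar> \<le> (\<integral>\<^sup>+ \<sigma>. ennreal \<bar>LINT z|lborel. h \<sigma> z\<bar> \<partial>lborel)"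
    by (rule abs_integral_le_nn_integral)
  also have "\<dots> \<le> (\<integral>\<^sup>+ \<sigma>. \<integral>\<^sup>+ z. ennreal \<bar>\<psi> z\<bar> *
      ennreal (indicator {0..1} \<sigma> * (4 * R * \<sigma> ^ 3 * (\<Sum>b\<in>Basis. \<bar>G' b (z + \<sigma> ^ 4 *\<^sub>R y)\<bar>))) \<partial>lborel \<partial>lborel)"
  proof (rule nn_integral_mono)
    fix \<sigma> :: real
    let ?I = "\<lambda>b. LBINT z:\<Omega>. G b z * \<psi> (z - \<sigma> ^ 4 *\<^sub>R y)"
    show "ennreal \<bar>LINT z|lborel. h \<sigma> z\<bar> \<le> (\<integral>\<^sup>+ z. ennreal \<bar>\<psi> z\<bar> *
      ennreal (indicator {0..1} \<sigma> * (4 * R * \<sigma> ^ 3 * (\<Sum>b\<in>Basis. \<bar>G' b (z + \<sigma> ^ 4 *\<^sub>R y)\<bar>))) \<partial>lborel)"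
    proof (cases "\<sigma> \<in> {0..1}")
      case True
      have "\<bar>\<Sum>b\<in>Basis. (y \<bullet> b) * ?I b\<bar> \<le> (\<Sum>b\<in>Basis. \<bar>(y \<bullet> b) * ?I b\<bar>)" by (rule sum_abs)
      also have "\<dots> \<le> (\<Sum>b\<in>Basis. R * \<bar>?I b\<bar>)"
        unfolding abs_mult
        by (intro sum_mono mult_right_mono) (use R Basis_le_norm[of _ y] order_trans in blast, simp)
      finally have "\<bar>LINT z|lborel. h \<sigma> z\<bar> \<le> 4 * \<sigma> ^ 3 * (\<Sum>b\<in>Basis. R * \<bar>?I b\<bar>)"
        unfolding inner using True by (simp add: abs_mult mult_left_mono)
      also have "\<dots> = 4 * R * \<sigma> ^ 3 * (\<Sum>b\<in>Basis. \<bar>?I b\<bar>)" by (simp add: sum_distrib_left mult_ac)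
      finally have "ennreal \<bar>LINT z|lborel. h \<sigma> z\<bar> \<le> ennreal (4 * R * \<sigma> ^ 3) * (\<Sum>b\<in>Basis. ennreal \<bar>?I b\<bar>)"
        using R0 True by (subst sum_ennreal) (auto simp flip: ennreal_mult intro!: ennreal_leI)
      also have "\<dots> \<le> ennreal (4 * R * \<sigma> ^ 3) *
          (\<Sum>b\<in>Basis. (\<integral>\<^sup>+ z. ennreal \<bar>\<psi> z\<bar> * ennreal \<bar>G' b (z + \<sigma> ^ 4 *\<^sub>R y)\<bar> \<partial>lborel))"
        by (intro mult_left_mono sum_mono GT) auto
      also have "\<dots> = (\<integral>\<^sup>+ z. ennreal (4 * R * \<sigma> ^ 3) *
          (\<Sum>b\<in>Basis. ennreal \<bar>\<psi> z\<bar> * ennreal \<bar>G' b (z + \<sigma> ^ 4 *\<^sub>R y)\<bar>) \<partial>lborel)"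
        by (subst nn_integral_cmult) (auto intro!: borel_measurable_sum simp: nn_integral_sum)
      also have "\<dots> = (\<integral>\<^sup>+ z. ennreal \<bar>\<psi> z\<bar> *
        ennreal (indicator {0..1} \<sigma> * (4 * R * \<sigma> ^ 3 * (\<Sum>b\<in>Basis. \<bar>G' b (z + \<sigma> ^ 4 *\<^sub>R y)\<bar>))) \<partial>lborel)"
        using R0 True
        by (intro nn_integral_cong)
          (simp add: ennreal_mult sum_nonneg mult_ac flip: sum_distrib_left sum_ennreal)
      finally show ?thesis .
    qed (simp add: inner)
  qed
  also have "\<dots> = (\<integral>\<^sup>+ z. \<integral>\<^sup>+ \<sigma>. ennreal \<bar>\<psi> z\<bar> *
      ennreal (indicator {0..1} \<sigma> * (4 * R * \<sigma> ^ 3 * (\<Sum>b\<in>Basis. \<bar>G' b (z + \<sigma> ^ 4 *\<^sub>R y)\<bar>))) \<partial>lborel \<partial>lborel)"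
    by (rule lborel_pair.Fubini') measurable
  also have "\<dots> = (\<integral>\<^sup>+ z. ennreal \<bar>\<psi> z\<bar> *
      (\<integral>\<^sup>+ \<sigma>. ennreal (indicator {0..1} \<sigma> * (4 * R * \<sigma> ^ 3 * (\<Sum>b\<in>Basis. \<bar>G' b (z + \<sigma> ^ 4 *\<^sub>R y)\<bar>))) \<partial>lborel) \<partial>lborel)"
    by (intro nn_integral_cong nn_integral_cmult) measurable
  finally have T2: "ennreal \<bar>LINT \<sigma>|lborel. LINT z|lborel. h \<sigma> z\<bar> \<le> \<dots>" .
  have "ennreal \<bar>LBINT z:\<Omega>. u z * \<psi> z\<bar>
      \<le> ennreal \<bar>LBINT z:\<Omega>. u z * \<psi> (z - y)\<bar> + ennreal \<bar>LINT \<sigma>|lborel. LINT z|lborel. h \<sigma> z\<bar>"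
    unfolding split by (simp flip: ennreal_plus add: ennreal_leI)
  also have "\<dots> \<le> (\<integral>\<^sup>+ z. ennreal \<bar>\<psi> z\<bar> * ennreal \<bar>u' (z + y)\<bar> \<partial>lborel) + (\<integral>\<^sup>+ z. ennreal \<bar>\<psi> z\<bar> *
      (\<integral>\<^sup>+ \<sigma>. ennreal (indicator {0..1} \<sigma> * (4 * R * \<sigma> ^ 3 * (\<Sum>b\<in>Basis. \<bar>G' b (z + \<sigma> ^ 4 *\<^sub>R y)\<bar>))) \<partial>lborel) \<partial>lborel)"
    by (intro add_mono T1 T2)
  also have "\<dots> = (\<integral>\<^sup>+ z. ennreal \<bar>\<psi> z\<bar> * (ennreal \<bar>u' (z + y)\<bar>
    + (\<integral>\<^sup>+ \<sigma>. ennreal (indicator {0..1} \<sigma> * (4 * R * \<sigma> ^ 3 * (\<Sum>b\<in>Basis. \<bar>G' b (z + \<sigma> ^ 4 *\<^sub>R y)\<bar>))) \<partial>lborel)) \<partial>lborel)"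
    unfolding distrib_left by (rule nn_integral_add[symmetric]) measurable
  finally show ?thesis .
qed

section \<open>Averaging over a ball of directions\<close>

lemma nn_integral_power4:
  assumes "open \<Omega>" "set_borel_measurable lborel \<Omega> f" "set_integrable lborel \<Omega> (\<lambda>x. f x ^ 4)"
  shows "(\<integral>\<^sup>+ x. ennreal ((indicator \<Omega> x * f x) ^ 4) \<partial>lborel) = ennreal (LBINT x:\<Omega>. f x ^ 4)"
proof -
  have "(\<integral>\<^sup>+ x. ennreal ((indicator \<Omega> x * f x) ^ 4) \<partial>lborel) = (\<integral>\<^sup>+ x. ennreal (indicator \<Omega> x *\<^sub>R f x ^ 4) \<partial>lborel)"
    by (intro nn_integral_cong) (simp add: indicator_def)
  also have "\<dots> = ennreal (LBINT x:\<Omega>. f x ^ 4)"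
    unfolding set_lebesgue_integral_def
    by (rule nn_integral_eq_integral) (use assms in \<open>auto simp: set_integrable_def\<close>)
  finally show ?thesis .
qed

text \<open>In dimension three the substitution x = z + \<sigma>^4 y has Jacobian \<sigma>^12, and
  |g| <= 1 + g^4 applied to \<sigma>^3 g gives \<sigma>^3 |g| <= 1 + \<sigma>^12 g^4. The two powers
  of \<sigma> cancel, so the bound is uniform in \<sigma> and independent of z.\<close>

lemma morrey_averaged_bound:
  fixes \<Omega> B :: "(real^3) set"
  assumes u'[measurable]: "u' \<in> borel_measurable borel"
    and G'[measurable]: "\<And>b. b \<in> Basis \<Longrightarrow> G' b \<in> borel_measurable borel"
    and Iu: "(\<integral>\<^sup>+ x. ennreal (u' x ^ 4) \<partial>lborel) = ennreal Iu" "0 \<le> Iu"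
    and IG: "\<And>b. b \<in> Basis \<Longrightarrow> (\<integral>\<^sup>+ x. ennreal (G' b x ^ 4) \<partial>lborel) = ennreal (IG b)"
      "\<And>b. b \<in> Basis \<Longrightarrow> 0 \<le> IG b"
    and B[measurable]: "B \<in> sets borel" and \<beta>: "emeasure lborel B = ennreal \<beta>" "0 \<le> \<beta>" and R: "0 \<le> R"
  shows "(\<integral>\<^sup>+ y. indicator B y * (ennreal \<bar>u' (z + y)\<bar>
      + (\<integral>\<^sup>+ \<sigma>. ennreal (indicator {0..1} \<sigma> * (4 * R * \<sigma> ^ 3 * (\<Sum>b\<in>Basis. \<bar>G' b (z + \<sigma> ^ 4 *\<^sub>R y)\<bar>))) \<partial>lborel)) \<partial>lborel)
    \<le> ennreal (\<beta> + Iu + 4 * R * (\<Sum>b\<in>(Basis :: (real^3) set). \<beta> + IG b))"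
proof -
  have indB: "(\<integral>\<^sup>+ y. indicator B y \<partial>lborel) = ennreal \<beta>" using \<beta> by simp
  have aff: "ennreal (c ^ 3) * (\<integral>\<^sup>+ y. f (z + c *\<^sub>R y) \<partial>lborel) = (\<integral>\<^sup>+ x. f x \<partial>lborel)"
    if "f \<in> borel_measurable borel" "c > 0" for c and f :: "real^3 \<Rightarrow> ennreal"
    using nn_integral_lborel_affine[OF that(1), of c z] that(2) by simp
  have 1: "(\<integral>\<^sup>+ y. indicator B y * ennreal \<bar>u' (z + y)\<bar> \<partial>lborel) \<le> ennreal (\<beta> + Iu)"
  proof -
    have "(\<integral>\<^sup>+ y. indicator B y * ennreal \<bar>u' (z + y)\<bar> \<partial>lborel)
        \<le> (\<integral>\<^sup>+ y. indicator B y + ennreal (u' (z + y) ^ 4) \<partial>lborel)"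
    proof (rule nn_integral_mono)
      fix y
      have "ennreal \<bar>u' (z + y)\<bar> \<le> 1 + ennreal (u' (z + y) ^ 4)"
        using ennreal_leI[OF abs_le_one_plus_power4[of "u' (z + y)"]] by simp
      then show "indicator B y * ennreal \<bar>u' (z + y)\<bar> \<le> indicator B y + ennreal (u' (z + y) ^ 4)"
        by (simp add: indicator_def)
    qed
    also have "\<dots> = ennreal \<beta> + (\<integral>\<^sup>+ y. ennreal (u' (z + y) ^ 4) \<partial>lborel)"
      by (subst nn_integral_add) (auto simp: indB)
    also have "(\<integral>\<^sup>+ y. ennreal (u' (z + y) ^ 4) \<partial>lborel) = ennreal Iu"
      using aff[of "\<lambda>x. ennreal (u' x ^ 4)" 1] Iu by simp
    finally show ?thesis using \<beta>(2) Iu(2) by simp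
  qed
  have slice: "(\<integral>\<^sup>+ y. indicator B y * ennreal (indicator {0..1} \<sigma> * (4 * R * \<sigma> ^ 3 * (\<Sum>b\<in>Basis. \<bar>G' b (z + \<sigma> ^ 4 *\<^sub>R y)\<bar>))) \<partial>lborel)
      \<le> indicator {0..1} \<sigma> * ennreal (4 * R * (\<Sum>b\<in>(Basis :: (real^3) set). \<beta> + IG b))" for \<sigma> :: real
  \<comment> \<open>At \<sigma> = 0 the substitution degenerates, but there the factor
    \<open>\<sigma> ^ 3\<close> makes the integrand vanish.\<close>
  proof (cases "\<sigma> \<in> {0..1} \<and> \<sigma> \<noteq> 0")
    case True
    then have \<sigma>: "0 < \<sigma>" "\<sigma> \<le> 1" by auto
    have "(\<integral>\<^sup>+ y. indicator B y * ennreal (indicator {0..1} \<sigma> * (4 * R * \<sigma> ^ 3 * (\<Sum>b\<in>Basis. \<bar>G' b (z + \<sigma> ^ 4 *\<^sub>R y)\<bar>))) \<partial>lborel)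
        \<le> (\<integral>\<^sup>+ y. ennreal (4 * R) * (\<Sum>b\<in>(Basis :: (real^3) set). indicator B y + ennreal (\<sigma> ^ 12) * ennreal (G' b (z + \<sigma> ^ 4 *\<^sub>R y) ^ 4)) \<partial>lborel)"
    proof (rule nn_integral_mono)
      fix y :: "real^3"
      show "indicator B y * ennreal (indicator {0..1} \<sigma> * (4 * R * \<sigma> ^ 3 * (\<Sum>b\<in>Basis. \<bar>G' b (z + \<sigma> ^ 4 *\<^sub>R y)\<bar>)))
        \<le> ennreal (4 * R) * (\<Sum>b\<in>(Basis :: (real^3) set). indicator B y + ennreal (\<sigma> ^ 12) * ennreal (G' b (z + \<sigma> ^ 4 *\<^sub>R y) ^ 4))"
      proof (cases "y \<in> B")
        case y: True
        have "\<sigma> ^ 3 * \<bar>g\<bar> \<le> 1 + \<sigma> ^ 12 * g ^ 4" for g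
          using abs_le_one_plus_power4[of "\<sigma> ^ 3 * g"] \<sigma> by (simp add: abs_mult power_mult_distrib flip: power_mult)
        then have "(\<Sum>b\<in>Basis. \<sigma> ^ 3 * \<bar>G' b (z + \<sigma> ^ 4 *\<^sub>R y)\<bar>) \<le> (\<Sum>b\<in>(Basis :: (real^3) set). 1 + \<sigma> ^ 12 * G' b (z + \<sigma> ^ 4 *\<^sub>R y) ^ 4)"
          by (intro sum_mono)
        then have "4 * R * (\<Sum>b\<in>Basis. \<sigma> ^ 3 * \<bar>G' b (z + \<sigma> ^ 4 *\<^sub>R y)\<bar>)
            \<le> 4 * R * (\<Sum>b\<in>(Basis :: (real^3) set). 1 + \<sigma> ^ 12 * G' b (z + \<sigma> ^ 4 *\<^sub>R y) ^ 4)"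
          using R by (intro mult_left_mono) auto
        then have "ennreal (4 * R * \<sigma> ^ 3 * (\<Sum>b\<in>Basis. \<bar>G' b (z + \<sigma> ^ 4 *\<^sub>R y)\<bar>))
            \<le> ennreal (4 * R * (\<Sum>b\<in>(Basis :: (real^3) set). 1 + \<sigma> ^ 12 * G' b (z + \<sigma> ^ 4 *\<^sub>R y) ^ 4))"
          by (intro ennreal_leI) (simp add: sum_distrib_left mult.assoc)
        also have "\<dots> = ennreal (4 * R) * (\<Sum>b\<in>(Basis :: (real^3) set). 1 + ennreal (\<sigma> ^ 12) * ennreal (G' b (z + \<sigma> ^ 4 *\<^sub>R y) ^ 4))"
        proof -
          have "1 + ennreal (\<sigma> ^ 12) * ennreal (g ^ 4) = ennreal (1 + \<sigma> ^ 12 * g ^ 4)" for g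
            using \<sigma> by (simp add: ennreal_mult)
          then have "(\<Sum>b\<in>(Basis :: (real^3) set). 1 + ennreal (\<sigma> ^ 12) * ennreal (G' b (z + \<sigma> ^ 4 *\<^sub>R y) ^ 4))
              = ennreal (\<Sum>b\<in>(Basis :: (real^3) set). 1 + \<sigma> ^ 12 * G' b (z + \<sigma> ^ 4 *\<^sub>R y) ^ 4)"
            using \<sigma> by (simp only: sum_ennreal) (subst sum_ennreal, auto)
          then show ?thesis using R \<sigma> by (simp add: ennreal_mult sum_nonneg)
        qed
        finally show ?thesis using y True by simp
      qed simp
    qed
    also have "\<dots> = ennreal (4 * R) * (\<Sum>b\<in>(Basis :: (real^3) set). ennreal \<beta> + ennreal (\<sigma> ^ 12) * (\<integral>\<^sup>+ y. ennreal (G' b (z + \<sigma> ^ 4 *\<^sub>R y) ^ 4) \<partial>lborel))"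
      by (subst nn_integral_cmult, measurable, subst nn_integral_sum, measurable)
        (auto simp: nn_integral_add nn_integral_cmult indB intro!: arg_cong2[where f="(*)"] sum.cong)
    also have "\<dots> = ennreal (4 * R) * (\<Sum>b\<in>(Basis :: (real^3) set). ennreal \<beta> + ennreal (IG b))"
    proof -
      have "ennreal (\<sigma> ^ 12) * (\<integral>\<^sup>+ y. ennreal (G' b (z + \<sigma> ^ 4 *\<^sub>R y) ^ 4) \<partial>lborel) = ennreal (IG b)"
        if "b \<in> Basis" for b
        using aff[of "\<lambda>x. ennreal (G' b x ^ 4)" "\<sigma> ^ 4"] \<sigma> IG that by (simp flip: power_mult)
      then show ?thesis by simp
    qed
    also have "\<dots> = ennreal (4 * R * (\<Sum>b\<in>(Basis :: (real^3) set). \<beta> + IG b))"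
    proof -
      have "(\<Sum>b\<in>(Basis :: (real^3) set). ennreal \<beta> + ennreal (IG b)) = (\<Sum>b\<in>(Basis :: (real^3) set). ennreal (\<beta> + IG b))"
        using \<beta>(2) IG(2) by (intro sum.cong) auto
      also have "\<dots> = ennreal (\<Sum>b\<in>(Basis :: (real^3) set). \<beta> + IG b)"
        using \<beta>(2) IG(2) by (intro sum_ennreal) auto
      finally show ?thesis using R \<beta>(2) IG(2) by (simp add: ennreal_mult sum_nonneg)
    qed
    finally show ?thesis using True by simp
  qed auto
  have eq: "(\<integral>\<^sup>+ y. indicator B y * (ennreal \<bar>u' (z + y)\<bar>
      + (\<integral>\<^sup>+ \<sigma>. ennreal (indicator {0..1} \<sigma> * (4 * R * \<sigma> ^ 3 * (\<Sum>b\<in>Basis. \<bar>G' b (z + \<sigma> ^ 4 *\<^sub>R y)\<bar>))) \<partial>lborel)) \<partial>lborel)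
    = (\<integral>\<^sup>+ y. indicator B y * ennreal \<bar>u' (z + y)\<bar> \<partial>lborel)
      + (\<integral>\<^sup>+ y. \<integral>\<^sup>+ \<sigma>. indicator B y * ennreal (indicator {0..1} \<sigma> * (4 * R * \<sigma> ^ 3 * (\<Sum>b\<in>Basis. \<bar>G' b (z + \<sigma> ^ 4 *\<^sub>R y)\<bar>))) \<partial>lborel \<partial>lborel)"
    unfolding distrib_left by (subst nn_integral_add) (auto simp: nn_integral_cmult)
  have "(\<integral>\<^sup>+ y. \<integral>\<^sup>+ \<sigma>. indicator B y * ennreal (indicator {0..1} \<sigma> * (4 * R * \<sigma> ^ 3 * (\<Sum>b\<in>Basis. \<bar>G' b (z + \<sigma> ^ 4 *\<^sub>R y)\<bar>))) \<partial>lborel \<partial>lborel)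
    = (\<integral>\<^sup>+ \<sigma>. \<integral>\<^sup>+ y. indicator B y * ennreal (indicator {0..1} \<sigma> * (4 * R * \<sigma> ^ 3 * (\<Sum>b\<in>Basis. \<bar>G' b (z + \<sigma> ^ 4 *\<^sub>R y)\<bar>))) \<partial>lborel \<partial>lborel)"
    by (rule lborel_pair.Fubini') measurable
  also have "\<dots> \<le> (\<integral>\<^sup>+ \<sigma>. indicator {0..1::real} \<sigma> * ennreal (4 * R * (\<Sum>b\<in>(Basis :: (real^3) set). \<beta> + IG b)) \<partial>lborel)"
    by (intro nn_integral_mono slice)
  also have "\<dots> = ennreal (4 * R * (\<Sum>b\<in>(Basis :: (real^3) set). \<beta> + IG b))"
    by (subst nn_integral_multc) auto
  finally have le: "(\<integral>\<^sup>+ y. \<integral>\<^sup>+ \<sigma>. indicator B y * ennreal (indicator {0..1} \<sigma> * (4 * R * \<sigma> ^ 3 * (\<Sum>b\<in>Basis. \<bar>G' b (z + \<sigma> ^ 4 *\<^sub>R y)\<bar>))) \<partial>lborel \<partial>lborel)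
    \<le> ennreal (4 * R * (\<Sum>b\<in>(Basis :: (real^3) set). \<beta> + IG b))" .
  \<comment> \<open>The coefficients are nonnegative, so the real bound splits into the two extended
    bounds already obtained.\<close>
  show ?thesis
  proof -
    have "ennreal (\<beta> + Iu + 4 * R * (\<Sum>b\<in>(Basis :: (real^3) set). \<beta> + IG b))
        = ennreal (\<beta> + Iu) + ennreal (4 * R * (\<Sum>b\<in>(Basis :: (real^3) set). \<beta> + IG b))"
      using \<beta>(2) Iu(2) IG(2) R by (intro ennreal_plus mult_nonneg_nonneg sum_nonneg) auto
    then show ?thesis using add_mono[OF 1 le] eq by simp
  qed
qed

text \<open>The segment bound holds for every direction y in \<open>B\<close>, and its left side
  does not depend on y. Integration over \<open>B\<close> therefore produces the factor
  \<open>\<beta>\<close> on the left, while on the right Fubini turns the y-integral into the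
  average bounded by \<open>morrey_averaged_bound\<close>.\<close>

lemma morrey_dual_bound:
  fixes \<Omega> U B :: "(real^3) set"
  assumes \<Omega>: "open \<Omega>" and U: "U \<subseteq> \<Omega>"
    and G: "\<And>b. b \<in> Basis \<Longrightarrow> has_weak_deriv \<Omega> [b] u (G b)"
    and u4: "set_integrable lborel \<Omega> (\<lambda>x. u x ^ 4)"
    and G4: "\<And>b. b \<in> Basis \<Longrightarrow> set_integrable lborel \<Omega> (\<lambda>x. G b x ^ 4)"
    and B[measurable]: "B \<in> sets borel" and \<beta>: "emeasure lborel B = ennreal \<beta>" "0 < \<beta>"
    and R: "\<And>y. y \<in> B \<Longrightarrow> norm y \<le> R" "0 \<le> R"
    and seg: "\<And>z y s. z \<in> U \<Longrightarrow> y \<in> B \<Longrightarrow> s \<in> {0..1} \<Longrightarrow> z + s *\<^sub>R y \<in> \<Omega>"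
    and \<psi>: "test_function U \<psi>"
  shows "\<bar>LBINT z:U. u z * \<psi> z\<bar> \<le> (\<beta> + (LBINT x:\<Omega>. u x ^ 4)
      + 4 * R * (\<Sum>b\<in>Basis. \<beta> + (LBINT x:\<Omega>. G b x ^ 4))) / \<beta> * (LBINT z:U. \<bar>\<psi> z\<bar>)"
proof -
  obtain K where K: "smooth \<psi>" "compact K" "K \<subseteq> U" "supported_in \<psi> K"
    by (rule test_functionE[OF \<psi>]) (rule that)
  \<comment> \<open>Local integrability of \<open>u\<close> is contained in each statement about its
    weak derivatives; \<open>axis 1 1\<close> provides a basis vector to extract it from.\<close>
  have u: "locally_integrable \<Omega> u" and Gl: "\<And>b. b \<in> Basis \<Longrightarrow> locally_integrable \<Omega> (G b)"
    using G[of "axis 1 1"] G by (auto simp: has_weak_deriv_def axis_in_Basis_iff)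
  have [measurable]: "\<psi> \<in> borel_measurable borel" using K(1) by (rule smooth_measurable)
  define u' where "u' x = indicator \<Omega> x * u x" for x
  define G' where "G' b x = indicator \<Omega> x * G b x" for b x
  have [measurable]: "u' \<in> borel_measurable borel"
    using locally_integrable_measurable[OF \<Omega> u] by (simp add: u'_def[abs_def] set_borel_measurable_def)
  have [measurable]: "G' b \<in> borel_measurable borel" if "b \<in> Basis" for b
    using locally_integrable_measurable[OF \<Omega> Gl[OF that]] by (simp add: G'_def[abs_def] set_borel_measurable_def)
  define H where "H z y = ennreal \<bar>u' (z + y)\<bar> + (\<integral>\<^sup>+ \<sigma>. ennreal (indicator {0..1} \<sigma> *
      (4 * R * \<sigma> ^ 3 * (\<Sum>b\<in>Basis. \<bar>G' b (z + \<sigma> ^ 4 *\<^sub>R y)\<bar>))) \<partial>lborel)" for z y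
  have [measurable]: "(\<lambda>(z, y). H z y) \<in> borel_measurable (borel \<Otimes>\<^sub>M borel)"
    unfolding H_def by measurable
  let ?Iu = "LBINT x:\<Omega>. u x ^ 4" and ?IG = "\<lambda>b. LBINT x:\<Omega>. G b x ^ 4"
  have nn: "0 \<le> ?Iu" "\<And>b. 0 \<le> ?IG b"
    unfolding set_lebesgue_integral_def by (auto intro!: Bochner_Integration.integral_nonneg)
  define M where "M = \<beta> + ?Iu + 4 * R * (\<Sum>b\<in>(Basis :: (real^3) set). \<beta> + ?IG b)"
  have M0: "0 \<le> M" unfolding M_def using nn R \<beta> by (intro add_nonneg_nonneg mult_nonneg_nonneg sum_nonneg) auto
  have avg: "(\<integral>\<^sup>+ y. indicator B y * H z y \<partial>lborel) \<le> ennreal M" for z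
    unfolding H_def M_def
    by (rule morrey_averaged_bound)
      (use nn R \<beta> nn_integral_power4[OF \<Omega> locally_integrable_measurable[OF \<Omega> u] u4]
        nn_integral_power4[OF \<Omega> locally_integrable_measurable[OF \<Omega> Gl] G4]
       in \<open>auto simp: u'_def[symmetric] G'_def[symmetric]\<close>)
  define E where "E = \<bar>LBINT z:\<Omega>. u z * \<psi> z\<bar>"
  have E: "ennreal E \<le> (\<integral>\<^sup>+ z. ennreal \<bar>\<psi> z\<bar> * H z y \<partial>lborel)" if "y \<in> B" for y
    unfolding E_def H_def u'_def G'_def
    by (rule weak_deriv_segment_bound[OF \<Omega> G u K(1,2,4)]) (use seg K(3) that R in auto)
  have \<psi>_int: "integrable lborel (\<lambda>z. \<bar>\<psi> z\<bar>)"
  proof -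
    \<comment> \<open>Integrability of a test function as the product of the locally integrable
      constant 1 with it.\<close>
    have "set_integrable lborel UNIV (\<lambda>z. 1 * \<psi> z)"
      by (rule locally_integrable_mult_test[OF _ _ K(1,2) _ K(4)])
        (auto simp: locally_integrable_def set_integrable_def emeasure_compact_finite[simplified] borel_compact
          intro!: integrable_real_indicator)
    then show ?thesis by (simp add: set_integrable_def)
  qed
  have "ennreal (\<beta> * E) = (\<integral>\<^sup>+ y. indicator B y * ennreal E \<partial>lborel)"
    using \<beta> by (subst nn_integral_multc) (auto simp: ennreal_mult E_def)
  also have "\<dots> \<le> (\<integral>\<^sup>+ y. \<integral>\<^sup>+ z. ennreal \<bar>\<psi> z\<bar> * (indicator B y * H z y) \<partial>lborel \<partial>lborel)"
    by (intro nn_integral_mono) (use E in \<open>auto simp: indicator_def\<close>)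
  also have "\<dots> = (\<integral>\<^sup>+ z. \<integral>\<^sup>+ y. ennreal \<bar>\<psi> z\<bar> * (indicator B y * H z y) \<partial>lborel \<partial>lborel)"
    by (rule lborel_pair.Fubini') measurable
  also have "\<dots> = (\<integral>\<^sup>+ z. ennreal \<bar>\<psi> z\<bar> * (\<integral>\<^sup>+ y. indicator B y * H z y \<partial>lborel) \<partial>lborel)"
    by (intro nn_integral_cong nn_integral_cmult) measurable
  also have "\<dots> \<le> (\<integral>\<^sup>+ z. ennreal \<bar>\<psi> z\<bar> * ennreal M \<partial>lborel)"
    by (intro nn_integral_mono mult_left_mono avg) auto
  also have "\<dots> = ennreal (M * (LINT z|lborel. \<bar>\<psi> z\<bar>))"
    using M0 \<psi>_int by (subst nn_integral_multc) (auto simp: nn_integral_eq_integral ennreal_mult mult.commute)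
  finally have "\<beta> * E \<le> M * (LINT z|lborel. \<bar>\<psi> z\<bar>)"
    using M0 by (subst (asm) ennreal_le_iff) auto
  moreover have "E = \<bar>LBINT z:U. u z * \<psi> z\<bar>"
    using set_integral_supported[OF K(4,3), of lborel u] set_integral_supported[OF K(4) order_trans[OF K(3) U], of lborel u]
    by (simp add: E_def)
  moreover have "(LINT z|lborel. \<bar>\<psi> z\<bar>) = (LBINT z:U. \<bar>\<psi> z\<bar>)"
    unfolding set_lebesgue_integral_def
    using K(3,4) by (intro Bochner_Integration.integral_cong) (auto simp: supported_in_def indicator_def)
  ultimately show ?thesis using \<beta>(2) by (simp add: M_def field_simps)
qed

section \<open>Interior cones at the boundary and the global inequality\<close>

lemma gradient_inner:
  fixes \<rho> :: "'a::euclidean_space \<Rightarrow> real"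
  assumes "\<rho> differentiable at x"
  shows "gradient \<rho> x \<bullet> y = frechet_derivative \<rho> (at x) y"
  using frechet_derivative_direction[OF assms, of y]
  by (simp add: gradient_def inner_sum_left inner_commute[of y] mult.commute)

text \<open>At a boundary point the defining function decreases in the direction of minus its
  gradient. By continuity it still does so at all nearby points and in all nearby directions, so a
  short segment in such a direction that starts where the function is negative stays there. At an
  interior point all short segments do, and the ball of directions is centred at 0.\<close>

lemma C2_boundary_interior_cone:
  fixes \<Omega> :: "'a::euclidean_space set"
  assumes \<Omega>: "open \<Omega>" "C2_boundary \<Omega>" and x: "x \<in> closure \<Omega>"
  shows "\<exists>r a \<rho>. r > 0 \<and> \<rho> > 0 \<and> (\<forall>z\<in>\<Omega> \<inter> ball x r. \<forall>y\<in>ball a \<rho>. \<forall>s\<in>{0..1}. z + s *\<^sub>R y \<in> \<Omega>)"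
proof (cases "x \<in> \<Omega>")
  case True
  then obtain e where e: "e > 0" "ball x e \<subseteq> \<Omega>" using \<Omega>(1) open_contains_ball by blast
  have "z + s *\<^sub>R y \<in> \<Omega>" if "z \<in> ball x (e / 2)" "y \<in> ball 0 (e / 2)" "s \<in> {0..1}" for z y and s :: real
  proof -
    have "norm (s *\<^sub>R y) \<le> norm y" using that(3) by (simp add: mult_left_le_one_le)
    moreover have "dist x (z + s *\<^sub>R y) \<le> dist x z + norm (s *\<^sub>R y)"
      using dist_triangle[of x "z + s *\<^sub>R y" z] by (simp add: dist_norm)
    ultimately have "dist x (z + s *\<^sub>R y) < e" using that by simp
    then show ?thesis using e(2) by auto
  qed
  then show ?thesis using e(1) by (intro exI[of _ "e / 2"] exI[of _ 0] exI[of _ "e / 2"]) auto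
next
  case False
  then have "x \<in> frontier \<Omega>" using x \<Omega>(1) by (simp add: frontier_def interior_open)
  then obtain N d where x: "x \<in> N" and d: "C2_defining_function \<Omega> N d"
    using \<Omega>(2) unfolding C2_boundary_def by blast
  have N: "open N" and C2: "Ck_on 2 N d" and g0: "gradient d x \<noteq> 0" and neg: "\<Omega> \<inter> N = {y \<in> N. d y < 0}"
    using d x unfolding C2_defining_function_def by auto
  have diff: "d differentiable at y" if "y \<in> N" for y
    using C2[unfolded Ck_on_def, THEN conjunct2, rule_format, of "[]" y] that by (simp add: multi_indices_def)
  have "continuous_on N (\<lambda>y. frechet_derivative d (at y) b)" if "b \<in> Basis" for b
    using C2[unfolded Ck_on_def, THEN conjunct1, rule_format, of "[b]"] that by (simp add: multi_indices_def)
  then have grad: "continuous_on N (gradient d)"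
    unfolding gradient_def by (intro continuous_intros)
  define g where "g = gradient d x"
  \<comment> \<open>Joint continuity in point and direction: the open set where this is negative
    contains a box A x B around (x, -g), which gives one set of directions for all points near
    x.\<close>
  let ?f = "\<lambda>z. gradient d (fst z) \<bullet> snd z"
  have cont: "continuous_on (N \<times> UNIV) ?f"
    by (intro continuous_intros continuous_on_compose2[OF grad]) auto
  have "open ((N \<times> UNIV) \<inter> ?f -` {..<0})"
    using continuous_open_preimage[OF cont _ open_lessThan[of 0]] N by (simp add: open_Times)
  moreover have "(x, - g) \<in> (N \<times> UNIV) \<inter> ?f -` {..<0}"
    using x g0 by (simp add: g_def)
  ultimately obtain A B where AB: "open A" "open B" "x \<in> A" "- g \<in> B" "A \<times> B \<subseteq> (N \<times> UNIV) \<inter> ?f -` {..<0}"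
    by (rule open_prod_elim) auto
  obtain \<delta>1 where \<delta>1: "\<delta>1 > 0" "ball x \<delta>1 \<subseteq> A" using AB open_contains_ball by blast
  obtain \<delta>2 where \<delta>2: "\<delta>2 > 0" "ball (- g) \<delta>2 \<subseteq> B" using AB open_contains_ball by blast
  \<comment> \<open>Shrinks the directions: \<open>\<tau>\<close> times a vector of length below
    norm g + \<delta>2 is shorter than \<delta>1/2, so segments starting in the ball of radius
    \<delta>1/2 about x remain in \<open>A\<close>.\<close>
  define \<tau> where "\<tau> = \<delta>1 / 2 / (norm g + \<delta>2)"
  have ng: "norm g + \<delta>2 > 0" using \<delta>2(1) norm_ge_zero[of g] by linarith
  have \<tau>: "\<tau> > 0" "\<tau> * (norm g + \<delta>2) = \<delta>1 / 2"
    using \<delta>1(1) ng nonzero_eq_divide_eq[of "norm g + \<delta>2" \<tau> "\<delta>1 / 2"] by (auto simp: \<tau>_def)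
  have "z + s *\<^sub>R y \<in> \<Omega>"
    if z: "z \<in> \<Omega>" "z \<in> ball x (\<delta>1 / 2)" and y: "y \<in> ball (- \<tau> *\<^sub>R g) (\<tau> * \<delta>2)" and s: "s \<in> {0..1}" for z y and s :: real
  proof -
    define y' where "y' = (1 / \<tau>) *\<^sub>R y"
    have y_eq: "y = \<tau> *\<^sub>R y'" using \<tau>(1) by (simp add: y'_def)
    have "dist (- \<tau> *\<^sub>R g) y = \<tau> * dist (- g) y'"
    proof -
      have "- \<tau> *\<^sub>R g - y = \<tau> *\<^sub>R (- g - y')" by (simp add: y_eq scaleR_diff_right)
      then show ?thesis using \<tau>(1) by (simp add: dist_norm)
    qed
    then have y'd: "dist (- g) y' < \<delta>2" using y \<tau>(1) by simp
    then have y': "y' \<in> B" using \<delta>2(2) by auto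
    have "norm y' \<le> norm g + dist (- g) y'"
      using norm_triangle_ineq4[of "y' + g" g] by (simp add: dist_norm norm_minus_commute[of "- g"])
    then have "norm y' < norm g + \<delta>2" using y'd by simp
    then have "norm y < \<delta>1 / 2" using \<tau> by (simp add: y_eq flip: \<tau>(2))
    then have near: "z + \<sigma> *\<^sub>R y \<in> A" if "0 \<le> \<sigma>" "\<sigma> \<le> s" for \<sigma>
    proof -
      have "norm (\<sigma> *\<^sub>R y) \<le> norm y" using that s by (simp add: mult_left_le_one_le)
      moreover have "dist x (z + \<sigma> *\<^sub>R y) \<le> dist x z + norm (\<sigma> *\<^sub>R y)"
        using dist_triangle[of x "z + \<sigma> *\<^sub>R y" z] by (simp add: dist_norm)
      ultimately have "dist x (z + \<sigma> *\<^sub>R y) < \<delta>1" using z(2) \<open>norm y < \<delta>1 / 2\<close> by simp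
      then show ?thesis using \<delta>1(2) by auto
    qed
    have AN: "A \<subseteq> N" using AB(4,5) by auto
    \<comment> \<open>Monotonicity along the segment: the derivative at each point is
      \<open>\<tau>\<close> times the inner product of the gradient with \<open>y'\<close>, negative
      by the choice of A and B.\<close>
    have "d (z + s *\<^sub>R y) \<le> d (z + 0 *\<^sub>R y)"
    proof (rule DERIV_nonpos_imp_nonincreasing[where f="\<lambda>\<sigma>. d (z + \<sigma> *\<^sub>R y)"])
      show "0 \<le> s" using s by simp
      fix \<sigma> assume \<sigma>: "0 \<le> \<sigma>" "\<sigma> \<le> s"
      let ?D = "frechet_derivative d (at (z + \<sigma> *\<^sub>R y))"
      have inN: "z + \<sigma> *\<^sub>R y \<in> N" using near[OF \<sigma>] AN by blast
      have 1: "((\<lambda>\<sigma>. z + \<sigma> *\<^sub>R y) has_derivative (\<lambda>h. h *\<^sub>R y)) (at \<sigma>)"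
        by (auto intro!: derivative_eq_intros)
      have 2: "(d has_derivative ?D) (at (z + \<sigma> *\<^sub>R y))"
        using diff[OF inN] by (simp add: frechet_derivative_works[symmetric])
      have l: "linear ?D" using diff[OF inN] by (rule linear_frechet_derivative)
      have "((\<lambda>\<sigma>. d (z + \<sigma> *\<^sub>R y)) has_derivative (\<lambda>h. ?D (h *\<^sub>R y))) (at \<sigma>)"
        by (rule has_derivative_compose[OF 1 2])
      then have "((\<lambda>\<sigma>. d (z + \<sigma> *\<^sub>R y)) has_real_derivative ?D y) (at \<sigma>)"
        unfolding has_field_derivative_def
        by (rule has_derivative_eq_rhs) (simp add: fun_eq_iff linear_scale[OF l])
      moreover have "?D y \<le> 0"
      proof -
        have "(z + \<sigma> *\<^sub>R y, y') \<in> A \<times> B" using near[OF \<sigma>] y' by simp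
        then have "gradient d (z + \<sigma> *\<^sub>R y) \<bullet> y' < 0" using AB(5) by auto
        then have "\<tau> * (gradient d (z + \<sigma> *\<^sub>R y) \<bullet> y') < 0" using \<tau>(1) by (rule mult_pos_neg[rotated])
        then have "gradient d (z + \<sigma> *\<^sub>R y) \<bullet> y < 0" by (subst (2) y_eq) simp
        then show ?thesis using gradient_inner[OF diff[OF inN], of y] by simp
      qed
      ultimately show "\<exists>D. ((\<lambda>\<sigma>. d (z + \<sigma> *\<^sub>R y)) has_real_derivative D) (at \<sigma>) \<and> D \<le> 0" by blast
    qed
    moreover have "d z < 0" using neg z(1) near[of 0] s AN by auto
    moreover have "z + s *\<^sub>R y \<in> N" using near[of s] s AN by auto
    ultimately have "z + s *\<^sub>R y \<in> {y \<in> N. d y < 0}" by simp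
    then show ?thesis unfolding neg[symmetric] by blast
  qed
  then show ?thesis using \<delta>1(1) \<delta>2(1) \<tau>(1)
    by (intro exI[of _ "\<delta>1 / 2"] exI[of _ "- \<tau> *\<^sub>R g"] exI[of _ "\<tau> * \<delta>2"]) auto
qed

text \<open>The constant is fixed before \<open>u\<close> and \<open>G\<close>, so that one constant
  serves all time slices. The set \<open>U\<close> localises the bound to a neighbourhood with a
  common cone, while the integrals extend over all of \<open>\<Omega>\<close>.\<close>

definition morrey_on :: "(real^3) set \<Rightarrow> (real^3) set \<Rightarrow> real \<Rightarrow> bool" where
  "morrey_on \<Omega> U C \<longleftrightarrow> C \<ge> 0 \<and>
    (\<forall>u G. (\<forall>b\<in>Basis. has_weak_deriv \<Omega> [b] u (G b)) \<longrightarrow>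
      set_integrable lborel \<Omega> (\<lambda>x. u x ^ 4) \<longrightarrow>
      (\<forall>b\<in>Basis. set_integrable lborel \<Omega> (\<lambda>x. G b x ^ 4)) \<longrightarrow>
      (AE x in lborel. x \<in> \<Omega> \<inter> U \<longrightarrow>
        \<bar>u x\<bar> \<le> C * (1 + (LBINT x:\<Omega>. u x ^ 4) + (\<Sum>b\<in>Basis. LBINT x:\<Omega>. G b x ^ 4))))"

lemma morrey_onI:
  assumes "C \<ge> 0"
    "\<And>u G. (\<And>b. b \<in> Basis \<Longrightarrow> has_weak_deriv \<Omega> [b] u (G b)) \<Longrightarrow>
      set_integrable lborel \<Omega> (\<lambda>x. u x ^ 4) \<Longrightarrow>
      (\<And>b. b \<in> Basis \<Longrightarrow> set_integrable lborel \<Omega> (\<lambda>x. G b x ^ 4)) \<Longrightarrow>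
      AE x in lborel. x \<in> \<Omega> \<inter> U \<longrightarrow>
        \<bar>u x\<bar> \<le> C * (1 + (LBINT x:\<Omega>. u x ^ 4) + (\<Sum>b\<in>Basis. LBINT x:\<Omega>. G b x ^ 4))"
  shows "morrey_on \<Omega> U C"
  unfolding morrey_on_def using assms by simp

lemma morrey_onD:
  assumes "morrey_on \<Omega> U C" "\<And>b. b \<in> Basis \<Longrightarrow> has_weak_deriv \<Omega> [b] u (G b)"
    "set_integrable lborel \<Omega> (\<lambda>x. u x ^ 4)"
    "\<And>b. b \<in> Basis \<Longrightarrow> set_integrable lborel \<Omega> (\<lambda>x. G b x ^ 4)"
  shows "AE x in lborel. x \<in> \<Omega> \<inter> U \<longrightarrow>
    \<bar>u x\<bar> \<le> C * (1 + (LBINT x:\<Omega>. u x ^ 4) + (\<Sum>b\<in>Basis. LBINT x:\<Omega>. G b x ^ 4))"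
  using assms unfolding morrey_on_def by blast

lemma morrey_local:
  fixes \<Omega> U B :: "(real^3) set"
  assumes \<Omega>: "open \<Omega>" and U: "open U" and "0 < \<rho>"
    and seg: "\<And>z y s. z \<in> \<Omega> \<inter> U \<Longrightarrow> y \<in> ball a \<rho> \<Longrightarrow> s \<in> {0..1} \<Longrightarrow> z + s *\<^sub>R y \<in> \<Omega>"
  shows "\<exists>C. morrey_on \<Omega> U C"
proof -
  define \<beta> where "\<beta> = measure lborel (ball a \<rho>)"
  have \<beta>: "emeasure lborel (ball a \<rho>) = ennreal \<beta>" "\<beta> > 0"
    using content_ball_pos[OF \<open>0 < \<rho>\<close>, of a] emeasure_lborel_ball_finite[of a \<rho>]
    by (auto simp: \<beta>_def emeasure_eq_ennreal_measure)
  define R where "R = norm a + \<rho>"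
  have R: "0 \<le> R" "norm y \<le> R" if "y \<in> ball a \<rho>" for y
    using norm_triangle_ineq2[of y a] that \<open>0 < \<rho>\<close>
    by (auto simp: R_def dist_norm norm_minus_commute[of a])
  have R0: "0 \<le> R" using \<open>0 < \<rho>\<close> by (simp add: R_def)
  \<comment> \<open>The sum of the coefficients of 1, of the integral of u^4 and of the derivative
    integrals in \<open>?M\<close>; 12 is 4 times the number of basis vectors.\<close>
  define C where "C = 1 + 1 / \<beta> + 12 * R + 4 * R / \<beta>"
  have "morrey_on \<Omega> U C"
  proof (rule morrey_onI)
    show "C \<ge> 0" using R0 \<beta>(2) by (simp add: C_def)
    fix u G
    assume G: "\<And>b. b \<in> Basis \<Longrightarrow> has_weak_deriv \<Omega> [b] u (G b)"
      and u4: "set_integrable lborel \<Omega> (\<lambda>x. u x ^ 4)"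
      and G4: "\<And>b. b \<in> Basis \<Longrightarrow> set_integrable lborel \<Omega> (\<lambda>x. G b x ^ 4)"
    let ?Iu = "LBINT x:\<Omega>. u x ^ 4" and ?S = "\<Sum>b\<in>(Basis :: (real^3) set). LBINT x:\<Omega>. G b x ^ 4"
    let ?M = "(\<beta> + ?Iu + 4 * R * (\<Sum>b\<in>(Basis :: (real^3) set). \<beta> + (LBINT x:\<Omega>. G b x ^ 4))) / \<beta>"
    have nn: "0 \<le> ?Iu" "0 \<le> ?S"
      unfolding set_lebesgue_integral_def
      by (auto intro!: Bochner_Integration.integral_nonneg sum_nonneg)
    have "locally_integrable \<Omega> u" using G[of "axis 1 1"] by (auto simp: has_weak_deriv_def axis_in_Basis_iff)
    then have u: "locally_integrable (\<Omega> \<inter> U) u" by (auto simp: locally_integrable_def)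
    have M_eq: "?M = 1 + ?Iu / \<beta> + 12 * R + 4 * R / \<beta> * ?S"
      using \<beta>(2) by (simp add: sum.distrib field_simps)
    then have M0: "0 \<le> ?M" using nn R0 \<beta>(2) by simp
    have M: "AE x in lborel. x \<in> \<Omega> \<inter> U \<longrightarrow> \<bar>u x\<bar> \<le> ?M"
    proof (rule AE_bounded_of_dual_bound[OF _ u M0])
      fix \<psi> assume \<psi>: "test_function (\<Omega> \<inter> U) \<psi>"
      show "\<bar>LBINT x:\<Omega> \<inter> U. u x * \<psi> x\<bar> \<le> ?M * (LBINT x:\<Omega> \<inter> U. \<bar>\<psi> x\<bar>)"
        by (rule morrey_dual_bound[OF \<Omega> _ G u4 G4 _ \<beta> _ R0 seg \<psi>]) (use R in auto)
    qed (use \<Omega> U in auto)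
    have le: "?M \<le> C * (1 + ?Iu + ?S)"
    proof -
      have "?M \<le> 1 + ?Iu / \<beta> + 12 * R + 4 * R / \<beta> * ?S
          + ((1 / \<beta> + 4 * R / \<beta>) + (1 + 12 * R + 4 * R / \<beta>) * ?Iu + (1 + 1 / \<beta> + 12 * R) * ?S)"
        unfolding M_eq using nn R0 \<beta>(2) by simp
      also have "\<dots> = C * (1 + ?Iu + ?S)" by (simp add: C_def algebra_simps)
      finally show ?thesis .
    qed
    from M show "AE x in lborel. x \<in> \<Omega> \<inter> U \<longrightarrow> \<bar>u x\<bar> \<le> C * (1 + ?Iu + ?S)"
      by eventually_elim (use le order_trans in blast)
  qed
  then show ?thesis ..
qed

text \<open>The closure is compact, so finitely many neighbourhoods with interior cones cover it.
  The sum of their nonnegative constants dominates each of them.\<close>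

lemma morrey:
  fixes \<Omega> :: "(real^3) set"
  assumes \<Omega>: "open \<Omega>" "bounded \<Omega>" "C2_boundary \<Omega>"
  shows "\<exists>C. morrey_on \<Omega> UNIV C"
proof -
  have "\<exists>r C. r > 0 \<and> morrey_on \<Omega> (ball x r) C" if x: "x \<in> closure \<Omega>" for x
    using C2_boundary_interior_cone[OF \<Omega>(1,3) x] morrey_local[OF \<Omega>(1) open_ball, of _ x] by metis
  then obtain r C where rC: "\<And>x. x \<in> closure \<Omega> \<Longrightarrow> r x > 0 \<and> morrey_on \<Omega> (ball x (r x)) (C x)"
    by metis
  then have C_nn: "C x \<ge> 0" if "x \<in> closure \<Omega>" for x using that by (auto simp: morrey_on_def)
  have "compact (closure \<Omega>)" using \<Omega>(2) by (simp add: compact_closure)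
  moreover have "closure \<Omega> \<subseteq> (\<Union>x\<in>closure \<Omega>. ball x (r x))" using rC by force
  ultimately obtain I where I: "I \<subseteq> closure \<Omega>" "finite I" "closure \<Omega> \<subseteq> (\<Union>x\<in>I. ball x (r x))"
    using compactE_image[of "closure \<Omega>" "closure \<Omega>" "\<lambda>x. ball x (r x)"] by auto
  have "morrey_on \<Omega> UNIV (sum C I)"
  proof (rule morrey_onI)
    show "sum C I \<ge> 0" using C_nn I(1) by (intro sum_nonneg) blast
    fix u G
    assume G: "\<And>b. b \<in> Basis \<Longrightarrow> has_weak_deriv \<Omega> [b] u (G b)"
      and u4: "set_integrable lborel \<Omega> (\<lambda>x. u x ^ 4)"
      and G4: "\<And>b. b \<in> Basis \<Longrightarrow> set_integrable lborel \<Omega> (\<lambda>x. G b x ^ 4)"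
    let ?E = "1 + (LBINT x:\<Omega>. u x ^ 4) + (\<Sum>b\<in>(Basis :: (real^3) set). LBINT x:\<Omega>. G b x ^ 4)"
    have E: "0 \<le> ?E"
      unfolding set_lebesgue_integral_def
      by (intro add_nonneg_nonneg Bochner_Integration.integral_nonneg sum_nonneg) auto
    have "AE x in lborel. x \<in> \<Omega> \<inter> ball c (r c) \<longrightarrow> \<bar>u x\<bar> \<le> C c * ?E" if "c \<in> I" for c
      using morrey_onD[OF _ G u4 G4] rC[of c] that I(1) by blast
    then have "AE x in lborel. \<forall>c\<in>I. x \<in> \<Omega> \<inter> ball c (r c) \<longrightarrow> \<bar>u x\<bar> \<le> C c * ?E"
      using I(2) by (simp add: AE_finite_all)
    then show "AE x in lborel. x \<in> \<Omega> \<inter> UNIV \<longrightarrow> \<bar>u x\<bar> \<le> sum C I * ?E"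
    proof eventually_elim
      case (elim x)
      show ?case
      proof
        assume "x \<in> \<Omega> \<inter> UNIV"
        then have x: "x \<in> \<Omega>" by simp
        then obtain c where c: "c \<in> I" "x \<in> ball c (r c)" using I(3) closure_subset by blast
        have "C c \<le> sum C I" using C_nn I(1) by (intro member_le_sum c I(2)) blast
        then have "C c * ?E \<le> sum C I * ?E" using E by (rule mult_right_mono)
        then show "\<bar>u x\<bar> \<le> sum C I * ?E" using elim c x by fastforce
      qed
    qed
  qed
  then show ?thesis ..
qed

section \<open>Bounds that are uniform in time\<close>

lemma weak_deriv_powr_le_sobolev_norm:
  fixes \<Omega> :: "'a::euclidean_space set"
  assumes p: "p > 0" and bs: "bs \<in> multi_indices (nat \<lfloor>s\<rfloor>)"
  shows "(LBINT x:\<Omega>. \<bar>weak_deriv \<Omega> bs u x\<bar> powr p) \<le> sobolev_norm \<Omega> s p u powr p"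
proof -
  let ?A = "\<lambda>bs. LBINT x:\<Omega>. \<bar>weak_deriv \<Omega> bs u x\<bar> powr p"
  let ?B = "\<lambda>bs. LBINT z:\<Omega> \<times> \<Omega>. gagliardo (frac s) p (weak_deriv \<Omega> bs u) z"
  let ?S = "(\<Sum>bs\<in>multi_indices (nat \<lfloor>s\<rfloor>). ?A bs)"
  let ?T = "if frac s > 0 then \<Sum>bs | bs \<in> multi_indices (nat \<lfloor>s\<rfloor>) \<and> length bs = nat \<lfloor>s\<rfloor>. ?B bs else 0"
  have A: "0 \<le> ?A bs" for bs
    unfolding set_lebesgue_integral_def by (intro Bochner_Integration.integral_nonneg) simp
  have "0 \<le> ?B bs" for bs
    unfolding set_lebesgue_integral_def
    by (intro Bochner_Integration.integral_nonneg) (auto simp: gagliardo_def indicator_def split: prod.splits)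
  then have T: "0 \<le> ?T" by (auto intro: sum_nonneg)
  have "?A bs \<le> ?S" using A by (intro member_le_sum bs finite_multi_indices) auto
  also have "\<dots> \<le> ?S + ?T" using T by simp
  also have "\<dots> = sobolev_norm \<Omega> s p u powr p"
    using p T A by (simp add: sobolev_norm_def powr_powr sum_nonneg)
  finally show ?thesis .
qed

lemma has_weak_deriv_Nil: "locally_integrable S f \<Longrightarrow> has_weak_deriv S [] f f"
  by (simp add: has_weak_deriv_def)

lemma add_power4_le: "(a + b) ^ 4 \<le> 8 * (a ^ 4 + b ^ 4)" for a b :: real
proof -
  have "(a + b)\<^sup>2 \<le> 2 * (a\<^sup>2 + b\<^sup>2)" using sum_squares_ge_zero[of "a - b" 0] by (simp add: power2_eq_square algebra_simps)
  then have "((a + b)\<^sup>2)\<^sup>2 \<le> (2 * (a\<^sup>2 + b\<^sup>2))\<^sup>2" by (intro power_mono) auto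
  also have "\<dots> = 4 * (a\<^sup>2 + b\<^sup>2)\<^sup>2" by (simp add: power2_eq_square algebra_simps)
  also have "\<dots> \<le> 4 * (2 * ((a\<^sup>2)\<^sup>2 + (b\<^sup>2)\<^sup>2))"
    using sum_squares_ge_zero[of "a\<^sup>2 - b\<^sup>2" 0] by (simp add: power2_eq_square algebra_simps)
  finally show ?thesis by (simp flip: power_mult)
qed

lemma sobolev_weak_deriv_power4:
  fixes \<Omega> :: "'a::euclidean_space set"
  assumes \<Omega>: "open \<Omega>" and u: "u \<in> sobolev \<Omega> s 4" and bs: "bs \<in> multi_indices (nat \<lfloor>s\<rfloor>)"
  shows "has_weak_deriv \<Omega> bs u (weak_deriv \<Omega> bs u)"
    and "set_integrable lborel \<Omega> (\<lambda>x. weak_deriv \<Omega> bs u x ^ 4)"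
proof -
  obtain g where g: "g \<in> Lp_space \<Omega> 4" "has_weak_deriv \<Omega> bs u g"
    using sobolev_has_weak_deriv[OF u bs] by blast
  show "has_weak_deriv \<Omega> bs u (weak_deriv \<Omega> bs u)" using g(2) by (rule has_weak_deriv_weak_deriv)
  have i: "set_integrable lborel \<Omega> (\<lambda>x. \<bar>g x\<bar> powr 4)" using g(1) by (simp add: Lp_space_def)
  have m: "set_borel_measurable lborel \<Omega> (\<lambda>x. weak_deriv \<Omega> bs u x ^ 4)"
    by (rule set_borel_measurable_comp[OF weak_deriv_measurable[OF \<Omega>]]) (use \<Omega> in auto)
  show "set_integrable lborel \<Omega> (\<lambda>x. weak_deriv \<Omega> bs u x ^ 4)"
    by (rule set_integrable_cong_AE'[OF m i])
      (use weak_deriv_AE_eq[OF \<Omega> g(2)] in \<open>auto elim!: eventually_mono\<close>)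
qed

text \<open>A continuous curve on a compact interval is bounded. No triangle inequality for
  \<open>sobolev_norm\<close> enters: at norm distance below 1 the integrals at two times are
  compared directly through (a + b)^4 <= 8 (a^4 + b^4), and a finite subcover of [0, T]
  finishes.\<close>

lemma X_space_power4_bounded:
  fixes \<Omega> :: "(real^3) set"
  assumes \<Omega>: "open \<Omega>" and v: "v \<in> X_space T \<Omega> 4" and bs: "bs \<in> multi_indices 1"
  obtains M where "\<And>t. t \<in> {0..T} \<Longrightarrow> (LBINT x:\<Omega>. weak_deriv \<Omega> bs (v t) x ^ 4) \<le> M"
proof -
  let ?N = "sobolev_norm \<Omega> (3/2) 4"
  \<comment> \<open>For p = 4 the order 2 - 2/p of the initial-value space is 3/2, so its norm
    contains the derivatives of orders 0 and 1.\<close>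
  have fl: "nat \<lfloor>3 / 2 :: real\<rfloor> = 1" by (simp add: floor_divide_of_int_eq[of 3 2, simplified])
  have vs: "v t \<in> sobolev \<Omega> (3/2) 4" if "t \<in> {0..T}" for t
    using v that by (auto simp: X_space_def continuous_into_def sobolev_hat_def sobolev_n_def)
  have lim: "((\<lambda>r. ?N (\<lambda>x. v r x - v t x)) \<longlongrightarrow> 0) (at t within {0..T})" if "t \<in> {0..T}" for t
    using v that by (auto simp: X_space_def continuous_into_def)
  have bs': "bs \<in> multi_indices (nat \<lfloor>3 / 2 :: real\<rfloor>)" using bs fl by simp
  note wd = sobolev_weak_deriv_power4[OF \<Omega> vs bs']
  let ?I = "\<lambda>t. LBINT x:\<Omega>. weak_deriv \<Omega> bs (v t) x ^ 4"
  have step: "?I r \<le> 8 * (1 + ?I t)" if t: "t \<in> {0..T}" and r: "r \<in> {0..T}" and n: "?N (\<lambda>x. v r x - v t x) < 1" for t r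
  proof -
    let ?D = "weak_deriv \<Omega> bs (\<lambda>x. v r x - v t x)"
    have D: "AE x in lborel. x \<in> \<Omega> \<longrightarrow> ?D x = weak_deriv \<Omega> bs (v r) x - weak_deriv \<Omega> bs (v t) x"
      by (rule weak_deriv_diff[OF \<Omega> multi_indices_Basis[OF bs] wd(1)[OF r] wd(1)[OF t]])
    have m: "set_borel_measurable lborel \<Omega> (\<lambda>x. weak_deriv \<Omega> bs f x ^ 4)" for f
      by (rule set_borel_measurable_comp[OF weak_deriv_measurable[OF \<Omega>]]) (use \<Omega> in auto)
    have i: "set_integrable lborel \<Omega> (\<lambda>x. 8 * (weak_deriv \<Omega> bs (v r) x ^ 4 + weak_deriv \<Omega> bs (v t) x ^ 4))"
      using wd(2)[OF r] wd(2)[OF t] by (intro set_integrable_mult_right set_integral_add)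
    have Di: "set_integrable lborel \<Omega> (\<lambda>x. ?D x ^ 4)"
    proof (rule set_integrable_bound'[OF i m])
      show "AE x in lborel. x \<in> \<Omega> \<longrightarrow> \<bar>?D x ^ 4\<bar> \<le> 8 * (weak_deriv \<Omega> bs (v r) x ^ 4 + weak_deriv \<Omega> bs (v t) x ^ 4)"
        using D
      proof eventually_elim
        case (elim x)
        show ?case
          using elim add_power4_le[of "weak_deriv \<Omega> bs (v r) x" "- weak_deriv \<Omega> bs (v t) x"] by simp
      qed
    qed
    have "(LBINT x:\<Omega>. \<bar>?D x\<bar> powr 4) \<le> ?N (\<lambda>x. v r x - v t x) powr 4"
      by (rule weak_deriv_powr_le_sobolev_norm) (use bs' in auto)
    also have "\<dots> \<le> 1" using n by (intro powr_le1) (auto simp: sobolev_norm_def)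
    finally have D1: "(LBINT x:\<Omega>. ?D x ^ 4) \<le> 1" by simp
    have "?I r \<le> (LBINT x:\<Omega>. 8 * (?D x ^ 4 + weak_deriv \<Omega> bs (v t) x ^ 4))"
    proof -
      have i2: "set_integrable lborel \<Omega> (\<lambda>x. 8 * (?D x ^ 4 + weak_deriv \<Omega> bs (v t) x ^ 4))"
        using Di wd(2)[OF t] by (intro set_integrable_mult_right set_integral_add)
      show ?thesis
        unfolding set_lebesgue_integral_def
      proof (rule integral_mono_AE)
        show "AE x in lborel. indicator \<Omega> x *\<^sub>R weak_deriv \<Omega> bs (v r) x ^ 4
            \<le> indicator \<Omega> x *\<^sub>R (8 * (?D x ^ 4 + weak_deriv \<Omega> bs (v t) x ^ 4))"
          using D
        proof eventually_elim
          case (elim x)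
          show ?case
            using elim add_power4_le[of "?D x" "weak_deriv \<Omega> bs (v t) x"] by (auto simp: indicator_def)
        qed
      qed (use wd(2)[OF r] i2 in \<open>auto simp: set_integrable_def\<close>)
    qed
    also have "\<dots> = 8 * ((LBINT x:\<Omega>. ?D x ^ 4) + ?I t)"
      using Di wd(2)[OF t] by (simp add: set_integral_add(2))
    finally show ?thesis using D1 by simp
  qed
  have "\<exists>\<delta>>0. \<forall>r\<in>{0..T} \<inter> ball t \<delta>. ?I r \<le> 8 * (1 + ?I t)" if t: "t \<in> {0..T}" for t
  proof -
    have "\<forall>\<^sub>F r in at t within {0..T}. ?N (\<lambda>x. v r x - v t x) < 1"
      using order_tendstoD(2)[OF lim[OF t], of 1] by simp
    then obtain \<delta> where \<delta>: "\<delta> > 0" "\<And>r. r \<in> {0..T} \<Longrightarrow> r \<noteq> t \<Longrightarrow> dist r t < \<delta> \<Longrightarrow> ?N (\<lambda>x. v r x - v t x) < 1"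
      unfolding eventually_at by blast
    have "?I r \<le> 8 * (1 + ?I t)" if r: "r \<in> {0..T} \<inter> ball t \<delta>" for r
    proof (cases "r = t")
      case True
      have "0 \<le> ?I t" unfolding set_lebesgue_integral_def by (intro Bochner_Integration.integral_nonneg) simp
      then show ?thesis using True by simp
    next
      case False
      then show ?thesis using step[OF t, of r] \<delta>(2)[of r] r by (simp add: dist_commute)
    qed
    then show ?thesis using \<delta>(1) by blast
  qed
  then obtain \<delta> where \<delta>: "\<And>t. t \<in> {0..T} \<Longrightarrow> \<delta> t > 0 \<and> (\<forall>r\<in>{0..T} \<inter> ball t (\<delta> t). ?I r \<le> 8 * (1 + ?I t))"
    by metis
  then have "{0..T} \<subseteq> (\<Union>t\<in>{0..T}. ball t (\<delta> t))" by force
  then obtain J where J: "J \<subseteq> {0..T}" "finite J" "{0..T} \<subseteq> (\<Union>t\<in>J. ball t (\<delta> t))"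
    using compactE_image[of "{0..T}" "{0..T}" "\<lambda>t. ball t (\<delta> t)"] by auto
  show ?thesis
  proof (rule that)
    fix t assume t: "t \<in> {0..T}"
    then obtain c where c: "c \<in> J" "t \<in> ball c (\<delta> c)" using J(3) by blast
    then have "?I t \<le> 8 * (1 + ?I c)" using \<delta>[of c] J(1) t by blast
    also have "\<dots> \<le> (\<Sum>c\<in>J. 8 * (1 + ?I c))"
    proof (rule member_le_sum[OF c(1) _ J(2)])
      fix x assume "x \<in> J - {c}"
      have "0 \<le> ?I x" unfolding set_lebesgue_integral_def by (intro Bochner_Integration.integral_nonneg) simp
      then show "0 \<le> 8 * (1 + ?I x)" by simp
    qed
    finally show "?I t \<le> (\<Sum>c\<in>J. 8 * (1 + ?I c))" .
  qed
qed

text \<open>Morrey's inequality applies to each slice, with one constant and with integrals bounded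
  uniformly in time. Fubini converts the bounds on the slices into one that holds a.e. on the
  cylinder.\<close>

lemma X_space_essentially_bounded:
  fixes \<Omega> :: "(real^3) set"
  assumes \<Omega>: "open \<Omega>" "bounded \<Omega>" "C2_boundary \<Omega>" and v: "v \<in> X_space T \<Omega> 4"
  obtains M where "M \<ge> 0" "AE z in lborel. z \<in> cyl T \<Omega> \<longrightarrow> \<bar>case_prod v z\<bar> \<le> M"
proof -
  obtain C where mor: "morrey_on \<Omega> UNIV C" using morrey[OF \<Omega>] by blast
  then have C: "C \<ge> 0" by (simp add: morrey_on_def)
  have fl: "nat \<lfloor>3 / 2 :: real\<rfloor> = 1" by (simp add: floor_divide_of_int_eq[of 3 2, simplified])
  have "\<exists>M. \<forall>t\<in>{0..T}. (LBINT x:\<Omega>. weak_deriv \<Omega> bs (v t) x ^ 4) \<le> M" if "bs \<in> multi_indices 1" for bs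
    by (rule X_space_power4_bounded[OF \<Omega>(1) v that]) blast
  then obtain M where M: "\<And>bs t. bs \<in> multi_indices 1 \<Longrightarrow> t \<in> {0..T} \<Longrightarrow> (LBINT x:\<Omega>. weak_deriv \<Omega> bs (v t) x ^ 4) \<le> M bs"
    by metis
  define A where "A = C * (1 + M [] + (\<Sum>b\<in>(Basis :: (real^3) set). M [b]))"
  have nil: "[] \<in> multi_indices 1" and single: "b \<in> Basis \<Longrightarrow> [b] \<in> multi_indices 1" for b :: "real^3"
    by (auto simp: multi_indices_def)
  have slice: "AE x in lborel. x \<in> \<Omega> \<longrightarrow> \<bar>v t x\<bar> \<le> A" if t: "t \<in> {0..T}" for t
  proof -
    have vs: "v t \<in> sobolev \<Omega> (3/2) 4"
      using v t by (auto simp: X_space_def continuous_into_def sobolev_hat_def sobolev_n_def)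
    note wd = sobolev_weak_deriv_power4[OF \<Omega>(1) vs, unfolded fl]
    \<comment> \<open>Even for the empty multi-index \<open>weak_deriv\<close> picks some
      representative, which agrees with \<open>v t\<close> only up to a null set.\<close>
    have v0: "AE x in lborel. x \<in> \<Omega> \<longrightarrow> weak_deriv \<Omega> [] (v t) x = v t x"
      using wd(1)[OF nil] by (intro weak_deriv_AE_eq[OF \<Omega>(1)] has_weak_deriv_Nil) (simp add: has_weak_deriv_def)
    have m: "set_borel_measurable lborel \<Omega> (\<lambda>x. v t x ^ 4)"
      by (rule set_borel_measurable_comp[OF sobolev_measurable[OF vs]]) (use \<Omega> in auto)
    have m0: "set_borel_measurable lborel \<Omega> (\<lambda>x. weak_deriv \<Omega> [] (v t) x ^ 4)"
      using wd(2)[OF nil] by (rule set_integrable_imp_set_borel_measurable)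
    have i: "set_integrable lborel \<Omega> (\<lambda>x. v t x ^ 4)"
      by (rule set_integrable_cong_AE'[OF m wd(2)[OF nil]]) (use v0 in \<open>auto elim!: eventually_mono\<close>)
    have I: "(LBINT x:\<Omega>. v t x ^ 4) \<le> M []"
    proof -
      have "(LBINT x:\<Omega>. v t x ^ 4) = (LBINT x:\<Omega>. weak_deriv \<Omega> [] (v t) x ^ 4)"
        by (rule set_integral_cong_AE'[OF m m0]) (use v0 in \<open>auto elim!: eventually_mono\<close>)
      then show ?thesis using M[OF nil t] by simp
    qed
    have 1: "AE x in lborel. x \<in> \<Omega> \<inter> UNIV \<longrightarrow> \<bar>v t x\<bar>
        \<le> C * (1 + (LBINT x:\<Omega>. v t x ^ 4) + (\<Sum>b\<in>Basis. LBINT x:\<Omega>. weak_deriv \<Omega> [b] (v t) x ^ 4))"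
      by (rule morrey_onD[OF mor]) (use wd single i in auto)
    have 2: "C * (1 + (LBINT x:\<Omega>. v t x ^ 4) + (\<Sum>b\<in>Basis. LBINT x:\<Omega>. weak_deriv \<Omega> [b] (v t) x ^ 4)) \<le> A"
      unfolding A_def using C I M[OF single t] by (intro mult_left_mono add_mono sum_mono) auto
    from 1 show ?thesis by eventually_elim (use 2 order_trans in blast)
  qed
  have [measurable]: "cyl T \<Omega> \<in> sets borel" using \<Omega>(1) by (simp add: cyl_def open_Times)
  \<comment> \<open>Extended by 0 the function is jointly measurable, as the passage from slices to
    the product requires.\<close>
  define w where "w z = indicator (cyl T \<Omega>) z *\<^sub>R case_prod v z" for z
  have "w \<in> borel_measurable borel"
    using v by (simp add: w_def[abs_def] X_space_def cyl_Lp_def Lp_space_def set_borel_measurable_def)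
  then have [measurable]: "w \<in> borel_measurable (borel \<Otimes>\<^sub>M borel)" by (simp add: borel_prod)
  have "AE z in (lborel \<Otimes>\<^sub>M lborel). \<bar>w z\<bar> \<le> max A 0"
  proof (rule lborel_pair.AE_pair_measure)
    show "AE t in lborel. AE x in lborel. \<bar>w (t, x)\<bar> \<le> max A 0"
    proof (rule AE_I2)
      fix t
      show "AE x in lborel. \<bar>w (t, x)\<bar> \<le> max A 0"
      proof (cases "t \<in> {0..T}")
        case True
        from slice[OF this] show ?thesis by eventually_elim (auto simp: w_def cyl_def indicator_def)
      qed (auto simp: w_def cyl_def)
    qed
  qed measurable
  then have "AE z in lborel. \<bar>w z\<bar> \<le> max A 0" unfolding lborel_prod .
  then have "AE z in lborel. z \<in> cyl T \<Omega> \<longrightarrow> \<bar>case_prod v z\<bar> \<le> max A 0"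
    by eventually_elim (auto simp: w_def)
  then show ?thesis by (rule that[rotated]) simp
qed

section \<open>Integrability of the Laplacian on the cylinder\<close>

lemma Lp_space_4_iff:
  "f \<in> Lp_space S 4 \<longleftrightarrow> set_borel_measurable lborel S f \<and> set_integrable lborel S (\<lambda>x. f x ^ 4)"
  by (simp add: Lp_space_def)

text \<open>The converse of Hoelder's inequality in affine form. Testing with a truncation of w^3/8
  gives the integral of w^4 with factor 1/8 on the left and 1/16 on the right. The truncation makes
  these integrals finite, so the right one can be absorbed, leaving the bound 16 C0; monotone
  convergence removes the truncation.\<close>

lemma power4_integrable_of_dual_bound:
  fixes S :: "'a::euclidean_space set"
  assumes S: "open S" and w: "locally_integrable S w" and C0: "0 \<le> C0"
    and bound: "\<And>\<phi>. test_function S \<phi> \<Longrightarrow> \<bar>LBINT x:S. w x * \<phi> x\<bar> \<le> C0 + (LBINT x:S. \<bar>\<phi> x\<bar> powr (4/3))"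
  shows "w \<in> Lp_space S 4"
proof -
  obtain C where C: "\<And>n. compact (C n)" "\<And>n. C n \<subseteq> S" "\<And>n. C n \<subseteq> interior (C (Suc n))"
      "\<Union> (range C) = S" "\<And>K. \<lbrakk>compact K; K \<subseteq> S\<rbrakk> \<Longrightarrow> \<exists>N. \<forall>n\<ge>N. K \<subseteq> (C n)"
    by (rule open_Union_compact_subsets[OF S]) (rule that)
  have C_mono: "C m \<subseteq> C n" if "m \<le> n" for m n
    using lift_Suc_mono_le[of C m n] C(3) interior_subset that by blast
  define W where "W x = indicator S x *\<^sub>R w x" for x
  have [measurable]: "W \<in> borel_measurable borel"
    using locally_integrable_measurable[OF S w] by (simp add: W_def[abs_def] set_borel_measurable_def)
  have Cm[measurable]: "C n \<in> sets borel" for n using C(1) by (simp add: borel_compact)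
  define A where "A n x = indicator (C n) x * (if \<bar>W x\<bar> \<le> real n then W x ^ 4 else 0)" for n x
  have A_m[measurable]: "A n \<in> borel_measurable borel" for n unfolding A_def[abs_def] by measurable
  have A_int: "integrable lborel (A n)" for n
  proof (rule Bochner_Integration.integrable_bound)
    show "integrable lborel (\<lambda>x. indicator (C n) x *\<^sub>R (real n ^ 4))"
      using C(1)[of n] by (intro integrable_indicator) (simp_all add: emeasure_compact_finite[simplified])
    show "AE x in lborel. norm (A n x) \<le> norm (indicator (C n) x *\<^sub>R (real n ^ 4))"
    proof (rule AE_I2)
      fix x
      have "\<bar>W x\<bar> ^ 4 \<le> real n ^ 4" if "\<bar>W x\<bar> \<le> real n" using that by (intro power_mono) auto
      then show "norm (A n x) \<le> norm (indicator (C n) x *\<^sub>R (real n ^ 4))"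
        by (simp add: A_def indicator_def)
    qed
  qed measurable
  have A_bound: "(LINT x|lborel. A n x) \<le> 16 * C0" for n
  proof -
    \<comment> \<open>The divisor 8 creates the gap for absorption: 8 to the power 4/3 is
      16.\<close>
    define \<zeta> where "\<zeta> x = indicator (C n) x * (if \<bar>W x\<bar> \<le> real n then W x ^ 3 / 8 else 0)" for x
    have "\<bar>LBINT x:S. w x * \<zeta> x\<bar> \<le> C0 + 1 * (LBINT x:S. \<bar>\<zeta> x\<bar> powr (4/3))"
    proof (rule dual_bound_extend[OF S w, where K="C n" and c="real n ^ 3"])
      show "\<bar>LBINT x:S. w x * \<phi> x\<bar> \<le> C0 + 1 * (LBINT x:S. \<bar>\<phi> x\<bar> powr (4/3))"
        if "test_function S \<phi>" for \<phi> using bound[OF that] by simp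
      show "\<zeta> \<in> borel_measurable borel" unfolding \<zeta>_def[abs_def] by measurable
      show "\<bar>\<zeta> x\<bar> \<le> real n ^ 3" for x
      proof -
        have "\<bar>W x\<bar> ^ 3 \<le> real n ^ 3 * 8" if "\<bar>W x\<bar> \<le> real n"
        proof -
          have "\<bar>W x\<bar> ^ 3 \<le> real n ^ 3" using that by (intro power_mono) auto
          moreover have "0 \<le> real n ^ 3" by simp
          ultimately show ?thesis by linarith
        qed
        then show ?thesis by (auto simp: \<zeta>_def indicator_def power_abs)
      qed
      show "supported_in \<zeta> (C n)" by (simp add: \<zeta>_def supported_in_def)
    qed (use C(1,2) in simp_all)
    moreover have "(LBINT x:S. w x * \<zeta> x) = (LINT x|lborel. A n x / 8)"
      unfolding set_lebesgue_integral_def using C(2)[of n]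
      by (intro Bochner_Integration.integral_cong)
        (auto simp: \<zeta>_def W_def A_def indicator_def power_numeral_reduce)
    moreover have "(LBINT x:S. \<bar>\<zeta> x\<bar> powr (4/3)) = (LINT x|lborel. A n x / 16)"
      unfolding set_lebesgue_integral_def
    proof (intro Bochner_Integration.integral_cong refl)
      fix x
      have "\<bar>y ^ 3 / 8\<bar> powr (4/3) = y ^ 4 / 16" for y :: real
      proof -
        have "\<bar>y ^ 3 / 8\<bar> = (\<bar>y\<bar> / 2) powr 3"
          by (simp add: power_divide power_abs)
        then have "\<bar>y ^ 3 / 8\<bar> powr (4/3) = (\<bar>y\<bar> / 2) powr (3 * (4/3))" by (simp only: powr_powr)
        also have "\<dots> = (\<bar>y\<bar> / 2) powr 4" by simp
        also have "\<dots> = y ^ 4 / 16" by (simp add: power_divide)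
        finally show ?thesis .
      qed
      then show "indicator S x *\<^sub>R \<bar>\<zeta> x\<bar> powr (4/3) = A n x / 16"
        using C(2)[of n] by (auto simp: \<zeta>_def A_def indicator_def)
    qed
    ultimately show ?thesis by (simp add: abs_le_iff)
  qed
  have A_nn: "0 \<le> A n x" for n x by (simp add: A_def)
  have "(\<lambda>n. \<integral>\<^sup>+ x. ennreal (A n x) \<partial>lborel) \<longlonglongrightarrow> (\<integral>\<^sup>+ x. ennreal (W x ^ 4) \<partial>lborel)"
  proof (rule nn_integral_LIMSEQ)
    show "incseq (\<lambda>n x. ennreal (A n x))"
    proof (intro incseq_SucI le_funI ennreal_leI)
      fix n x show "A n x \<le> A (Suc n) x"
        using C_mono[of n "Suc n"] by (auto simp: A_def indicator_def)
    qed
    fix x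
    have "(\<lambda>n. A n x) \<longlonglongrightarrow> W x ^ 4"
    proof (rule tendsto_eventually, cases "x \<in> S")
      case True
      then obtain N where N: "\<forall>n\<ge>N. x \<in> C n" using C(5)[of "{x}"] by auto
      show "\<forall>\<^sub>F n in sequentially. A n x = W x ^ 4"
        unfolding eventually_at_top_linorder
        using N real_nat_ceiling_ge[of "\<bar>W x\<bar>"]
        by (intro exI[of _ "max N (nat \<lceil>\<bar>W x\<bar>\<rceil>)"]) (auto simp: A_def)
    next
      case False
      then have "x \<notin> C n" for n using C(2) by blast
      then show "\<forall>\<^sub>F n in sequentially. A n x = W x ^ 4" using False by (simp add: A_def W_def)
    qed
    then show "(\<lambda>n. ennreal (A n x)) \<longlonglongrightarrow> ennreal (W x ^ 4)" by (rule tendsto_ennrealI)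
  qed measurable
  moreover have "(\<integral>\<^sup>+ x. ennreal (A n x) \<partial>lborel) \<le> ennreal (16 * C0)" for n
    using A_bound[of n] A_int[of n] A_nn by (simp add: nn_integral_eq_integral ennreal_leI)
  ultimately have "(\<integral>\<^sup>+ x. ennreal (W x ^ 4) \<partial>lborel) \<le> ennreal (16 * C0)"
    by (intro LIMSEQ_le_const2) auto
  then have "(\<integral>\<^sup>+ x. ennreal (W x ^ 4) \<partial>lborel) < \<infinity>" using le_less_trans ennreal_less_top by fastforce
  then have "integrable lborel (\<lambda>x. W x ^ 4)" by (intro integrableI_nonneg) auto
  moreover have "(\<lambda>x. W x ^ 4) = (\<lambda>x. indicator S x *\<^sub>R w x ^ 4)" by (auto simp: W_def indicator_def)
  ultimately show ?thesis
    using locally_integrable_measurable[OF S w] by (simp add: Lp_space_4_iff set_integrable_def)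
qed

section \<open>Time slices of smooth functions on a product\<close>

lemma frechet_derivative_slice:
  fixes \<Phi> :: "'a::euclidean_space \<times> 'b::euclidean_space \<Rightarrow> real"
  assumes "\<Phi> differentiable at (t, x)"
  shows "((\<lambda>x. \<Phi> (t, x)) has_derivative (\<lambda>h. frechet_derivative \<Phi> (at (t, x)) (0, h))) (at x)"
proof -
  have 1: "((\<lambda>x. (t, x)) has_derivative (\<lambda>h. (0, h))) (at x)"
    by (auto intro!: derivative_eq_intros)
  have 2: "(\<Phi> has_derivative frechet_derivative \<Phi> (at (t, x))) (at (t, x))"
    using assms by (simp add: frechet_derivative_works[symmetric])
  show ?thesis by (rule has_derivative_compose[OF 1 2])
qed

lemma pd_slice:
  fixes \<Phi> :: "'a::euclidean_space \<times> 'b::euclidean_space \<Rightarrow> real"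
  assumes "smooth \<Phi>" "set bs \<subseteq> Basis"
  shows "pd bs (\<lambda>x. \<Phi> (t, x)) = (\<lambda>x. pd (map (Pair 0) bs) \<Phi> (t, x))"
  using assms
proof (induction bs arbitrary: \<Phi>)
  case (Cons b bs)
  have b: "(0, b) \<in> (Basis :: ('a \<times> 'b) set)" using Cons.prems by (simp add: Basis_prod_def)
  have "frechet_derivative (\<lambda>x. \<Phi> (t, x)) (at x) b = frechet_derivative \<Phi> (at (t, x)) (0, b)" for x
    by (simp add: frechet_derivative_eqI[OF frechet_derivative_slice[OF smooth_differentiable[OF Cons.prems(1)]]])
  then show ?case
    using Cons.IH[OF smooth_frechet[OF Cons.prems(1) b]] Cons.prems by simp
qed simp

text \<open>Together with compactness of the slices of the support, this makes each time slice of a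
  test function on the cylinder a test function on the domain.\<close>

lemma smooth_slice:
  fixes \<Phi> :: "'a::euclidean_space \<times> 'b::euclidean_space \<Rightarrow> real"
  assumes "smooth \<Phi>"
  shows "smooth (\<lambda>x. \<Phi> (t, x))"
  unfolding smooth_iff
proof (intro allI impI)
  fix bs :: "'b list" and x :: 'b assume bs: "set bs \<subseteq> Basis"
  have "set (map (Pair 0) bs) \<subseteq> (Basis :: ('a \<times> 'b) set)" using bs by (auto simp: Basis_prod_def)
  then have "pd (map (Pair 0) bs) \<Phi> differentiable at (t, x)"
    using smooth_pd[OF assms] smooth_differentiable by blast
  then show "pd bs (\<lambda>x. \<Phi> (t, x)) differentiable at x"
    unfolding pd_slice[OF assms bs] using frechet_derivative_slice differentiable_def by blast
qed

lemma compact_slice: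
  assumes "compact (K :: ('a::euclidean_space \<times> 'b::euclidean_space) set)"
  shows "compact {x. (t, x) \<in> K}"
proof -
  have "{x. (t, x) \<in> K} = snd ` (K \<inter> ({t} \<times> UNIV))" by force
  moreover have "compact (snd ` (K \<inter> ({t} \<times> UNIV)))"
    by (intro compact_continuous_image compact_Int_closed assms closed_Times continuous_intros
        closed_singleton closed_UNIV)
  ultimately show ?thesis by simp
qed

text \<open>Young's inequality with constants 1: either |b| <= |a|^3, and the first term dominates,
  or |a| <= |b|^(1/3), and the second does.\<close>

lemma young_4: "\<bar>a * b\<bar> \<le> a ^ 4 + \<bar>b\<bar> powr (4/3)" for a b :: real
proof (cases "\<bar>b\<bar> \<le> \<bar>a\<bar> ^ 3")
  case True
  then have "\<bar>a * b\<bar> \<le> \<bar>a\<bar> * \<bar>a\<bar> ^ 3" by (simp add: abs_mult mult_left_mono)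
  also have "\<dots> = a ^ 4" by (simp add: power_abs flip: power_Suc)
  finally show ?thesis by (simp add: add_increasing2)
next
  case False
  then have b: "\<bar>a\<bar> ^ 3 \<le> \<bar>b\<bar>" "b \<noteq> 0" by auto
  have "\<bar>a\<bar> = \<bar>a\<bar> powr (3 * (1/3))" by simp
  also have "\<dots> = (\<bar>a\<bar> powr 3) powr (1/3)" by (simp only: powr_powr)
  also have "\<dots> \<le> \<bar>b\<bar> powr (1/3)" using b by (intro powr_mono2) auto
  finally have "\<bar>a * b\<bar> \<le> \<bar>b\<bar> powr (1/3) * \<bar>b\<bar>" by (simp add: abs_mult mult_right_mono)
  also have "\<dots> = \<bar>b\<bar> powr (4/3)" using b(2) powr_add[of "\<bar>b\<bar>" "1/3" 1] by simp
  finally show ?thesis by (simp add: add_increasing)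
qed

lemma open_cyl: "open \<Omega> \<Longrightarrow> open (cyl T \<Omega>)"
  by (simp add: cyl_def open_Times)

lemma Lp_product_integrable:
  assumes S: "S \<in> sets lborel" and a: "a \<in> Lp_space S 4" and b: "b \<in> Lp_space S (4/3)"
  shows "set_integrable lborel S (\<lambda>x. a x * b x)"
proof (rule set_integrable_bound')
  show "set_integrable lborel S (\<lambda>x. a x ^ 4 + \<bar>b x\<bar> powr (4/3))"
    using a b by (intro set_integral_add) (auto simp: Lp_space_4_iff Lp_space_def[of _ "4/3"])
  show "set_borel_measurable lborel S (\<lambda>x. a x * b x)"
    using a b by (intro set_borel_measurable_mult) (auto simp: Lp_space_def)
qed (simp add: young_4)

text \<open>The slice derivatives controlled by the Bochner norm are never glued together to a
  function on the cylinder. Instead \<open>w\<close> is tested with \<Phi>, the derivative is moved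
  onto \<Phi>, Fubini splits off time, and on each slice it is moved back onto \<open>V t\<close>.
  Young's inequality then yields the dual bound required by
  \<open>power4_integrable_of_dual_bound\<close>.\<close>

lemma X_space_spatial_deriv_Lp:
  fixes \<Omega> :: "(real^3) set"
  assumes \<Omega>: "open \<Omega>" and V: "V \<in> X_space T \<Omega> 4" and bs: "bs \<in> multi_indices 2"
    and w: "has_weak_deriv (cyl T \<Omega>) (map (Pair 0) bs) (case_prod V) w"
  shows "w \<in> Lp_space (cyl T \<Omega>) 4"
proof -
  let ?Q = "cyl T \<Omega>" and ?N = "\<lambda>t. sobolev_norm \<Omega> 2 4 (V t) powr 4"
  let ?bs = "map (Pair 0) bs :: (real \<times> (real^3)) list"
  note Q = open_cyl[OF \<Omega>, of T]
  have [measurable]: "?Q \<in> sets borel" "\<Omega> \<in> sets borel" using Q \<Omega> by auto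
  have bsB: "set ?bs \<subseteq> Basis" using multi_indices_Basis[OF bs] by (auto simp: Basis_prod_def)
  have b: "V \<in> bochner_Lp T 4 (sobolev \<Omega> 2 4) (sobolev_norm \<Omega> 2 4)" using V by (simp add: X_space_def)
  then have Vs: "AE t in lborel. t \<in> {0<..<T} \<longrightarrow> V t \<in> sobolev \<Omega> 2 4"
    and N_int: "integrable lborel (\<lambda>t. indicator {0<..<T} t *\<^sub>R ?N t)"
    by (simp_all add: bochner_Lp_def set_integrable_def)
  \<comment> \<open>The fourth power of the Bochner norm; it is independent of the test
    function.\<close>
  define C0 where "C0 = (LINT t|lborel. indicator {0<..<T} t *\<^sub>R ?N t)"
  have bound: "\<bar>LBINT z:?Q. w z * \<Phi> z\<bar> \<le> C0 + (LBINT z:?Q. \<bar>\<Phi> z\<bar> powr (4/3))"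
    if \<Phi>: "test_function ?Q \<Phi>" for \<Phi>
  proof -
    obtain K where K: "smooth \<Phi>" "compact K" "K \<subseteq> ?Q" "supported_in \<Phi> K"
      by (rule test_functionE[OF \<Phi>]) (rule that)
    have slice: "test_function \<Omega> (\<lambda>x. \<Phi> (t, x))" for t
      by (rule test_functionI[OF smooth_slice[OF K(1)] compact_slice[OF K(2), of t]])
        (use K(3,4) in \<open>auto simp: supported_in_def cyl_def\<close>)
    have \<Phi>m: "\<Phi> \<in> borel_measurable borel" using K(1) by (rule smooth_measurable)
    have p_int: "set_integrable lborel ?Q (\<lambda>z. \<bar>\<Phi> z\<bar> powr (4/3))"
    proof -
      obtain B where B: "B > 0" "\<And>x. \<bar>\<Phi> x\<bar> \<le> B"
        by (rule smooth_compact_support_bounded[OF K(1,2,4)]) (rule that)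
      have "integrable lborel (\<lambda>z. \<bar>\<Phi> z\<bar> powr (4/3))"
      proof (rule Bochner_Integration.integrable_bound)
        show "integrable lborel (\<lambda>z. indicator K z *\<^sub>R (B powr (4/3)))"
          using K(2) by (intro integrable_indicator) (simp_all add: emeasure_compact_finite[simplified] borel_compact)
        show "AE z in lborel. norm (\<bar>\<Phi> z\<bar> powr (4/3)) \<le> norm (indicator K z *\<^sub>R (B powr (4/3)))"
          using B K(4) by (intro AE_I2) (auto simp: supported_in_def indicator_def intro!: powr_mono2)
      qed (use \<Phi>m in measurable)
      moreover have "(\<lambda>z. \<bar>\<Phi> z\<bar> powr (4/3)) = (\<lambda>z. indicator ?Q z *\<^sub>R \<bar>\<Phi> z\<bar> powr (4/3))"
        using K(3,4) by (auto simp: supported_in_def indicator_def fun_eq_iff)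
      ultimately show ?thesis
        unfolding set_integrable_def by (rule back_subst[where P="integrable lborel"])
    qed
    have wi: "locally_integrable ?Q (case_prod V)" using w by (simp add: has_weak_deriv_def)
    let ?g = "\<lambda>z. indicator ?Q z *\<^sub>R (case_prod V z * pd ?bs \<Phi> z)"
    let ?h = "\<lambda>z. indicator ?Q z *\<^sub>R \<bar>\<Phi> z\<bar> powr (4/3)"
    have g_int: "integrable (lborel \<Otimes>\<^sub>M lborel) ?g"
      using test_function_pd_integrable[OF Q wi \<Phi> bsB] by (simp add: set_integrable_def lborel_prod)
    have h_int: "integrable (lborel \<Otimes>\<^sub>M lborel) ?h"
      using p_int by (simp add: set_integrable_def lborel_prod)
    have "\<bar>LBINT z:?Q. w z * \<Phi> z\<bar> = \<bar>LBINT z:?Q. case_prod V z * pd ?bs \<Phi> z\<bar>"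
      using w \<Phi> unfolding has_weak_deriv_def by (simp add: abs_mult power_abs)
    also have "(LBINT z:?Q. case_prod V z * pd ?bs \<Phi> z) = (LINT t|lborel. LINT x|lborel. ?g (t, x))"
      unfolding set_lebesgue_integral_def
      using lborel_pair.integral_fst'[OF g_int] by (simp add: lborel_prod)
    also have "\<bar>\<dots>\<bar> \<le> (LINT t|lborel. \<bar>LINT x|lborel. ?g (t, x)\<bar>)"
      by (rule integral_abs_bound)
    also have "\<dots> \<le> (LINT t|lborel. indicator {0<..<T} t *\<^sub>R ?N t + (LINT x|lborel. ?h (t, x)))"
    proof (rule integral_mono_AE)
      show "integrable lborel (\<lambda>t. \<bar>LINT x|lborel. ?g (t, x)\<bar>)"
        using lborel_pair.integrable_fst'[OF g_int] by (rule integrable_abs)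
      show "integrable lborel (\<lambda>t. indicator {0<..<T} t *\<^sub>R ?N t + (LINT x|lborel. ?h (t, x)))"
        using N_int lborel_pair.integrable_fst'[OF h_int] by (rule Bochner_Integration.integrable_add)
      \<comment> \<open>The slice derivative \<open>?D\<close> occurs for fixed t only; as functions
        of t only the slice integrals of \<open>?g\<close> and \<open>?h\<close> and the Sobolev
        norm of the slice are integrated.\<close>
      show "AE t in lborel. \<bar>LINT x|lborel. ?g (t, x)\<bar> \<le> indicator {0<..<T} t *\<^sub>R ?N t + (LINT x|lborel. ?h (t, x))"
        using Vs
      proof eventually_elim
        case (elim t)
        show ?case
        proof (cases "t \<in> {0<..<T}")
          case True
          then have Vt: "V t \<in> sobolev \<Omega> 2 4" using elim by simp
          have n2: "nat \<lfloor>2::real\<rfloor> = 2" by simp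
          note wd = sobolev_weak_deriv_power4[OF \<Omega> Vt, unfolded n2, OF bs]
          let ?D = "weak_deriv \<Omega> bs (V t)"
          have i: "set_integrable lborel \<Omega> (\<lambda>x. ?D x * \<Phi> (t, x))"
            using test_function_integrable[OF \<Omega> _ slice, of ?D t] wd(1) by (simp add: has_weak_deriv_def)
          have pi: "set_integrable lborel \<Omega> (\<lambda>x. \<bar>\<Phi> (t, x)\<bar> powr (4/3))"
          proof -
            obtain B where B: "B > 0" "\<And>x. \<bar>\<Phi> x\<bar> \<le> B"
              by (rule smooth_compact_support_bounded[OF K(1,2,4)]) (rule that)
            let ?K = "{x. (t, x) \<in> K}"
            have c: "compact ?K" by (rule compact_slice[OF K(2)])
            have "set_integrable lborel \<Omega> (\<lambda>x. indicator ?K x * B powr (4/3))"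
            proof -
              have "integrable lborel (\<lambda>x. indicator (\<Omega> \<inter> ?K) x *\<^sub>R (B powr (4/3)))"
                using c \<Omega> emeasure_mono[of "\<Omega> \<inter> ?K" ?K lborel] emeasure_compact_finite[OF c]
                by (intro integrable_indicator) (auto simp: borel_compact intro: le_less_trans)
              moreover have "(\<lambda>x. indicator (\<Omega> \<inter> ?K) x *\<^sub>R (B powr (4/3)))
                = (\<lambda>x. indicator \<Omega> x *\<^sub>R (indicator ?K x * B powr (4/3)))"
                by (auto simp: indicator_def fun_eq_iff)
              ultimately show ?thesis by (simp only: set_integrable_def)
            qed
            then show ?thesis
            proof (rule set_integrable_bound')
              have "(\<lambda>x. \<Phi> (t, x)) \<in> borel_measurable borel"
                using smooth_measurable[OF smooth_slice[OF K(1)]] .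
              then show "set_borel_measurable lborel \<Omega> (\<lambda>x. \<bar>\<Phi> (t, x)\<bar> powr (4/3))"
                by (intro borel_set_borel_measurable) auto
              show "AE x in lborel. x \<in> \<Omega> \<longrightarrow> \<bar>\<bar>\<Phi> (t, x)\<bar> powr (4/3)\<bar> \<le> indicator ?K x * B powr (4/3)"
                using B K(4) by (intro AE_I2) (auto simp: supported_in_def indicator_def intro!: powr_mono2)
            qed
          qed
          have "(LINT x|lborel. ?g (t, x)) = (LBINT x:\<Omega>. V t x * pd bs (\<lambda>x. \<Phi> (t, x)) x)"
            unfolding set_lebesgue_integral_def pd_slice[OF K(1) multi_indices_Basis[OF bs]]
            using True by (intro Bochner_Integration.integral_cong) (auto simp: cyl_def indicator_def)
          also have "\<dots> = (-1) ^ length bs * (LBINT x:\<Omega>. ?D x * \<Phi> (t, x))"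
            using wd(1) slice[of t] unfolding has_weak_deriv_def by blast
          finally have "\<bar>LINT x|lborel. ?g (t, x)\<bar> = \<bar>LBINT x:\<Omega>. ?D x * \<Phi> (t, x)\<bar>"
            by (simp add: abs_mult power_abs)
          also have "\<dots> \<le> (LBINT x:\<Omega>. \<bar>?D x * \<Phi> (t, x)\<bar>)"
            unfolding set_lebesgue_integral_def
            by (rule order_trans[OF integral_abs_bound]) (simp add: abs_mult)
          also have "\<dots> \<le> (LBINT x:\<Omega>. ?D x ^ 4 + \<bar>\<Phi> (t, x)\<bar> powr (4/3))"
            using set_integrable_abs[OF i] set_integral_add(1)[OF wd(2) pi]
            by (rule set_integral_mono) (rule young_4)
          also have "\<dots> = (LBINT x:\<Omega>. ?D x ^ 4) + (LBINT x:\<Omega>. \<bar>\<Phi> (t, x)\<bar> powr (4/3))"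
            by (rule set_integral_add(2)[OF wd(2) pi])
          also have "(LBINT x:\<Omega>. ?D x ^ 4) \<le> ?N t"
            using weak_deriv_powr_le_sobolev_norm[of 4 bs 2 \<Omega> "V t"] bs by simp
          also have "(LBINT x:\<Omega>. \<bar>\<Phi> (t, x)\<bar> powr (4/3)) = (LINT x|lborel. ?h (t, x))"
            unfolding set_lebesgue_integral_def
            using True by (intro Bochner_Integration.integral_cong) (auto simp: cyl_def indicator_def)
          finally show ?thesis using True by simp
        next
          case False
          then have "(t, x) \<notin> ?Q" for x by (auto simp: cyl_def)
          then show ?thesis using False by simp
        qed
      qed
    qed
    also have "\<dots> = C0 + (LINT t|lborel. LINT x|lborel. ?h (t, x))"
      unfolding C0_def using N_int lborel_pair.integrable_fst'[OF h_int]
      by (rule Bochner_Integration.integral_add)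
    also have "(LINT t|lborel. LINT x|lborel. ?h (t, x)) = (LBINT z:?Q. \<bar>\<Phi> z\<bar> powr (4/3))"
      unfolding set_lebesgue_integral_def
      using lborel_pair.integral_fst'[OF h_int] by (simp add: lborel_prod)
    finally show ?thesis .
  qed
  show ?thesis
  proof (rule power4_integrable_of_dual_bound[OF Q _ _ bound])
    show "locally_integrable ?Q w" using w by (simp add: has_weak_deriv_def)
    show "0 \<le> C0" unfolding C0_def by (intro Bochner_Integration.integral_nonneg) auto
  qed
qed

section \<open>Differential operators on the cylinder\<close>

lemma dt_eq: "dt T \<Omega> u (fst z) (snd z) = weak_deriv (cyl T \<Omega>) [(1, 0)] (case_prod u) z"
  by (simp add: dt_def)

lemma lap_eq: "lap T \<Omega> u (fst z) (snd z)
    = (\<Sum>b\<in>Basis. weak_deriv (cyl T \<Omega>) [(0, b), (0, b)] (case_prod u) z)"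
  by (simp add: lap_def)

lemma grad_inner:
  assumes "b \<in> Basis"
  shows "grad T \<Omega> u (fst z) (snd z) \<bullet> b = weak_deriv (cyl T \<Omega>) [(0, b)] (case_prod u) z"
  using assms by (simp add: grad_def inner_sum_left_Basis)

lemma dt_measurable: "open \<Omega> \<Longrightarrow> set_borel_measurable lborel (cyl T \<Omega>) (\<lambda>z. dt T \<Omega> u (fst z) (snd z))"
  unfolding dt_eq by (intro weak_deriv_measurable open_cyl)

lemma lap_measurable: "open \<Omega> \<Longrightarrow> set_borel_measurable lborel (cyl T \<Omega>) (\<lambda>z. lap T \<Omega> u (fst z) (snd z))"
  unfolding lap_eq by (intro set_borel_measurable_sum weak_deriv_measurable open_cyl)

lemma dt_scale:
  assumes \<Omega>: "open \<Omega>" and u: "set_borel_measurable lborel (cyl T \<Omega>) (case_prod u)"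
  shows "AE z in lborel. z \<in> cyl T \<Omega> \<longrightarrow>
    dt T \<Omega> (\<lambda>t x. c * u t x) (fst z) (snd z) = c * dt T \<Omega> u (fst z) (snd z)"
  unfolding dt_eq
  by (rule weak_deriv_scale[OF open_cyl[OF \<Omega>] _ u])
    (use set_borel_measurable_cmult[OF u, of c] in \<open>auto simp: case_prod_beta' Basis_prod_def\<close>)

lemma weak_deriv_cyl_scale:
  assumes \<Omega>: "open \<Omega>" and u: "set_borel_measurable lborel (cyl T \<Omega>) (case_prod u)"
    and bs: "set bs \<subseteq> Basis"
  shows "AE z in lborel. z \<in> cyl T \<Omega> \<longrightarrow> weak_deriv (cyl T \<Omega>) bs (\<lambda>(t, x). c * u t x) z
    = c * weak_deriv (cyl T \<Omega>) bs (case_prod u) z"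
  by (rule weak_deriv_scale[OF open_cyl[OF \<Omega>] bs u])
    (use set_borel_measurable_cmult[OF u, of c] in \<open>auto simp: case_prod_beta'\<close>)

lemma lap_scale:
  assumes \<Omega>: "open \<Omega>" and u: "set_borel_measurable lborel (cyl T \<Omega>) (case_prod u)"
  shows "AE z in lborel. z \<in> cyl T \<Omega> \<longrightarrow>
    lap T \<Omega> (\<lambda>t x. c * u t x) (fst z) (snd z) = c * lap T \<Omega> u (fst z) (snd z)"
proof -
  have "AE z in lborel. \<forall>b\<in>(Basis :: (real^3) set). z \<in> cyl T \<Omega> \<longrightarrow>
    weak_deriv (cyl T \<Omega>) [(0, b), (0, b)] (\<lambda>(t, x). c * u t x) z
    = c * weak_deriv (cyl T \<Omega>) [(0, b), (0, b)] (case_prod u) z"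
    using weak_deriv_cyl_scale[OF \<Omega> u] by (intro AE_finite_allI) (auto simp: Basis_prod_def)
  then show ?thesis unfolding lap_eq
    by eventually_elim (auto simp: sum_distrib_left intro!: sum.cong)
qed

lemma grad_scale:
  assumes \<Omega>: "open \<Omega>" and u: "set_borel_measurable lborel (cyl T \<Omega>) (case_prod u)"
  shows "AE z in lborel. z \<in> cyl T \<Omega> \<longrightarrow>
    grad T \<Omega> (\<lambda>t x. c * u t x) (fst z) (snd z) = c *\<^sub>R grad T \<Omega> u (fst z) (snd z)"
proof -
  have "AE z in lborel. \<forall>b\<in>(Basis :: (real^3) set). z \<in> cyl T \<Omega> \<longrightarrow>
    weak_deriv (cyl T \<Omega>) [(0, b)] (\<lambda>(t, x). c * u t x) z
    = c * weak_deriv (cyl T \<Omega>) [(0, b)] (case_prod u) z"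
    using weak_deriv_cyl_scale[OF \<Omega> u] by (intro AE_finite_allI) (auto simp: Basis_prod_def)
  then show ?thesis
    by eventually_elim (auto simp: grad_def scaleR_sum_right intro!: sum.cong)
qed

lemma flux_measurable:
  assumes \<Omega>: "open \<Omega>" and u: "set_borel_measurable lborel (cyl T \<Omega>) (case_prod u)" and b: "b \<in> Basis"
  shows "set_borel_measurable lborel (cyl T \<Omega>)
    (\<lambda>z. (u (fst z) (snd z) *\<^sub>R grad T \<Omega> v (fst z) (snd z)) \<bullet> b)"
  using set_borel_measurable_mult[OF u weak_deriv_measurable[OF open_cyl[OF \<Omega>]]] b
  by (simp add: grad_inner case_prod_beta')

lemma has_weak_div_zero: "has_weak_div T \<Omega> (\<lambda>_ _. 0) (\<lambda>_ _. 0)"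
  by (simp add: has_weak_div_def cyl_int_def case_prod_beta' locally_integrable_zero)

lemma has_weak_div_unique:
  assumes \<Omega>: "open \<Omega>" and "has_weak_div T \<Omega> F g" "has_weak_div T \<Omega> F g'"
  shows "AE z in lborel. z \<in> cyl T \<Omega> \<longrightarrow> case_prod g z = case_prod g' z"
proof (rule AE_eq_of_test_functions[OF open_cyl[OF \<Omega>]])
  fix \<phi> assume \<phi>: "test_function (cyl T \<Omega>) \<phi>"
  let ?L = "cyl_int T \<Omega> (\<lambda>t x. \<Sum>b\<in>Basis. (F t x \<bullet> b) * pd [(0, b)] \<phi> (t, x))"
  have "?L = - cyl_int T \<Omega> (\<lambda>t x. g t x * \<phi> (t, x))" "?L = - cyl_int T \<Omega> (\<lambda>t x. g' t x * \<phi> (t, x))"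
    using assms(2,3) \<phi> unfolding has_weak_div_def by blast+
  then have "cyl_int T \<Omega> (\<lambda>t x. g t x * \<phi> (t, x)) = cyl_int T \<Omega> (\<lambda>t x. g' t x * \<phi> (t, x))"
    by linarith
  then show "(LBINT z:cyl T \<Omega>. case_prod g z * \<phi> z) = (LBINT z:cyl T \<Omega>. case_prod g' z * \<phi> z)"
    by (simp add: cyl_int_def case_prod_beta')
qed (use assms in \<open>auto simp: has_weak_div_def\<close>)

text \<open>The fields need to be proportional only a.e., because the gradient of a multiple is a
  multiple of the gradient only up to a null set.\<close>

lemma has_weak_div_scale:
  assumes \<Omega>: "open \<Omega>" and F: "has_weak_div T \<Omega> F g"
    and F': "\<And>b. b \<in> Basis \<Longrightarrow> set_borel_measurable lborel (cyl T \<Omega>) (\<lambda>z. F' (fst z) (snd z) \<bullet> b)"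
    and eq: "AE z in lborel. z \<in> cyl T \<Omega> \<longrightarrow> F' (fst z) (snd z) = c *\<^sub>R F (fst z) (snd z)"
  shows "has_weak_div T \<Omega> F' (\<lambda>t x. c * g t x)"
  unfolding has_weak_div_def
proof (intro conjI ballI allI impI)
  note Q = open_cyl[OF \<Omega>, of T]
  note F = F[unfolded has_weak_div_def]
  show F'l: "locally_integrable (cyl T \<Omega>) (\<lambda>(t, x). F' t x \<bullet> b)" if b: "b \<in> Basis" for b
  proof (rule locally_integrable_cong_AE)
    show "locally_integrable (cyl T \<Omega>) (\<lambda>z. c * (\<lambda>(t, x). F t x \<bullet> b) z)"
      using F b by (intro locally_integrable_cmult) blast
    show "AE z in lborel. z \<in> cyl T \<Omega> \<longrightarrow> c * (\<lambda>(t, x). F t x \<bullet> b) z = (\<lambda>(t, x). F' t x \<bullet> b) z"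
      using eq by eventually_elim (auto simp: case_prod_beta')
  qed (use F'[OF b] in \<open>simp add: case_prod_beta'\<close>)
  show "locally_integrable (cyl T \<Omega>) (\<lambda>(t, x). c * g t x)"
    using F locally_integrable_cmult[of "cyl T \<Omega>" "case_prod g" c] by (simp add: case_prod_beta')
  fix \<phi> assume \<phi>: "test_function (cyl T \<Omega>) \<phi>"
  have int: "set_integrable lborel (cyl T \<Omega>) (\<lambda>z. \<Sum>b\<in>Basis. (H (fst z) (snd z) \<bullet> b) * pd [(0, b)] \<phi> z)"
    if H: "\<And>b. b \<in> Basis \<Longrightarrow> locally_integrable (cyl T \<Omega>) (\<lambda>(t, x). H t x \<bullet> b)" for H :: "real \<Rightarrow> real^3 \<Rightarrow> real^3"
  proof -
    have "set_integrable lborel (cyl T \<Omega>) (\<lambda>z. (H (fst z) (snd z) \<bullet> b) * pd [(0, b)] \<phi> z)" if b: "b \<in> Basis" for b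
      using test_function_pd_integrable[OF Q H[OF b] \<phi>, of "[(0, b)]"] b
      by (simp add: case_prod_beta' Basis_prod_def del: pd.simps)
    then show ?thesis
      unfolding set_integrable_def scaleR_sum_right by (intro Bochner_Integration.integrable_sum) auto
  qed
  have "cyl_int T \<Omega> (\<lambda>t x. \<Sum>b\<in>Basis. (F' t x \<bullet> b) * pd [(0, b)] \<phi> (t, x))
      = (LBINT z:cyl T \<Omega>. c * (\<Sum>b\<in>Basis. (F (fst z) (snd z) \<bullet> b) * pd [(0, b)] \<phi> z))"
    unfolding cyl_int_def case_prod_beta' prod.collapse
  proof (rule set_integral_cong_AE')
    show "set_borel_measurable lborel (cyl T \<Omega>) (\<lambda>z. \<Sum>b\<in>Basis. (F' (fst z) (snd z) \<bullet> b) * pd [(0, b)] \<phi> z)"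
      by (rule set_integrable_imp_set_borel_measurable[OF int[OF F'l]])
    show "set_borel_measurable lborel (cyl T \<Omega>) (\<lambda>z. c * (\<Sum>b\<in>Basis. (F (fst z) (snd z) \<bullet> b) * pd [(0, b)] \<phi> z))"
      using F by (intro set_borel_measurable_cmult set_integrable_imp_set_borel_measurable int) blast
    show "AE z in lborel. z \<in> cyl T \<Omega> \<longrightarrow> (\<Sum>b\<in>Basis. (F' (fst z) (snd z) \<bullet> b) * pd [(0, b)] \<phi> z)
        = c * (\<Sum>b\<in>Basis. (F (fst z) (snd z) \<bullet> b) * pd [(0, b)] \<phi> z)"
      using eq by eventually_elim (simp add: sum_distrib_left mult.assoc del: pd.simps)
  qed
  also have "\<dots> = c * cyl_int T \<Omega> (\<lambda>t x. \<Sum>b\<in>Basis. (F t x \<bullet> b) * pd [(0, b)] \<phi> (t, x))"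
    by (simp add: cyl_int_def case_prod_beta' del: pd.simps)
  also have "\<dots> = - cyl_int T \<Omega> (\<lambda>t x. c * g t x * \<phi> (t, x))"
    using F \<phi> by (simp add: cyl_int_def case_prod_beta' mult.assoc del: pd.simps)
  finally show "cyl_int T \<Omega> (\<lambda>t x. \<Sum>b\<in>Basis. (F' t x \<bullet> b) * pd [(0, b)] \<phi> (t, x))
      = - cyl_int T \<Omega> (\<lambda>t x. c * g t x * \<phi> (t, x))" .
qed

lemma has_weak_div_divg: "has_weak_div T \<Omega> F g \<Longrightarrow> has_weak_div T \<Omega> F (divg T \<Omega> F)"
  unfolding divg_def by (auto intro: someI[of "has_weak_div T \<Omega> F"])

lemma divg_measurable:
  assumes "open \<Omega>"
  shows "set_borel_measurable lborel (cyl T \<Omega>) (\<lambda>z. divg T \<Omega> F (fst z) (snd z))"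
proof (cases "\<exists>g. has_weak_div T \<Omega> F g")
  case True
  then have "locally_integrable (cyl T \<Omega>) (case_prod (divg T \<Omega> F))"
    using has_weak_div_divg by (auto simp: has_weak_div_def)
  then show ?thesis
    using locally_integrable_measurable[OF open_cyl[OF assms]] by (simp add: case_prod_beta')
next
  case False
  then show ?thesis by (simp add: divg_def set_borel_measurable_zero)
qed

text \<open>The same case distinction as in \<open>weak_deriv_scale\<close>: either a weak
  divergence exists and scales, or for nonzero c none exists for both fields and both values are the
  default 0, or c = 0 and the field vanishes a.e.\<close>

lemma divg_scale:
  assumes \<Omega>: "open \<Omega>"
    and F: "\<And>b. b \<in> Basis \<Longrightarrow> set_borel_measurable lborel (cyl T \<Omega>) (\<lambda>z. F (fst z) (snd z) \<bullet> b)"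
    and F': "\<And>b. b \<in> Basis \<Longrightarrow> set_borel_measurable lborel (cyl T \<Omega>) (\<lambda>z. F' (fst z) (snd z) \<bullet> b)"
    and eq: "AE z in lborel. z \<in> cyl T \<Omega> \<longrightarrow> F' (fst z) (snd z) = c *\<^sub>R F (fst z) (snd z)"
  shows "AE z in lborel. z \<in> cyl T \<Omega> \<longrightarrow>
    divg T \<Omega> F' (fst z) (snd z) = c * divg T \<Omega> F (fst z) (snd z)"
proof -
  have key: "AE z in lborel. z \<in> cyl T \<Omega> \<longrightarrow> divg T \<Omega> F' (fst z) (snd z) = g (fst z) (snd z)"
    if "has_weak_div T \<Omega> F' g" for g
    using has_weak_div_unique[OF \<Omega> has_weak_div_divg[OF that] that] by (simp add: case_prod_beta')
  show ?thesis
  proof (cases "\<exists>g. has_weak_div T \<Omega> F g")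
    case True
    then show ?thesis using key[OF has_weak_div_scale[OF \<Omega> _ F' eq]] has_weak_div_divg by blast
  next
    case False
    then have 0: "divg T \<Omega> F = (\<lambda>_ _. 0)" by (simp add: divg_def)
    show ?thesis
    proof (cases "c = 0")
      case True
      have "has_weak_div T \<Omega> F' (\<lambda>t x. 0 * 0)"
        by (rule has_weak_div_scale[OF \<Omega> has_weak_div_zero F']) (use eq True in auto)
      from key[OF this] show ?thesis by (simp add: 0)
    next
      case c: False
      have "AE z in lborel. z \<in> cyl T \<Omega> \<longrightarrow> F (fst z) (snd z) = (1 / c) *\<^sub>R F' (fst z) (snd z)"
        using eq by eventually_elim (use c in simp)
      then have "\<not> has_weak_div T \<Omega> F' g" for g
        using has_weak_div_scale[OF \<Omega> _ F, of F' g "1 / c"] False by blast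
      then show ?thesis by (simp add: 0) (simp add: divg_def)
    qed
  qed
qed

section \<open>Fourth-power integrability of the time derivative and the Laplacian\<close>

lemma Lp_space_4_add:
  assumes f: "f \<in> Lp_space S 4" and g: "g \<in> Lp_space S 4" and S: "S \<in> sets lborel"
  shows "(\<lambda>x. f x + g x) \<in> Lp_space S 4"
  unfolding Lp_space_4_iff
proof
  note f = f[unfolded Lp_space_4_iff] and g = g[unfolded Lp_space_4_iff]
  show m: "set_borel_measurable lborel S (\<lambda>x. f x + g x)"
    using f g by (intro set_borel_measurable_add) auto
  show "set_integrable lborel S (\<lambda>x. (f x + g x) ^ 4)"
  proof (rule set_integrable_bound')
    show "set_integrable lborel S (\<lambda>x. 8 * (f x ^ 4 + g x ^ 4))"
      using f g by (intro set_integrable_mult_right set_integral_add) auto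
    show "set_borel_measurable lborel S (\<lambda>x. (f x + g x) ^ 4)"
      by (rule set_borel_measurable_comp[OF m]) (use S in auto)
    show "AE x in lborel. x \<in> S \<longrightarrow> \<bar>(f x + g x) ^ 4\<bar> \<le> 8 * (f x ^ 4 + g x ^ 4)"
      using add_power4_le by (intro AE_I2) simp
  qed
qed

lemma Lp_space_4_zero: "(\<lambda>_. 0) \<in> Lp_space S 4"
  by (simp add: Lp_space_4_iff set_borel_measurable_zero set_integrable_def)

lemma Lp_space_4_sum:
  "finite I \<Longrightarrow> S \<in> sets lborel \<Longrightarrow> (\<And>i. i \<in> I \<Longrightarrow> f i \<in> Lp_space S 4) \<Longrightarrow> (\<lambda>x. \<Sum>i\<in>I. f i x) \<in> Lp_space S 4"
  by (induction I rule: finite_induct) (auto simp: Lp_space_4_zero intro: Lp_space_4_add)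

lemma Lp_space_4_cong_AE:
  assumes "g \<in> Lp_space S 4" "set_borel_measurable lborel S f" "S \<in> sets lborel"
    and eq: "AE x in lborel. x \<in> S \<longrightarrow> f x = g x"
  shows "f \<in> Lp_space S 4"
  unfolding Lp_space_4_iff
proof
  show "set_integrable lborel S (\<lambda>x. f x ^ 4)"
  proof (rule set_integrable_cong_AE')
    show "set_integrable lborel S (\<lambda>x. g x ^ 4)" using assms(1) by (simp add: Lp_space_4_iff)
    show "set_borel_measurable lborel S (\<lambda>x. f x ^ 4)"
      by (rule set_borel_measurable_comp[OF assms(2)]) (use assms(3) in auto)
    show "AE x in lborel. x \<in> S \<longrightarrow> g x ^ 4 = f x ^ 4" using eq by eventually_elim simp
  qed
qed (rule assms(2))

lemma X_space_dt_Lp: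
  assumes \<Omega>: "open \<Omega>" and V: "V \<in> X_space T \<Omega> 4"
  shows "(\<lambda>z. dt T \<Omega> V (fst z) (snd z)) \<in> Lp_space (cyl T \<Omega>) 4"
proof -
  obtain g where g: "g \<in> Lp_space (cyl T \<Omega>) 4" "has_weak_deriv (cyl T \<Omega>) [(1, 0)] (case_prod V) g"
    using V by (auto simp: X_space_def)
  show ?thesis
    by (rule Lp_space_4_cong_AE[OF g(1) dt_measurable[OF \<Omega>]])
      (use weak_deriv_AE_eq[OF open_cyl[OF \<Omega>] g(2)] open_cyl[OF \<Omega>] in \<open>auto simp: dt_eq\<close>)
qed

lemma X_space_lap_Lp:
  assumes \<Omega>: "open \<Omega>" and V: "V \<in> X_space T \<Omega> 4"
  shows "(\<lambda>z. lap T \<Omega> V (fst z) (snd z)) \<in> Lp_space (cyl T \<Omega>) 4"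
  unfolding lap_eq
proof (rule Lp_space_4_sum)
  fix b :: "real^3" assume b: "b \<in> Basis"
  show "weak_deriv (cyl T \<Omega>) [(0, b), (0, b)] (case_prod V) \<in> Lp_space (cyl T \<Omega>) 4"
  \<comment> \<open>A second derivative on the cylinder that exists is in L^4 by comparison with the
    slices; otherwise the default 0 is.\<close>
  proof (cases "\<exists>w. has_weak_deriv (cyl T \<Omega>) [(0, b), (0, b)] (case_prod V) w")
    case True
    then have "has_weak_deriv (cyl T \<Omega>) (map (Pair 0) [b, b]) (case_prod V)
        (weak_deriv (cyl T \<Omega>) [(0, b), (0, b)] (case_prod V))"
      using has_weak_deriv_weak_deriv by auto
    then show ?thesis
      using b by (intro X_space_spatial_deriv_Lp[OF \<Omega> V, of "[b, b]"]) (auto simp: multi_indices_def)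
  next
    case False
    then show ?thesis by (simp add: weak_deriv_def Lp_space_4_zero)
  qed
qed (use open_cyl[OF \<Omega>] in auto)

text \<open>A function that is 0 a.e. has Sobolev norm 0, and the functional is bounded by a
  multiple of the norm.\<close>

lemma dual_space_vanishes:
  assumes \<Omega>: "open \<Omega>" and p: "p > 0" and \<Phi>: "\<Phi> \<in> dual_space X (sobolev_norm \<Omega> s p)"
    and w: "w \<in> X" "set_borel_measurable lborel \<Omega> w" "AE x in lborel. x \<in> \<Omega> \<longrightarrow> w x = 0"
  shows "\<Phi> w = 0"
proof -
  have "sobolev_norm \<Omega> s p w = \<bar>0\<bar> * sobolev_norm \<Omega> s p w"
    by (rule sobolev_norm_scale[OF \<Omega> p w(2,2)]) (use w(3) in simp)
  then have "sobolev_norm \<Omega> s p w = 0" by simp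
  moreover obtain C where "\<forall>u\<in>X. \<bar>\<Phi> u\<bar> \<le> C * sobolev_norm \<Omega> s p u"
    using \<Phi> unfolding dual_space_def by blast
  ultimately show ?thesis using w(1) by fastforce
qed

section \<open>The optimality system\<close>

lemma W_space_cyl_measurable:
  "u \<in> W_space T \<Omega> p \<Longrightarrow> set_borel_measurable lborel (cyl T \<Omega>) (case_prod u)"
  by (simp add: W_space_def X_space_def cyl_Lp_def Lp_space_def)

lemma cyl_int_cong_AE:
  assumes "set_borel_measurable lborel (cyl T A) (\<lambda>z. h (fst z) (snd z))"
    "set_borel_measurable lborel (cyl T A) (\<lambda>z. h' (fst z) (snd z))"
    "AE z in lborel. z \<in> cyl T A \<longrightarrow> h (fst z) (snd z) = h' (fst z) (snd z)"
  shows "cyl_int T A h = cyl_int T A h'"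
  unfolding cyl_int_def case_prod_beta' using assms by (rule set_integral_cong_AE')

lemma cyl_int_cmult: "cyl_int T A (\<lambda>t x. c * h t x) = c * cyl_int T A h"
  by (simp add: cyl_int_def case_prod_beta')

lemma cyl_int_AE_zero:
  assumes "AE z in lborel. z \<in> cyl T A \<longrightarrow> h (fst z) (snd z) = 0"
  shows "cyl_int T A h = 0"
  unfolding cyl_int_def case_prod_beta' using assms by (rule set_integral_AE_zero)

text \<open>For p = 2 the order 2 - 2/p is 1, and \<open>sobolev_hat\<close> is the plain space
  because p < 3.\<close>

lemma W0_space_initial_vanishes_H1:
  assumes \<Omega>: "open \<Omega>" and T: "0 < T" and U: "U \<in> W0_space T \<Omega> 2"
    and \<Phi>: "\<Phi> \<in> dual_space (sobolev \<Omega> 1 2) (sobolev_norm \<Omega> 1 2)"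
  shows "\<Phi> (U 0) = 0"
proof -
  have "U 0 \<in> sobolev_hat \<Omega> 2"
    using U T by (auto simp: W0_space_def W_space_def X_space_def continuous_into_def)
  then have s: "U 0 \<in> sobolev \<Omega> 1 2" by (simp add: sobolev_hat_def)
  show ?thesis
    by (rule dual_space_vanishes[OF \<Omega> _ \<Phi> s sobolev_measurable[OF s]]) (use U in \<open>auto simp: W0_space_def\<close>)
qed

text \<open>For p = 4 the order 2 - 2/p is 3/2, and \<open>sobolev_hat\<close> carries the Neumann
  condition, matching the domain of the functional.\<close>

lemma W0_space_initial_vanishes_W32:
  assumes \<Omega>: "open \<Omega>" and T: "0 < T" and V: "V \<in> W0_space T \<Omega> 4"
    and \<Phi>: "\<Phi> \<in> dual_space (sobolev_n \<Omega> (3/2) 4) (sobolev_norm \<Omega> (3/2) 4)"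
  shows "\<Phi> (V 0) = 0"
proof -
  have "V 0 \<in> sobolev_hat \<Omega> 4"
    using V T by (auto simp: W0_space_def W_space_def X_space_def continuous_into_def)
  then have s: "V 0 \<in> sobolev_n \<Omega> (3/2) 4" by (simp add: sobolev_hat_def)
  then have m: "set_borel_measurable lborel \<Omega> (V 0)" by (auto simp: sobolev_n_def intro: sobolev_measurable)
  show ?thesis
    by (rule dual_space_vanishes[OF \<Omega> _ \<Phi> s m]) (use V in \<open>auto simp: W0_space_def\<close>)
qed

text \<open>Obtained as 0 times a known member, so that none of the defining conditions, such as
  traces or Bochner measurability, has to be checked for the zero function.\<close>

lemma W0_space_zero:
  assumes "open \<Omega>" "p > 0" "u \<in> W_space T \<Omega> p"
  shows "(\<lambda>_ _. 0) \<in> W0_space T \<Omega> p"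
  using W_space_cmult[OF assms, of 0] by (simp add: W0_space_def)

theorem corollary1:
  fixes \<Omega> \<Omega>c :: "(real^3) set"
    and T \<alpha>u \<alpha>v \<alpha>f :: real
    and u0 v0 :: "real^3 \<Rightarrow> real"
    and ud vd u v f lam \<eta> :: "real \<Rightarrow> real^3 \<Rightarrow> real"
    and \<F> :: "(real \<Rightarrow> real^3 \<Rightarrow> real) set"
    and \<phi>1 \<phi>2 :: "(real^3 \<Rightarrow> real) \<Rightarrow> real"
  assumes "domain \<Omega>" and "bounded \<Omega>" and "simply_connected \<Omega>" and "C2_boundary \<Omega>"
    and "domain \<Omega>c" and "\<Omega>c \<subseteq> \<Omega>"
    and "0 < T"
    and "0 < \<alpha>u" and "0 \<le> \<alpha>v" and "0 \<le> \<alpha>f"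
    and "u0 \<in> sobolev \<Omega> 1 2" and "v0 \<in> sobolev_n \<Omega> (3/2) 4"
    and "AE x\<in>\<Omega> in lborel. 0 \<le> u0 x" and "AE x\<in>\<Omega> in lborel. 0 \<le> v0 x"
    and "ud \<in> cyl_Lp T \<Omega> (26/7)" and "vd \<in> cyl_Lp T \<Omega> 2"
    and "\<F> \<noteq> {}" and "\<F> \<subseteq> cyl_Lp T \<Omega>c 4" and "convex_functions \<F>"
    and "local_optimal T \<Omega> \<Omega>c \<alpha>u \<alpha>v \<alpha>f u0 v0 ud vd \<F> u v f"
    and "lagrange_multiplier T \<Omega> \<Omega>c \<alpha>u \<alpha>v \<alpha>f ud vd \<F> u v f lam \<eta> \<phi>1 \<phi>2"
  shows "lam \<in> cyl_Lp T \<Omega> 2 \<and> \<eta> \<in> cyl_Lp T \<Omega> (4/3) \<and>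
    (\<forall>U\<in>W0_space T \<Omega> 2.
       cyl_int T \<Omega> (\<lambda>t x.
           (dt T \<Omega> U t x - lap T \<Omega> U t x
             - divg T \<Omega> (\<lambda>t x. U t x *\<^sub>R grad T \<Omega> v t x) t x) * lam t x)
         - cyl_int T \<Omega> (\<lambda>t x. U t x * \<eta> t x)
       = \<alpha>u * cyl_int T \<Omega>
           (\<lambda>t x. sgn (u t x - ud t x) * \<bar>u t x - ud t x\<bar> powr (13/7) * U t x)) \<and>
    (\<forall>V\<in>W0_space T \<Omega> 4.
       cyl_int T \<Omega> (\<lambda>t x. (dt T \<Omega> V t x - lap T \<Omega> V t x + V t x) * \<eta> t x)
         - cyl_int T \<Omega>c (\<lambda>t x. f t x * V t x * \<eta> t x)
         - cyl_int T \<Omega> (\<lambda>t x. divg T \<Omega> (\<lambda>t x. u t x *\<^sub>R grad T \<Omega> V t x) t x * lam t x)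
       = \<alpha>v * cyl_int T \<Omega> (\<lambda>t x. (v t x - vd t x) * V t x)) \<and>
    (\<forall>g\<in>\<F>. 0 \<le> cyl_int T \<Omega>c
       (\<lambda>t x. (\<alpha>f * (f t x) ^ 3 + v t x * \<eta> t x) * (g t x - f t x)))"
proof -
  have \<Omega>: "open \<Omega>" and \<Omega>c: "open \<Omega>c" using assms(1,5) by (auto simp: domain_def)
  let ?Q = "cyl T \<Omega>" and ?Qc = "cyl T \<Omega>c"
  note Q = open_cyl[OF \<Omega>, of T] and Qc = open_cyl[OF \<Omega>c, of T]
  have Qs: "?Q \<in> sets lborel" "?Qc \<in> sets lborel" using Q Qc by auto
  have QcQ: "?Qc \<subseteq> ?Q" using assms(6) by (auto simp: cyl_def)
  note lm = assms(21)[unfolded lagrange_multiplier_def]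
  have lam: "lam \<in> cyl_Lp T \<Omega> 2" and \<eta>: "\<eta> \<in> cyl_Lp T \<Omega> (4/3)"
    and \<phi>1: "\<phi>1 \<in> dual_space (sobolev \<Omega> 1 2) (sobolev_norm \<Omega> 1 2)"
    and \<phi>2: "\<phi>2 \<in> dual_space (sobolev_n \<Omega> (3/2) 4) (sobolev_norm \<Omega> (3/2) 4)"
    using lm by auto
  have f\<F>: "f \<in> \<F>" and uX: "u \<in> W_space T \<Omega> 2" and vX: "v \<in> W_space T \<Omega> 4"
    using assms(20) by (auto simp: local_optimal_def admissible_def strong_solution_def W_space_def)
  let ?Z = "\<lambda>_ _. 0 :: real"
  have Z2: "?Z \<in> W0_space T \<Omega> 2" and Z4: "?Z \<in> W0_space T \<Omega> 4"
    using W0_space_zero[OF \<Omega> _ uX] W0_space_zero[OF \<Omega> _ vX] by auto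
  have cone0: "?Z \<in> cone_at \<F> f"
    unfolding cone_at_def using f\<F> by (intro CollectI exI[of _ 0] exI[of _ f]) auto
  have W0W: "w \<in> W0_space T \<Omega> p \<Longrightarrow> w \<in> W_space T \<Omega> p" for w p by (simp add: W0_space_def)
  have lam_m: "set_borel_measurable lborel ?Q (\<lambda>z. lam (fst z) (snd z))"
    and \<eta>_m: "set_borel_measurable lborel ?Q (\<lambda>z. \<eta> (fst z) (snd z))"
    using lam \<eta> by (auto simp: cyl_Lp_def Lp_space_def case_prod_beta')
  have W_m: "set_borel_measurable lborel ?Q (\<lambda>z. w (fst z) (snd z))" if "w \<in> W_space T \<Omega> p" for w p
    using W_space_cyl_measurable[OF that] by (simp add: case_prod_beta')
  have Z_m: "set_borel_measurable lborel ?Q (case_prod ?Z)" by (simp add: set_borel_measurable_def)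
  \<comment> \<open>A control is measurable only on the control cylinder; the indicator extends it
    by zero.\<close>
  have F_m: "set_borel_measurable lborel ?Q (\<lambda>z. h (fst z) (snd z) * indicator \<Omega>c (snd z))"
    if "h \<in> \<F>" for h
  proof -
    have "set_borel_measurable lborel ?Qc (case_prod h)"
      using that assms(18) by (auto simp: cyl_Lp_def Lp_space_def)
    moreover have "(\<lambda>z. indicator ?Q z *\<^sub>R (h (fst z) (snd z) * indicator \<Omega>c (snd z))) = (\<lambda>z. indicator ?Qc z *\<^sub>R case_prod h z)"
      using assms(6) by (auto simp: cyl_def indicator_def fun_eq_iff)
    ultimately show ?thesis by (simp only: set_borel_measurable_def)
  qed
  \<comment> \<open>The operators applied to the zero function return some representative, known to
    be 0 only a.e.; this is homogeneity with factor 0.\<close>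
  have dt0: "AE z in lborel. z \<in> ?Q \<longrightarrow> dt T \<Omega> ?Z (fst z) (snd z) = 0"
    using dt_scale[OF \<Omega> Z_m, of 0] by simp
  have lap0: "AE z in lborel. z \<in> ?Q \<longrightarrow> lap T \<Omega> ?Z (fst z) (snd z) = 0"
    using lap_scale[OF \<Omega> Z_m, of 0] by simp
  have grad0: "AE z in lborel. z \<in> ?Q \<longrightarrow> grad T \<Omega> ?Z (fst z) (snd z) = 0"
    using grad_scale[OF \<Omega> Z_m, of 0] by simp
  have div_flux_scale: "AE z in lborel. z \<in> ?Q \<longrightarrow>
      divg T \<Omega> (\<lambda>t x. (c * a t x) *\<^sub>R grad T \<Omega> b t x) (fst z) (snd z)
      = c * divg T \<Omega> (\<lambda>t x. a t x *\<^sub>R grad T \<Omega> b t x) (fst z) (snd z)"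
    if a: "set_borel_measurable lborel ?Q (case_prod a)" for a b c
  proof (rule divg_scale[OF \<Omega>])
    have "set_borel_measurable lborel ?Q (case_prod (\<lambda>t x. c * a t x))"
      using set_borel_measurable_cmult[OF a, of c] by (simp add: case_prod_beta')
    then show "\<And>e. e \<in> Basis \<Longrightarrow> set_borel_measurable lborel ?Q
        (\<lambda>z. ((c * a (fst z) (snd z)) *\<^sub>R grad T \<Omega> b (fst z) (snd z)) \<bullet> e)"
      by (rule flux_measurable[OF \<Omega>])
    show "\<And>e. e \<in> Basis \<Longrightarrow> set_borel_measurable lborel ?Q
        (\<lambda>z. (a (fst z) (snd z) *\<^sub>R grad T \<Omega> b (fst z) (snd z)) \<bullet> e)"
      by (rule flux_measurable[OF \<Omega> a])
  qed simp
  have div_grad_scale: "AE z in lborel. z \<in> ?Q \<longrightarrow>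
      divg T \<Omega> (\<lambda>t x. a t x *\<^sub>R grad T \<Omega> (\<lambda>t x. c * b t x) t x) (fst z) (snd z)
      = c * divg T \<Omega> (\<lambda>t x. a t x *\<^sub>R grad T \<Omega> b t x) (fst z) (snd z)"
    if a: "set_borel_measurable lborel ?Q (case_prod a)" and b: "set_borel_measurable lborel ?Q (case_prod b)" for a b c
    by (rule divg_scale[OF \<Omega> flux_measurable[OF \<Omega> a] flux_measurable[OF \<Omega> a]])
      (use grad_scale[OF \<Omega> b, of c] in \<open>auto elim!: eventually_mono simp: mult.commute\<close>)
  note u_m = W_space_cyl_measurable[OF uX] and v_m = W_space_cyl_measurable[OF vX]
  have div_zero_flux: "AE z in lborel. z \<in> ?Q \<longrightarrow>
      divg T \<Omega> (\<lambda>t x. ?Z t x *\<^sub>R grad T \<Omega> b t x) (fst z) (snd z) = 0" for b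
    using div_flux_scale[OF Z_m, of 0 b] by simp
  have div_zero_grad: "AE z in lborel. z \<in> ?Q \<longrightarrow>
      divg T \<Omega> (\<lambda>t x. u t x *\<^sub>R grad T \<Omega> ?Z t x) (fst z) (snd z) = 0"
    using div_grad_scale[OF u_m Z_m, of 0] by simp
  note meas = set_borel_measurable_mult set_borel_measurable_diff set_borel_measurable_add
    dt_measurable[OF \<Omega>] lap_measurable[OF \<Omega>] divg_measurable[OF \<Omega>] lam_m \<eta>_m

  note ineq = lm[THEN conjunct2, THEN conjunct2, THEN conjunct2, THEN conjunct2]
  \<comment> \<open>For test functions with zero initial value the two functionals drop out.\<close>
  have mult: "0 \<le> \<alpha>u * cyl_int T \<Omega>
                (\<lambda>t x. sgn (u t x - ud t x) * \<bar>u t x - ud t x\<bar> powr (13/7) * U t x)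
          + \<alpha>v * cyl_int T \<Omega> (\<lambda>t x. (v t x - vd t x) * V t x)
          + \<alpha>f * cyl_int T \<Omega>c (\<lambda>t x. (f t x) ^ 3 * F t x)
          - cyl_int T \<Omega> (\<lambda>t x.
              (dt T \<Omega> U t x - lap T \<Omega> U t x
                - divg T \<Omega> (\<lambda>t x. U t x *\<^sub>R grad T \<Omega> v t x) t x
                - divg T \<Omega> (\<lambda>t x. u t x *\<^sub>R grad T \<Omega> V t x) t x) * lam t x)
          - cyl_int T \<Omega> (\<lambda>t x.
              (dt T \<Omega> V t x - lap T \<Omega> V t x + V t x - U t x
                - f t x * V t x * indicator \<Omega>c x) * \<eta> t x)
          + cyl_int T \<Omega>c (\<lambda>t x. F t x * v t x * \<eta> t x)"
    if U: "U \<in> W0_space T \<Omega> 2" and V: "V \<in> W0_space T \<Omega> 4" and F: "F \<in> cone_at \<F> f" for U V F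
    using ineq[THEN bspec, OF W0W[OF U], THEN bspec, OF W0W[OF V], THEN bspec, OF F]
    unfolding W0_space_initial_vanishes_H1[OF \<Omega> assms(7) U \<phi>1] W0_space_initial_vanishes_W32[OF \<Omega> assms(7) V \<phi>2] diff_zero .

  define I where "I U = cyl_int T \<Omega> (\<lambda>t x. sgn (u t x - ud t x) * \<bar>u t x - ud t x\<bar> powr (13/7) * U t x)" for U
  define A where "A U = cyl_int T \<Omega> (\<lambda>t x. (dt T \<Omega> U t x - lap T \<Omega> U t x
      - divg T \<Omega> (\<lambda>t x. U t x *\<^sub>R grad T \<Omega> v t x) t x) * lam t x)" for U
  define J where "J U = cyl_int T \<Omega> (\<lambda>t x. U t x * \<eta> t x)" for U
  have U_ineq: "0 \<le> \<alpha>u * I U - A U + J U" if U: "U \<in> W0_space T \<Omega> 2" for U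
  proof -
    note U_m = W_m[OF W0W[OF U]]
    have 1: "cyl_int T \<Omega> (\<lambda>t x. (dt T \<Omega> U t x - lap T \<Omega> U t x
          - divg T \<Omega> (\<lambda>t x. U t x *\<^sub>R grad T \<Omega> v t x) t x
          - divg T \<Omega> (\<lambda>t x. u t x *\<^sub>R grad T \<Omega> ?Z t x) t x) * lam t x) = A U"
      unfolding A_def
    proof (rule cyl_int_cong_AE)
      show "AE z in lborel. z \<in> ?Q \<longrightarrow> (dt T \<Omega> U (fst z) (snd z) - lap T \<Omega> U (fst z) (snd z)
          - divg T \<Omega> (\<lambda>t x. U t x *\<^sub>R grad T \<Omega> v t x) (fst z) (snd z)
          - divg T \<Omega> (\<lambda>t x. u t x *\<^sub>R grad T \<Omega> ?Z t x) (fst z) (snd z)) * lam (fst z) (snd z)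
        = (dt T \<Omega> U (fst z) (snd z) - lap T \<Omega> U (fst z) (snd z)
          - divg T \<Omega> (\<lambda>t x. U t x *\<^sub>R grad T \<Omega> v t x) (fst z) (snd z)) * lam (fst z) (snd z)"
        using div_zero_grad by eventually_elim simp
    qed (intro meas)+
    have 2: "cyl_int T \<Omega> (\<lambda>t x. (dt T \<Omega> ?Z t x - lap T \<Omega> ?Z t x + ?Z t x - U t x
          - f t x * ?Z t x * indicator \<Omega>c x) * \<eta> t x) = cyl_int T \<Omega> (\<lambda>t x. (-1) * (U t x * \<eta> t x))"
    proof (rule cyl_int_cong_AE)
      \<comment> \<open>Simplification removes the product of \<open>f\<close> with 0 first; without
        the indicator \<open>f\<close> is not known to be measurable on the whole cylinder.\<close>
      show "set_borel_measurable lborel ?Q (\<lambda>z. (dt T \<Omega> ?Z (fst z) (snd z) - lap T \<Omega> ?Z (fst z) (snd z)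
          + ?Z (fst z) (snd z) - U (fst z) (snd z)
          - f (fst z) (snd z) * ?Z (fst z) (snd z) * indicator \<Omega>c (snd z)) * \<eta> (fst z) (snd z))"
        by (simp, intro meas U_m)
      show "set_borel_measurable lborel ?Q (\<lambda>z. (-1) * (U (fst z) (snd z) * \<eta> (fst z) (snd z)))"
        by (intro set_borel_measurable_cmult meas U_m)
      show "AE z in lborel. z \<in> ?Q \<longrightarrow> (dt T \<Omega> ?Z (fst z) (snd z) - lap T \<Omega> ?Z (fst z) (snd z)
          + ?Z (fst z) (snd z) - U (fst z) (snd z)
          - f (fst z) (snd z) * ?Z (fst z) (snd z) * indicator \<Omega>c (snd z)) * \<eta> (fst z) (snd z)
          = (-1) * (U (fst z) (snd z) * \<eta> (fst z) (snd z))"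
        using dt0 lap0 by eventually_elim simp
    qed
    show ?thesis
      using mult[OF U Z4 cone0] unfolding 1 2 cyl_int_cmult
      by (simp add: I_def J_def cyl_int_def[of _ _ "\<lambda>_ _. 0"])
  qed
  \<comment> \<open>All three terms are odd in \<open>U\<close>, so the inequality for -U is the
    reverse one. Each integrand changes sign as a whole, up to null sets, and no integral is
    split.\<close>
  have U_eq: "A U - J U = \<alpha>u * I U" if U: "U \<in> W0_space T \<Omega> 2" for U
  proof -
    let ?U = "\<lambda>t x. (-1) * U t x"
    note U_m = W_space_cyl_measurable[OF W0W[OF U]]
    have "I ?U = cyl_int T \<Omega> (\<lambda>t x. (-1) * (sgn (u t x - ud t x) * \<bar>u t x - ud t x\<bar> powr (13/7) * U t x))"
      unfolding I_def by (simp add: mult_ac)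
    then have I: "I ?U = - I U" unfolding cyl_int_cmult I_def by simp
    have "J ?U = cyl_int T \<Omega> (\<lambda>t x. (-1) * (U t x * \<eta> t x))"
      unfolding J_def by (simp add: mult_ac)
    then have J: "J ?U = - J U" unfolding cyl_int_cmult J_def by simp
    have "A ?U = cyl_int T \<Omega> (\<lambda>t x. (-1) * ((dt T \<Omega> U t x - lap T \<Omega> U t x
      - divg T \<Omega> (\<lambda>t x. U t x *\<^sub>R grad T \<Omega> v t x) t x) * lam t x))"
      unfolding A_def
    proof (rule cyl_int_cong_AE)
      show "AE z in lborel. z \<in> ?Q \<longrightarrow> (dt T \<Omega> ?U (fst z) (snd z) - lap T \<Omega> ?U (fst z) (snd z)
          - divg T \<Omega> (\<lambda>t x. ?U t x *\<^sub>R grad T \<Omega> v t x) (fst z) (snd z)) * lam (fst z) (snd z)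
        = (-1) * ((dt T \<Omega> U (fst z) (snd z) - lap T \<Omega> U (fst z) (snd z)
          - divg T \<Omega> (\<lambda>t x. U t x *\<^sub>R grad T \<Omega> v t x) (fst z) (snd z)) * lam (fst z) (snd z))"
        using dt_scale[OF \<Omega> U_m, of "-1"] lap_scale[OF \<Omega> U_m, of "-1"] div_flux_scale[OF U_m, of "-1" v]
        by eventually_elim (simp add: algebra_simps)
    qed (intro set_borel_measurable_cmult meas)+
    then have A: "A ?U = - A U" unfolding cyl_int_cmult A_def by simp
    have "0 \<le> \<alpha>u * I ?U - A ?U + J ?U"
      by (rule U_ineq) (rule W0_space_cmult[OF \<Omega> _ U], simp)
    with U_ineq[OF U] show ?thesis unfolding I J A by simp
  qed

  have f4: "case_prod f \<in> Lp_space ?Qc 4" and \<eta>43: "case_prod \<eta> \<in> Lp_space ?Q (4/3)"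
    using f\<F> assms(18) \<eta> by (auto simp: cyl_Lp_def)
  \<comment> \<open>Stated for any control \<open>h\<close> and any \<open>V\<close>: the second
    equation uses it with \<open>f\<close> and a test function, the optimality condition with
    \<open>v\<close> and both \<open>f\<close> and its competitor. The product of \<open>h\<close>
    and \<open>\<eta>\<close> is handled by Young's inequality, and \<open>V\<close> is
    bounded.\<close>
  have F_int: "set_integrable lborel ?Qc (\<lambda>z. h (fst z) (snd z) * V (fst z) (snd z) * \<eta> (fst z) (snd z))"
    if V: "V \<in> W_space T \<Omega> 4" and h: "h \<in> \<F>" for V h
  proof -
    obtain M where M: "M \<ge> 0" "AE z in lborel. z \<in> ?Q \<longrightarrow> \<bar>case_prod V z\<bar> \<le> M"
      using X_space_essentially_bounded[OF \<Omega> assms(2,4), of V T] V by (auto simp: W_space_def)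
    have h4: "case_prod h \<in> Lp_space ?Qc 4" using h assms(18) by (auto simp: cyl_Lp_def)
    have \<eta>c: "set_integrable lborel ?Qc (\<lambda>z. \<bar>case_prod \<eta> z\<bar> powr (4/3))"
      by (rule set_integrable_subset[of _ ?Q]) (use \<eta>43 Qs QcQ in \<open>auto simp: Lp_space_def\<close>)
    show ?thesis
    proof (rule set_integrable_bound')
      show "set_integrable lborel ?Qc (\<lambda>z. M * (case_prod h z ^ 4 + \<bar>case_prod \<eta> z\<bar> powr (4/3)))"
        using h4 \<eta>c by (intro set_integrable_mult_right set_integral_add) (auto simp: Lp_space_4_iff)
      show "set_borel_measurable lborel ?Qc (\<lambda>z. h (fst z) (snd z) * V (fst z) (snd z) * \<eta> (fst z) (snd z))"
        using h4 set_borel_measurable_mono[OF W_m[OF V] Qs(2) QcQ] set_borel_measurable_mono[OF \<eta>_m Qs(2) QcQ]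
        by (intro meas) (auto simp: Lp_space_def case_prod_beta')
      show "AE z in lborel. z \<in> ?Qc \<longrightarrow> \<bar>h (fst z) (snd z) * V (fst z) (snd z) * \<eta> (fst z) (snd z)\<bar>
          \<le> M * (case_prod h z ^ 4 + \<bar>case_prod \<eta> z\<bar> powr (4/3))"
        using M(2)
      proof eventually_elim
        case (elim z)
        show ?case
        proof
          assume "z \<in> ?Qc"
          then have "\<bar>V (fst z) (snd z)\<bar> \<le> M" using elim QcQ by (auto simp: case_prod_beta')
          then have "\<bar>V (fst z) (snd z)\<bar> * \<bar>h (fst z) (snd z) * \<eta> (fst z) (snd z)\<bar>
              \<le> M * (h (fst z) (snd z) ^ 4 + \<bar>\<eta> (fst z) (snd z)\<bar> powr (4/3))"
            using M(1) young_4 by (intro mult_mono) auto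
          then show "\<bar>h (fst z) (snd z) * V (fst z) (snd z) * \<eta> (fst z) (snd z)\<bar>
              \<le> M * (case_prod h z ^ 4 + \<bar>case_prod \<eta> z\<bar> powr (4/3))"
            by (simp add: case_prod_beta' abs_mult mult_ac)
        qed
      qed
    qed
  qed

  define I' where "I' V = cyl_int T \<Omega> (\<lambda>t x. (v t x - vd t x) * V t x)" for V
  define P where "P V = cyl_int T \<Omega> (\<lambda>t x. divg T \<Omega> (\<lambda>t x. u t x *\<^sub>R grad T \<Omega> V t x) t x * lam t x)" for V
  \<comment> \<open>The integrand is kept whole here, so that oddness in \<open>V\<close> follows
    without integrability; the integral is separated only in \<open>Y_split\<close>.\<close>
  define Y where "Y V = cyl_int T \<Omega> (\<lambda>t x. (dt T \<Omega> V t x - lap T \<Omega> V t x + V t x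
      - f t x * V t x * indicator \<Omega>c x) * \<eta> t x)" for V
  have fV_m: "set_borel_measurable lborel ?Q (\<lambda>z. f (fst z) (snd z) * w (fst z) (snd z) * indicator \<Omega>c (snd z))"
    if "w \<in> W_space T \<Omega> 4" for w
    using set_borel_measurable_mult[OF F_m[OF f\<F>] W_m[OF that]] by (simp add: mult_ac)
  have V_ineq: "0 \<le> \<alpha>v * I' V + P V - Y V" if V: "V \<in> W0_space T \<Omega> 4" for V
  proof -
    note V_m = W_m[OF W0W[OF V]]
    have 1: "cyl_int T \<Omega> (\<lambda>t x. (dt T \<Omega> ?Z t x - lap T \<Omega> ?Z t x
          - divg T \<Omega> (\<lambda>t x. ?Z t x *\<^sub>R grad T \<Omega> v t x) t x
          - divg T \<Omega> (\<lambda>t x. u t x *\<^sub>R grad T \<Omega> V t x) t x) * lam t x)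
        = cyl_int T \<Omega> (\<lambda>t x. (-1) * (divg T \<Omega> (\<lambda>t x. u t x *\<^sub>R grad T \<Omega> V t x) t x * lam t x))"
    proof (rule cyl_int_cong_AE)
      show "AE z in lborel. z \<in> ?Q \<longrightarrow> (dt T \<Omega> ?Z (fst z) (snd z) - lap T \<Omega> ?Z (fst z) (snd z)
          - divg T \<Omega> (\<lambda>t x. ?Z t x *\<^sub>R grad T \<Omega> v t x) (fst z) (snd z)
          - divg T \<Omega> (\<lambda>t x. u t x *\<^sub>R grad T \<Omega> V t x) (fst z) (snd z)) * lam (fst z) (snd z)
        = (-1) * (divg T \<Omega> (\<lambda>t x. u t x *\<^sub>R grad T \<Omega> V t x) (fst z) (snd z) * lam (fst z) (snd z))"
        using dt0 lap0 div_zero_flux[of v] by eventually_elim simp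
    qed (intro set_borel_measurable_cmult meas)+
    show ?thesis
      using mult[OF Z2 V cone0] unfolding 1 cyl_int_cmult
      by (simp add: I'_def P_def Y_def cyl_int_def[of _ _ "\<lambda>_ _. 0"])
  qed
  have V_eq: "Y V - P V = \<alpha>v * I' V" if V: "V \<in> W0_space T \<Omega> 4" for V
  proof -
    let ?V = "\<lambda>t x. (-1) * V t x"
    note V_m = W_space_cyl_measurable[OF W0W[OF V]] and V_m' = W_m[OF W0W[OF V]]
    have nV: "?V \<in> W_space T \<Omega> 4" by (rule W_space_cmult[OF \<Omega> _ W0W[OF V]]) simp
    have "I' ?V = cyl_int T \<Omega> (\<lambda>t x. (-1) * ((v t x - vd t x) * V t x))"
      unfolding I'_def by (simp add: mult_ac)
    then have I: "I' ?V = - I' V" unfolding cyl_int_cmult I'_def by simp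
    have "P ?V = cyl_int T \<Omega> (\<lambda>t x. (-1) * (divg T \<Omega> (\<lambda>t x. u t x *\<^sub>R grad T \<Omega> V t x) t x * lam t x))"
      unfolding P_def
    proof (rule cyl_int_cong_AE)
      show "AE z in lborel. z \<in> ?Q \<longrightarrow>
          divg T \<Omega> (\<lambda>t x. u t x *\<^sub>R grad T \<Omega> ?V t x) (fst z) (snd z) * lam (fst z) (snd z)
        = (-1) * (divg T \<Omega> (\<lambda>t x. u t x *\<^sub>R grad T \<Omega> V t x) (fst z) (snd z) * lam (fst z) (snd z))"
        using div_grad_scale[OF u_m V_m, of "-1"] by eventually_elim simp
    qed (intro set_borel_measurable_cmult meas)+
    then have P: "P ?V = - P V" unfolding cyl_int_cmult P_def by simp
    have "Y ?V = cyl_int T \<Omega> (\<lambda>t x. (-1) * ((dt T \<Omega> V t x - lap T \<Omega> V t x + V t x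
      - f t x * V t x * indicator \<Omega>c x) * \<eta> t x))"
      unfolding Y_def
    proof (rule cyl_int_cong_AE)
      show "AE z in lborel. z \<in> ?Q \<longrightarrow> (dt T \<Omega> ?V (fst z) (snd z) - lap T \<Omega> ?V (fst z) (snd z)
          + ?V (fst z) (snd z) - f (fst z) (snd z) * ?V (fst z) (snd z) * indicator \<Omega>c (snd z)) * \<eta> (fst z) (snd z)
        = (-1) * ((dt T \<Omega> V (fst z) (snd z) - lap T \<Omega> V (fst z) (snd z)
          + V (fst z) (snd z) - f (fst z) (snd z) * V (fst z) (snd z) * indicator \<Omega>c (snd z)) * \<eta> (fst z) (snd z))"
        using dt_scale[OF \<Omega> V_m, of "-1"] lap_scale[OF \<Omega> V_m, of "-1"]
        by eventually_elim (simp add: algebra_simps)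
    qed (intro set_borel_measurable_cmult meas fV_m[OF nV] fV_m[OF W0W[OF V]] W_m[OF nV] V_m')+
    then have Y: "Y ?V = - Y V" unfolding cyl_int_cmult Y_def by simp
    have "0 \<le> \<alpha>v * I' ?V + P ?V - Y ?V"
      by (rule V_ineq) (rule W0_space_cmult[OF \<Omega> _ V], simp)
    with V_ineq[OF V] show ?thesis unfolding I P Y by simp
  qed
  have Y_split: "Y V = cyl_int T \<Omega> (\<lambda>t x. (dt T \<Omega> V t x - lap T \<Omega> V t x + V t x) * \<eta> t x)
      - cyl_int T \<Omega>c (\<lambda>t x. f t x * V t x * \<eta> t x)" if V: "V \<in> W0_space T \<Omega> 4" for V
  proof -
    have VX: "V \<in> X_space T \<Omega> 4" using W0W[OF V] by (simp add: W_space_def)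
    \<comment> \<open>The Laplacian is added with factor -1 to fit the closure of L^4 under sums and
      multiples.\<close>
    have "(\<lambda>z. (dt T \<Omega> V (fst z) (snd z) + (-1) * lap T \<Omega> V (fst z) (snd z)) + V (fst z) (snd z)) \<in> Lp_space ?Q 4"
      using VX by (intro Lp_space_4_add Lp_space_cmult X_space_dt_Lp X_space_lap_Lp \<Omega> Qs)
        (auto simp: X_space_def cyl_Lp_def case_prod_beta')
    from Lp_product_integrable[OF Qs(1) this \<eta>43]
    have i1: "set_integrable lborel ?Q (\<lambda>z. (dt T \<Omega> V (fst z) (snd z) - lap T \<Omega> V (fst z) (snd z)
        + V (fst z) (snd z)) * \<eta> (fst z) (snd z))" by (simp add: case_prod_beta')
    have ind: "(\<lambda>z. indicator ?Q z *\<^sub>R (f (fst z) (snd z) * V (fst z) (snd z) * indicator \<Omega>c (snd z) * \<eta> (fst z) (snd z)))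
        = (\<lambda>z. indicator ?Qc z *\<^sub>R (f (fst z) (snd z) * V (fst z) (snd z) * \<eta> (fst z) (snd z)))"
      using assms(6) by (auto simp: cyl_def indicator_def fun_eq_iff)
    have i2: "set_integrable lborel ?Q (\<lambda>z. f (fst z) (snd z) * V (fst z) (snd z) * indicator \<Omega>c (snd z) * \<eta> (fst z) (snd z))"
      using F_int[OF W0W[OF V] f\<F>] unfolding set_integrable_def ind .
    have "Y V = (LBINT z:?Q. (dt T \<Omega> V (fst z) (snd z) - lap T \<Omega> V (fst z) (snd z)
        + V (fst z) (snd z)) * \<eta> (fst z) (snd z)
        - f (fst z) (snd z) * V (fst z) (snd z) * indicator \<Omega>c (snd z) * \<eta> (fst z) (snd z))"
      by (simp add: Y_def cyl_int_def case_prod_beta' left_diff_distrib)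
    also have "\<dots> = (LBINT z:?Q. (dt T \<Omega> V (fst z) (snd z) - lap T \<Omega> V (fst z) (snd z)
        + V (fst z) (snd z)) * \<eta> (fst z) (snd z))
        - (LBINT z:?Q. f (fst z) (snd z) * V (fst z) (snd z) * indicator \<Omega>c (snd z) * \<eta> (fst z) (snd z))"
      by (rule set_integral_diff(2)[OF i1 i2])
    also have "(LBINT z:?Q. f (fst z) (snd z) * V (fst z) (snd z) * indicator \<Omega>c (snd z) * \<eta> (fst z) (snd z))
        = (LBINT z:?Qc. f (fst z) (snd z) * V (fst z) (snd z) * \<eta> (fst z) (snd z))"
      unfolding set_lebesgue_integral_def ind ..
    finally show ?thesis by (simp add: cyl_int_def case_prod_beta')
  qed

  have F_ineq: "0 \<le> cyl_int T \<Omega>c (\<lambda>t x. (\<alpha>f * (f t x) ^ 3 + v t x * \<eta> t x) * (g t x - f t x))"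
    if g: "g \<in> \<F>" for g
  proof -
    \<comment> \<open>The factor 1 is the \<theta> of the cone.\<close>
    let ?F = "\<lambda>t x. 1 * (g t x - f t x)"
    have cone: "?F \<in> cone_at \<F> f"
      unfolding cone_at_def using g by (intro CollectI exI[of _ 1] exI[of _ g]) auto
    have 1: "cyl_int T \<Omega> (\<lambda>t x. (dt T \<Omega> ?Z t x - lap T \<Omega> ?Z t x
          - divg T \<Omega> (\<lambda>t x. ?Z t x *\<^sub>R grad T \<Omega> v t x) t x
          - divg T \<Omega> (\<lambda>t x. u t x *\<^sub>R grad T \<Omega> ?Z t x) t x) * lam t x) = 0"
      by (rule cyl_int_AE_zero)
        (use dt0 lap0 div_zero_flux[of v] div_zero_grad in \<open>eventually_elim, simp\<close>)
    have 2: "cyl_int T \<Omega> (\<lambda>t x. (dt T \<Omega> ?Z t x - lap T \<Omega> ?Z t x + ?Z t x - ?Z t x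
          - f t x * ?Z t x * indicator \<Omega>c x) * \<eta> t x) = 0"
      by (rule cyl_int_AE_zero) (use dt0 lap0 in \<open>eventually_elim, simp\<close>)
    \<comment> \<open>Young's inequality with the cube of \<open>f\<close> in the second slot: its
      4/3 power is f^4, so the product is dominated by h^4 + f^4.\<close>
    have i: "set_integrable lborel ?Qc (\<lambda>z. f (fst z) (snd z) ^ 3 * h (fst z) (snd z))" if h: "h \<in> \<F>" for h
    proof (rule set_integrable_bound')
      have h4: "case_prod h \<in> Lp_space ?Qc 4" using h assms(18) by (auto simp: cyl_Lp_def)
      show "set_integrable lborel ?Qc (\<lambda>z. case_prod h z ^ 4 + case_prod f z ^ 4)"
        using h4 f4 by (intro set_integral_add) (auto simp: Lp_space_4_iff)
      show "set_borel_measurable lborel ?Qc (\<lambda>z. f (fst z) (snd z) ^ 3 * h (fst z) (snd z))"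
        using h4 f4 Qs set_borel_measurable_comp[of lborel ?Qc "case_prod f" "\<lambda>x. x ^ 3"]
        by (intro meas) (auto simp: Lp_space_def case_prod_beta')
      have pw: "\<bar>a ^ 3\<bar> powr (4/3) = a ^ 4" for a :: real
      proof -
        have "\<bar>a ^ 3\<bar> powr (4/3) = (\<bar>a\<bar> powr 3) powr (4/3)" by (simp add: power_abs)
        also have "\<dots> = \<bar>a\<bar> powr (3 * (4/3))" by (simp only: powr_powr)
        finally show ?thesis by simp
      qed
      show "AE z in lborel. z \<in> ?Qc \<longrightarrow> \<bar>f (fst z) (snd z) ^ 3 * h (fst z) (snd z)\<bar>
          \<le> case_prod h z ^ 4 + case_prod f z ^ 4"
      proof (intro AE_I2 impI)
        fix z
        show "\<bar>f (fst z) (snd z) ^ 3 * h (fst z) (snd z)\<bar> \<le> case_prod h z ^ 4 + case_prod f z ^ 4"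
          using young_4[of "h (fst z) (snd z)" "f (fst z) (snd z) ^ 3"] unfolding pw
          by (simp add: case_prod_beta' mult.commute)
      qed
    qed
    have i1: "set_integrable lborel ?Qc (\<lambda>z. \<alpha>f * (f (fst z) (snd z) ^ 3 * (g (fst z) (snd z) - f (fst z) (snd z))))"
    proof (rule set_integrable_mult_right)
      show "set_integrable lborel ?Qc (\<lambda>z. f (fst z) (snd z) ^ 3 * (g (fst z) (snd z) - f (fst z) (snd z)))"
        unfolding right_diff_distrib by (rule set_integral_diff(1)[OF i[OF g] i[OF f\<F>]])
    qed
    have i2: "set_integrable lborel ?Qc (\<lambda>z. (g (fst z) (snd z) - f (fst z) (snd z)) * v (fst z) (snd z) * \<eta> (fst z) (snd z))"
      using set_integral_diff(1)[OF F_int[OF vX g] F_int[OF vX f\<F>]] by (simp add: left_diff_distrib)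
    have "cyl_int T \<Omega>c (\<lambda>t x. (\<alpha>f * (f t x) ^ 3 + v t x * \<eta> t x) * (g t x - f t x))
        = (LBINT z:?Qc. \<alpha>f * (f (fst z) (snd z) ^ 3 * (g (fst z) (snd z) - f (fst z) (snd z)))
          + (g (fst z) (snd z) - f (fst z) (snd z)) * v (fst z) (snd z) * \<eta> (fst z) (snd z))"
      by (simp add: cyl_int_def case_prod_beta' algebra_simps)
    also have "\<dots> = \<alpha>f * cyl_int T \<Omega>c (\<lambda>t x. (f t x) ^ 3 * ?F t x)
        + cyl_int T \<Omega>c (\<lambda>t x. ?F t x * v t x * \<eta> t x)"
      unfolding set_integral_add(2)[OF i1 i2] by (simp add: cyl_int_def case_prod_beta')
    finally show ?thesis
      using mult[OF Z2 Z4 cone] unfolding 1 2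
      by (simp add: cyl_int_def[of _ _ "\<lambda>_ _. 0"])
  qed

  show ?thesis
    using lam \<eta> U_eq[unfolded A_def J_def I_def] V_eq[unfolded P_def I'_def] Y_split F_ineq
    by (intro conjI ballI) auto
qed

end
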